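(* Let $\mathcal{E}_1$ and $\mathcal{E}_2$ be two ellipsoids in $\mathbb{R}^3$. If $\mathcal{E}_1$ and $\mathcal{E}_2$ have the same volume, the same surface area and the same mean width, then $\mathcal{E}_1$ and $\mathcal{E}_2$ are congruent, i.e. there is an isometry of $\mathbb{R}^3$ mapping $\mathcal{E}_1$ onto $\mathcal{E}_2$.
   Context: An ellipsoid in $\mathbb{R}^3$ is a solid (filled) nondegenerate ellipsoid, i.e. the image under an isometry of $\mathbb{R}^3$ of a set $\{(x,y,z)\in\mathbb{R}^3 : x^2/a^2+y^2/b^2+z^2/c^2\le 1\}$ with semiaxes $a,b,c>0$. Volume is 3-dimensional Lebesgue measure; surface area is the 2-dimensional area of the boundary; the mean width of a convex body $K$ is the average, over unit vectors $u$ distributed uniformly on the unit sphere, of the width $\max_{x\in K}\langle x,u\rangle-\min_{x\in K}\langle x,u\rangle$. Equivalently, up to constant factors these three quantities are the intrinsic volumes $V_3$, $V_2$, $V_1$, which for a compact convex set $K\subset\mathbb{R}^3$ are defined by the Steiner formula $\mathrm{Vol}(K+tB_3)=\sum_{k=0}^3\kappa_{3-k}V_k(K)t^{3-k}$ for $t\ge 0$, where $B_3$ is the closed Euclidean unit ball and $\kappa_j=\pi^{j/2}/\Gamma(\frac j2+1)$ is the volume of the $j$-dimensional unit ball. *)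

theory Defs
  imports "HOL-Analysis.Analysis"
begin

definition isometry :: "(real^3 \<Rightarrow> real^3) \<Rightarrow> bool" where
  "isometry f \<longleftrightarrow> surj f \<and> (\<forall>x y. dist (f x) (f y) = dist x y)"

definition axis_ellipsoid :: "real \<Rightarrow> real \<Rightarrow> real \<Rightarrow> (real^3) set" where
  "axis_ellipsoid a b c =
     {x. (x $ 1)\<^sup>2 / a\<^sup>2 + (x $ 2)\<^sup>2 / b\<^sup>2 + (x $ 3)\<^sup>2 / c\<^sup>2 \<le> 1}"

definition ellipsoid :: "(real^3) set \<Rightarrow> bool" where
  "ellipsoid E \<longleftrightarrow>
     (\<exists>f a b c. isometry f \<and> a > 0 \<and> b > 0 \<and> c > 0 \<and> E = f ` axis_ellipsoid a b c)"

text \<open>Two-dimensional area is two-dimensional Hausdorff (outer) measure. A covering set of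
  diameter \<open>d\<close> contributes the area \<open>pi * (d / 2)\<^sup>2\<close> of a planar disc of that diameter, so that
  the value on planar sets is Lebesgue area. The covering sets are required to be bounded because
  \<^const>\<open>diameter\<close> has no meaningful value on unbounded sets.\<close>

definition small_covers :: "real \<Rightarrow> (real^3) set \<Rightarrow> (nat \<Rightarrow> (real^3) set) set" where
  "small_covers \<delta> S =
     {C. S \<subseteq> (\<Union>i. C i) \<and> (\<forall>i. bounded (C i) \<and> diameter (C i) \<le> \<delta>)}"

definition area :: "(real^3) set \<Rightarrow> ennreal" where
  "area S =
     (SUP \<delta>\<in>{0<..}. INF C\<in>small_covers \<delta> S. \<Sum>i. ennreal (pi * (diameter (C i) / 2)\<^sup>2))"

definition surface_area :: "(real^3) set \<Rightarrow> ennreal" where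
  "surface_area K = area (frontier K)"

definition width :: "(real^3) set \<Rightarrow> real^3 \<Rightarrow> real" where
  "width K u = (SUP x\<in>K. x \<bullet> u) - (INF x\<in>K. x \<bullet> u)"

text \<open>The uniform distribution on the unit sphere is the distribution of the direction \<open>x / |x|\<close> of
  a point \<open>x\<close> chosen uniformly in the unit ball; the value of \<^const>\<open>sgn\<close> at the centre is
  irrelevant because the centre has measure zero.\<close>

definition uniform_sphere :: "(real^3) measure" where
  "uniform_sphere = distr (uniform_measure lborel (ball 0 1)) borel sgn"

definition mean_width :: "(real^3) set \<Rightarrow> real" where
  "mean_width K = (LINT u|uniform_sphere. width K u)"

end

theory Submission
  imports Defs "HOL-Probability.Distributions"
begin

text \<open>
  Let \<open>a, b, c\<close> be the semiaxes of an ellipsoid \<open>E\<close>, let \<open>A = scale3 a b c\<close> be the diagonal map with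
  these entries, and let \<open>m(a, b, c)\<close> be the mean of \<open>|A u|\<close> over the unit sphere. The width of
  \<open>E\<close> in a direction \<open>u\<close> is \<open>2 |A u|\<close> up to a rotation of \<open>u\<close>, so the mean width is
  \<open>2 m(a, b, c)\<close>; the volume is a multiple of \<open>a b c\<close>; and the surface area is a multiple of
  \<open>a b c m(1/a, 1/b, 1/c)\<close> (lemma \<open>area_scaled_sphere\<close>), because \<open>A\<close> stretches the tangent plane of
  the sphere at \<open>u\<close> by the factor \<open>a b c |A\<^sup>-\<^sup>1 u|\<close>. It must be shown that \<open>a b c\<close>,
  \<open>m(a, b, c)\<close> and \<open>m(1/a, 1/b, 1/c)\<close> determine the semiaxes up to order.

  \<^bold>\<open>Uniqueness.\<close> Averaging over a Gaussian instead of the sphere only changes \<open>m\<close> by a constant factor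
  (\<open>radial_integral\<close>). For \<open>q \<ge> 0\<close> the number \<open>sqrt q\<close> is a constant times the integral of
  \<open>(1 - exp (- t q)) t\<^bsup>-3/2\<^esup>\<close> over \<open>t > 0\<close>, and Gaussian averages of \<open>exp (- t |A x|\<^sup>2)\<close> are explicit,
  so \<open>m(a, b, c)\<close> is a constant times the integral of \<open>(1 - P(t)\<^bsup>-1/2\<^esup>) t\<^bsup>-3/2\<^esup>\<close>, where
  \<open>P(t) = (1 + t a\<^sup>2) (1 + t b\<^sup>2) (1 + t c\<^sup>2)\<close>. With \<open>1/t\<close> in place of \<open>t\<close> one gets
  \<open>m(1/a, 1/b, 1/c)\<close> from the same polynomial as an integral of
  \<open>(1 - a b c t\<^bsup>3/2\<^esup> P(t)\<^bsup>-1/2\<^esup>) t\<^bsup>-1/2\<^esup>\<close>. Suppose that a second ellipsoid, with polynomial \<open>P'\<close>, has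
  the same three invariants, and let \<open>u = P\<^bsup>-1/2\<^esup> - P'\<^bsup>-1/2\<^esup>\<close>. Then the integrals of \<open>t\<^bsup>-3/2\<^esup> u\<close> and of
  \<open>t u\<close> vanish. On the other hand \<open>P\<close> and \<open>P'\<close> have the same cubic coefficient, so that
  \<open>P' - P = t (d1 + d2 t)\<close> changes sign at most once, and so does \<open>u\<close>. A suitable combination of
  \<open>t\<^bsup>-3/2\<^esup>\<close> and \<open>t\<close> changes sign at the same point, and its product with \<open>u\<close> would be positive
  almost everywhere with integral zero, unless \<open>d1 = d2 = 0\<close> (\<open>moments_vanish_imp_eq\<close>). Hence
  \<open>P = P'\<close>, and the squared semiaxes agree as multisets.

  \<^bold>\<open>Surface area.\<close> Area is Hausdorff measure, so the formula for the area of \<open>A S\<close>, with \<open>S\<close> the unit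
  sphere, has to be derived from coverings. It is expressed relative to the area of \<open>S\<close>, which is
  positive and finite, and rests on three facts. First, area is a metric outer measure
  and hence a measure on Borel sets (\<open>emeasure_area_measure\<close>), and an \<open>L\<close>-Lipschitz map increases it at most
  by the factor \<open>L\<^sup>2\<close>. Second, in a plane it is invariant under translations and therefore
  proportional to Lebesgue measure, measured here as the volume of a slab of height 2 over the set
  (\<open>planar_area_proportional_slab\<close>); so a linear map scales planar area by a determinant
  (\<open>area_linear_image_planar\<close>). Third, a cap of small radius \<open>r\<close> is nearly isometric to its projection to the
  tangent plane, also after applying \<open>A\<close>, so the area of the image of a cap around \<open>x\<close> is
  \<open>a b c |A\<^sup>-\<^sup>1 x|\<close> times the area of the cap, up to a factor near 1 that is uniform in \<open>x\<close>
  (\<open>area_cap_image\<close>). Now average the area of the image of the cap over all centres \<open>x\<close>: by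
  Tonelli's theorem this is the probability of a cap times the area of \<open>A S\<close>
  (\<open>average_cap_area\<close>). Comparing with the case \<open>A = id\<close> and letting \<open>r\<close> tend to 0 gives the formula.
\<close>

section \<open>Two-dimensional Hausdorff measure as a Borel measure\<close>

abbreviation disc_area :: "(real^3) set \<Rightarrow> ennreal" where
  "disc_area C \<equiv> ennreal (pi * (diameter C / 2)\<^sup>2)"

text \<open>The size-\<open>\<delta>\<close> approximation of area; it increases to the area as \<open>\<delta>\<close> decreases to 0.\<close>

definition area_at :: "real \<Rightarrow> (real^3) set \<Rightarrow> ennreal" where
  "area_at \<delta> S = (INF C\<in>small_covers \<delta> S. \<Sum>i. disc_area (C i))"

lemma area_eq_SUP: "area S = (SUP \<delta>\<in>{0<..}. area_at \<delta> S)"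
  by (simp add: area_def area_at_def)

lemma area_at_le: "C \<in> small_covers \<delta> S \<Longrightarrow> area_at \<delta> S \<le> (\<Sum>i. disc_area (C i))"
  unfolding area_at_def by (rule INF_lower)

lemma area_at_le_area: "\<delta> > 0 \<Longrightarrow> area_at \<delta> S \<le> area S"
  unfolding area_eq_SUP by (rule SUP_upper) simp

lemma area_leI: "(\<And>\<delta>. \<delta> > 0 \<Longrightarrow> area_at \<delta> S \<le> x) \<Longrightarrow> area S \<le> x"
  unfolding area_eq_SUP by (rule SUP_least) auto

lemma area_at_mono: "S \<subseteq> T \<Longrightarrow> area_at \<delta> S \<le> area_at \<delta> T"
  unfolding area_at_def small_covers_def by (rule INF_superset_mono) auto

lemma area_at_antimono:
  assumes "\<delta> \<le> \<delta>'" shows "area_at \<delta>' S \<le> area_at \<delta> S"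
  unfolding area_at_def
proof (rule INF_superset_mono)
  show "small_covers \<delta> S \<subseteq> small_covers \<delta>' S"
    using assms unfolding small_covers_def by (auto intro: order_trans)
qed simp

lemma area_mono: "S \<subseteq> T \<Longrightarrow> area S \<le> area T"
  by (rule area_leI) (rule order_trans[OF area_at_mono area_at_le_area])

lemma area_empty [simp]: "area {} = 0"
proof -
  have "area {} \<le> 0"
  proof (rule area_leI)
    fix \<delta> :: real assume "\<delta> > 0"
    then have "(\<lambda>i. {}) \<in> small_covers \<delta> {}" by (simp add: small_covers_def)
    from area_at_le[OF this] show "area_at \<delta> {} \<le> 0" by simp
  qed
  then show ?thesis by simp
qed

lemma area_eq_SUP_nat: "area S = (SUP n. area_at (1 / real (Suc n)) S)"
proof (rule antisym)
  show "area S \<le> (SUP n. area_at (1 / real (Suc n)) S)"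
  proof (rule area_leI)
    fix \<delta> :: real assume "\<delta> > 0"
    then obtain n where n: "1 / real (Suc n) < \<delta>"
      using nat_approx_posE by blast
    show "area_at \<delta> S \<le> (SUP n. area_at (1 / real (Suc n)) S)"
      by (rule SUP_upper2[of n]) (use n area_at_antimono in auto)
  qed
  show "(SUP n. area_at (1 / real (Suc n)) S) \<le> area S"
    by (rule SUP_least) (auto intro: area_at_le_area)
qed

lemma incseq_area_at: "incseq (\<lambda>n. area_at (1 / real (Suc n)) S)"
  by (auto simp: incseq_def intro!: area_at_antimono frac_le)

text \<open>Choose for each set a cover that is optimal up to \<open>e 2\<^bsup>-n-1\<^esup>\<close> and enumerate all covering sets in one sequence.\<close>

lemma area_at_UN_le: "area_at \<delta> (\<Union>n. S n) \<le> (\<Sum>n. area_at \<delta> (S n))"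
proof (rule ennreal_le_epsilon)
  fix e :: real assume e: "0 < e" and fin: "(\<Sum>n. area_at \<delta> (S n)) < top"
  have "\<exists>C\<in>small_covers \<delta> (S n). (\<Sum>i. disc_area (C i)) < area_at \<delta> (S n) + ennreal (e * (1/2)^Suc n)" for n
  proof (rule INF_approx_ennreal)
    show "0 < e * (1/2)^Suc n" using e by simp
    show "area_at \<delta> (S n) = (INF C\<in>small_covers \<delta> (S n). \<Sum>i. disc_area (C i))"
      by (simp add: area_at_def)
    have "area_at \<delta> (S n) \<le> (\<Sum>n. area_at \<delta> (S n))"
      using sum_le_suminf[of "\<lambda>n. area_at \<delta> (S n)" "{n}"] by simp
    then show "area_at \<delta> (S n) \<noteq> \<infinity>" using fin by (auto simp: top_unique)
  qed
  then obtain C where C: "\<And>n. C n \<in> small_covers \<delta> (S n)"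
    and le: "\<And>n. (\<Sum>i. disc_area (C n i)) < area_at \<delta> (S n) + ennreal (e * (1/2)^Suc n)"
    by metis
  let ?D = "\<lambda>i. case prod_decode i of (m, n) \<Rightarrow> C m n"
  have cov: "?D \<in> small_covers \<delta> (\<Union>n. S n)"
  proof -
    have "(\<Union>n. S n) \<subseteq> (\<Union>i. ?D i)"
    proof safe
      fix x n assume "x \<in> S n"
      then obtain i where "x \<in> C n i" using C[of n] by (auto simp: small_covers_def)
      then have "x \<in> ?D (prod_encode (n, i))" by simp
      then show "x \<in> (\<Union>i. ?D i)" by (rule UN_I[OF UNIV_I])
    qed
    then show ?thesis using C by (auto simp: small_covers_def split: prod.splits)
  qed
  have "area_at \<delta> (\<Union>n. S n) \<le> (\<Sum>i. disc_area (?D i))" by (rule area_at_le[OF cov])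
  also have "\<dots> = (\<Sum>i. (\<lambda>(m,n). disc_area (C m n)) (prod_decode i))"
    by (intro arg_cong[of _ _ suminf] ext) (simp split: prod.splits)
  also have "\<dots> = (\<Sum>n. \<Sum>i. disc_area (C n i))"
    by (rule suminf_ennreal_2dimen) simp
  also have "\<dots> \<le> (\<Sum>n. area_at \<delta> (S n) + ennreal (e * (1/2)^Suc n))"
    by (intro suminf_le allI) (use less_imp_le[OF le] in auto)
  also have "\<dots> = (\<Sum>n. area_at \<delta> (S n)) + (\<Sum>n. ennreal (e * (1/2)^Suc n))"
    by (rule suminf_add[symmetric]) auto
  also have "(\<Sum>n. ennreal (e * (1/2)^Suc n)) = ennreal e"
    using sums_mult[OF power_half_series, of e] e by (intro suminf_ennreal_eq) auto
  finally show "area_at \<delta> (\<Union>n. S n) \<le> (\<Sum>n. area_at \<delta> (S n)) + ennreal e" .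
qed

lemma area_UN_le: "area (\<Union>n. S n) \<le> (\<Sum>n. area (S n))"
proof (rule area_leI)
  fix \<delta> :: real assume "\<delta> > 0"
  have "area_at \<delta> (\<Union>n. S n) \<le> (\<Sum>n. area_at \<delta> (S n))" by (rule area_at_UN_le)
  also have "\<dots> \<le> (\<Sum>n. area (S n))"
    by (intro suminf_le) (auto intro: area_at_le_area[OF \<open>\<delta> > 0\<close>])
  finally show "area_at \<delta> (\<Union>n. S n) \<le> (\<Sum>n. area (S n))" .
qed

lemma outer_measure_space_area: "outer_measure_space (Pow UNIV) area"
  unfolding outer_measure_space_def positive_def increasing_def countably_subadditive_def
  using area_mono area_UN_le by auto

lemma area_Un_le: "area (S \<union> T) \<le> area S + area T"
proof -
  have "subadditive (Pow UNIV) area"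
    using outer_measure_space_area ring_of_sets.countably_subadditive_subadditive[OF ring_of_sets_Pow]
    unfolding outer_measure_space_def by blast
  then have "area (S \<union> (T - S)) \<le> area S + area (T - S)"
    unfolding subadditive_def by blast
  also have "\<dots> \<le> area S + area T" by (intro add_left_mono area_mono) auto
  finally show ?thesis by (simp add: Un_Diff_cancel)
qed

lemma area_UN_finite_le: "finite I \<Longrightarrow> area (\<Union>i\<in>I. S i) \<le> (\<Sum>i\<in>I. area (S i))"
proof (induction I rule: finite_induct)
  case (insert i I)
  then show ?case using area_Un_le[of "S i" "\<Union>i\<in>I. S i"]
    by (simp add: add_left_mono order_trans)
qed simp

text \<open>Once \<open>\<delta>\<close> is below the distance of the two sets, no covering set meets both, so every cover of the union splits into covers of the parts.\<close>

lemma area_separated: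
  assumes "\<eta> > 0" and sep: "\<And>x y. x \<in> S \<Longrightarrow> y \<in> T \<Longrightarrow> \<eta> \<le> dist x y"
  shows "area S + area T \<le> area (S \<union> T)"
proof -
  have at: "area_at \<delta> S + area_at \<delta> T \<le> area_at \<delta> (S \<union> T)" if "\<delta> < \<eta>" for \<delta>
    unfolding area_at_def[of \<delta> "S \<union> T"]
  proof (rule INF_greatest)
    fix C assume C: "C \<in> small_covers \<delta> (S \<union> T)"
    have bd: "bounded (C i)" "diameter (C i) \<le> \<delta>" for i using C by (auto simp: small_covers_def)
    have cov: "(\<lambda>i. C i \<inter> U) \<in> small_covers \<delta> U" if "U \<subseteq> S \<union> T" for U
      unfolding small_covers_def
    proof (safe, goal_cases)
      case (1 x)
      then have "x \<in> S \<union> T" using that by blast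
      then have "x \<in> (\<Union>i. C i)" using C unfolding small_covers_def by blast
      then show ?case using 1 by blast
    next
      case (2 i) then show ?case using bd by (simp add: bounded_Int)
    next
      case (3 i) then show ?case using diameter_subset[of "C i \<inter> U" "C i"] bd[of i] by auto
    qed
    have "area_at \<delta> S + area_at \<delta> T \<le> (\<Sum>i. disc_area (C i \<inter> S)) + (\<Sum>i. disc_area (C i \<inter> T))"
      by (intro add_mono area_at_le cov) auto
    also have "\<dots> = (\<Sum>i. disc_area (C i \<inter> S) + disc_area (C i \<inter> T))"
      by (rule suminf_add) auto
    also have "\<dots> \<le> (\<Sum>i. disc_area (C i))"
    proof (intro suminf_le allI)
      fix i
      have sub: "disc_area (C i \<inter> U) \<le> disc_area (C i)" for U
        using diameter_subset[of "C i \<inter> U" "C i"] bd[of i] diameter_ge_0[of "C i \<inter> U"]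
        by (intro ennreal_leI mult_left_mono power_mono divide_right_mono) (auto intro: bounded_Int)
      have "C i \<inter> S = {} \<or> C i \<inter> T = {}"
      proof (rule ccontr)
        assume "\<not> ?thesis"
        then obtain x y where "x \<in> C i" "x \<in> S" "y \<in> C i" "y \<in> T" by auto
        then have "\<eta> \<le> dist x y" "dist x y \<le> diameter (C i)"
          using sep diameter_bounded_bound[OF bd(1)] by auto
        then show False using bd(2)[of i] that by linarith
      qed
      then show "disc_area (C i \<inter> S) + disc_area (C i \<inter> T) \<le> disc_area (C i)"
        using sub[of S] sub[of T] by auto
    qed auto
    finally show "area_at \<delta> S + area_at \<delta> T \<le> (\<Sum>i. disc_area (C i))" .
  qed
  obtain m where m: "1 / real (Suc m) < \<eta>"
    using \<open>\<eta> > 0\<close> nat_approx_posE by blast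
  have "area S + area T = (SUP n. area_at (1 / real (Suc n)) S + area_at (1 / real (Suc n)) T)"
    unfolding area_eq_SUP_nat by (rule ennreal_SUP_add[symmetric]) (rule incseq_area_at)+
  also have "\<dots> \<le> area (S \<union> T)"
  proof (rule SUP_least)
    fix n
    let ?d = "1 / real (Suc (max m n))"
    have d: "?d \<le> 1 / real (Suc n)" "?d < \<eta>"
      using m by (auto intro!: frac_le intro: le_less_trans[OF _ m])
    have "area_at (1 / real (Suc n)) S + area_at (1 / real (Suc n)) T \<le> area_at ?d S + area_at ?d T"
      by (intro add_mono area_at_antimono d)
    also have "\<dots> \<le> area_at ?d (S \<union> T)" by (rule at[OF d(2)])
    also have "\<dots> \<le> area (S \<union> T)" by (rule area_at_le_area) simp
    finally show "area_at (1 / real (Suc n)) S + area_at (1 / real (Suc n)) T \<le> area (S \<union> T)" .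
  qed
  finally show ?thesis .
qed

text \<open>Caratheodory's criterion for metric outer measures. The part of \<open>E\<close> outside \<open>F\<close> is exhausted by
  the sets \<open>inner n\<close> of points at distance at least \<open>1/(n+1)\<close> from \<open>F\<close>, which are separated from
  \<open>F\<close>. What is missing from \<open>inner n\<close> is a union of rings; rings of the same parity are separated from
  each other, so the sum of their areas is finite and its tails tend to 0.\<close>

lemma area_split_closed:
  assumes "closed F"
  shows "area (E \<inter> F) + area (E - F) \<le> area E"
proof (cases "F = {} \<or> area E = top")
  case True
  then show ?thesis by auto
next
  case False
  then have F: "F \<noteq> {}" and fin: "area E < top" by (auto simp: less_top)
  define inner where "inner n = {x \<in> E. 1 / real (Suc n) \<le> infdist x F}" for n
  define ring where "ring n = inner (Suc n) - inner n" for n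
  have dec: "1 / real (Suc (Suc n)) \<le> 1 / real (Suc m)" if "m \<le> Suc n" for m n
    using that by (intro frac_le) auto
  have inner_mono: "inner m \<subseteq> inner n" if "m \<le> n" for m n
  proof -
    have "1 / real (Suc n) \<le> 1 / real (Suc m)" using that by (intro frac_le) auto
    then show ?thesis unfolding inner_def by auto
  qed
  \<comment> \<open>Rings whose indices differ by at least 2 have positive distance, so their areas add up.\<close>
  have same_parity_sum: "(\<Sum>k<m. area (ring (2 * k + i))) \<le> area (\<Union>k<m. ring (2 * k + i))" for i m
  proof (induction m)
    case (Suc m)
    let ?U = "\<Union>k<m. ring (2 * k + i)"
    let ?l = "1 / real (2*m + i)" and ?s = "1 / real (2*m + i + 1)"
    have "(\<Sum>k<Suc m. area (ring (2 * k + i))) \<le> area ?U + area (ring (2 * m + i))"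
      using Suc by (simp add: add_right_mono)
    also have "\<dots> \<le> area (?U \<union> ring (2 * m + i))"
    proof (cases "m = 0")
      case False
      show ?thesis
      proof (rule area_separated)
        have pos: "0 < real (2*m+i)" using False by simp
        have "?s < ?l" by (rule divide_strict_left_mono) (use pos in \<open>auto intro!: mult_pos_pos\<close>)
        then show "?l - ?s > 0" by (rule diff_gt_0_iff_gt[THEN iffD2])
        fix x y assume x: "x \<in> ?U" and y: "y \<in> ring (2 * m + i)"
        from x obtain k where k: "k < m" "x \<in> inner (Suc (2 * k + i))" by (auto simp: ring_def)
        have "?l \<le> 1 / real (Suc (Suc (2 * k + i)))" using k by (intro frac_le) auto
        also have "\<dots> \<le> infdist x F" using k by (auto simp: inner_def)
        finally have 1: "?l \<le> infdist x F" .
        have 2: "infdist y F < ?s" using y by (auto simp: ring_def inner_def add.commute)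
        show "?l - ?s \<le> dist x y"
          using infdist_triangle[of x F y] 1 2 by linarith
      qed
    qed simp
    also have "?U \<union> ring (2 * m + i) = (\<Union>k<Suc m. ring (2 * k + i))"
      by (auto simp: less_Suc_eq)
    finally show ?case .
  qed simp
  have ring_sub: "ring n \<subseteq> E" for n by (auto simp: ring_def inner_def)
  \<comment> \<open>With \<open>i = 0\<close> and \<open>i = 1\<close> this bounds the areas of all even and of all odd rings.\<close>
  have le2: "(\<Sum>k. area (ring (2 * k + i))) \<le> area E" for i
  proof (rule suminf_le_const)
    show "(\<Sum>k<m. area (ring (2 * k + i))) \<le> area E" for m
      using same_parity_sum[of i m] area_mono[of "\<Union>k<m. ring (2 * k + i)" E] ring_sub by force
  qed auto
  have ring_fin: "area (ring n) < top" for n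
    using area_mono[OF ring_sub, of n] fin by auto
  define r where "r n = enn2real (area (ring n))" for n
  have r: "area (ring n) = ennreal (r n)" "r n \<ge> 0" for n
    using ring_fin[of n] by (auto simp: r_def)
  have "summable r"
  proof (rule bounded_imp_summable)
    show "0 \<le> r n" for n by (rule r)
    fix n
    have "(\<Sum>k\<le>n. area (ring k)) \<le> (\<Sum>k<2 * Suc n. area (ring k))"
      by (rule sum_mono2) auto
    also have "\<dots> = (\<Sum>k<Suc n. area (ring (2 * k + 0))) + (\<Sum>k<Suc n. area (ring (2 * k + 1)))"
      by (induction n) (auto simp: algebra_simps)
    also have "\<dots> \<le> area E + area E"
      using le2[of 0] le2[of 1] sum_le_suminf[of "\<lambda>k. area (ring (2 * k + 0))" "{..<Suc n}"]
        sum_le_suminf[of "\<lambda>k. area (ring (2 * k + 1))" "{..<Suc n}"]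
      by (intro add_mono) (auto intro: order_trans)
    finally have le: "(\<Sum>k\<le>n. ennreal (r k)) \<le> area E + area E" by (simp add: r)
    obtain M where M: "area E = ennreal M" "M \<ge> 0"
      using fin by (cases "area E") auto
    have "ennreal (\<Sum>k\<le>n. r k) = (\<Sum>k\<le>n. ennreal (r k))"
      by (rule sum_ennreal[symmetric]) (rule r)
    also have "\<dots> \<le> ennreal (M + M)" using le unfolding M(1) ennreal_plus[OF M(2) M(2)] .
    finally have "(\<Sum>k\<le>n. r k) \<le> M + M"
      using M by (subst (asm) ennreal_le_iff) auto
    then show "(\<Sum>k\<le>n. r k) \<le> 2 * enn2real (area E)" using M by simp
  qed
  then have tail: "(\<lambda>n. \<Sum>k. r (k + n)) \<longlonglongrightarrow> 0" by (rule suminf_exist_split2)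
  show ?thesis
  proof (rule ennreal_le_epsilon)
    fix e :: real assume "e > 0"
    then obtain n where n: "(\<Sum>k. r (k + n)) < e"
      using order_tendstoD(2)[OF tail \<open>e > 0\<close>] by (auto simp: eventually_sequentially)
    have "E - F \<subseteq> inner n \<union> (\<Union>k. ring (k + n))"
    proof
      fix x assume x: "x \<in> E - F"
      then have "infdist x F > 0"
        using in_closed_iff_infdist_zero[OF \<open>closed F\<close> F, of x] infdist_nonneg[of x F] by force
      then obtain m where "1 / real (Suc m) < infdist x F" using nat_approx_posE by blast
      then have ex: "x \<in> inner (max n m)"
        using x inner_mono[of m "max n m"] by (auto simp: inner_def)
      have "x \<in> inner (n + j) \<Longrightarrow> x \<in> inner n \<union> (\<Union>k. ring (k + n))" for j
      proof (induction j)
        case (Suc j)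
        then show ?case
          by (cases "x \<in> inner (n + j)") (auto simp: ring_def add.commute)
      qed simp
      then show "x \<in> inner n \<union> (\<Union>k. ring (k + n))"
        using ex by (metis le_Suc_ex max.cobounded1)
    qed
    then have "area (E - F) \<le> area (inner n \<union> (\<Union>k. ring (k + n)))" by (rule area_mono)
    also have "\<dots> \<le> area (inner n) + area (\<Union>k. ring (k + n))" by (rule area_Un_le)
    also have "\<dots> \<le> area (inner n) + (\<Sum>k. area (ring (k + n)))"
      by (intro add_left_mono area_UN_le)
    also have "(\<Sum>k. area (ring (k + n))) = ennreal (\<Sum>k. r (k + n))"
      unfolding r using summable_ignore_initial_segment[OF \<open>summable r\<close>]
      by (intro suminf_ennreal2 r) auto
    also have "\<dots> \<le> ennreal e" using n by (intro ennreal_leI) auto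
    finally have 1: "area (E - F) \<le> area (inner n) + ennreal e" by (simp add: add_left_mono)
    have "area (E \<inter> F) + area (inner n) \<le> area (E \<inter> F \<union> inner n)"
    proof (rule area_separated)
      fix x y assume "x \<in> E \<inter> F" "y \<in> inner n"
      then show "1 / real (Suc n) \<le> dist x y"
        using infdist_triangle[of y F x] infdist_zero[of x F] by (auto simp: inner_def dist_commute)
    qed simp
    also have "\<dots> \<le> area E" by (rule area_mono) (auto simp: inner_def)
    finally have 2: "area (E \<inter> F) + area (inner n) \<le> area E" .
    have "area (E \<inter> F) + area (E - F) \<le> area (E \<inter> F) + (area (inner n) + ennreal e)"
      by (rule add_left_mono[OF 1])
    also have "\<dots> = area (E \<inter> F) + area (inner n) + ennreal e" by (simp only: add.assoc)
    also have "\<dots> \<le> area E + ennreal e" by (rule add_right_mono[OF 2])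
    finally show "area (E \<inter> F) + area (E - F) \<le> area E + ennreal e" .
  qed
qed

definition area_measure :: "(real^3) measure" where
  "area_measure = measure_of UNIV (sets borel) area"

lemma sets_area_measure [measurable_cong, simp]: "sets area_measure = sets borel"
  and space_area_measure [simp]: "space area_measure = UNIV"
  unfolding area_measure_def using sets.sets_measure_of_eq[of borel]
  by (simp_all add: sets.sigma_sets_eq[of borel, simplified])

text \<open>Closed sets are measurable in the sense of Caratheodory, so all Borel sets are.\<close>

lemma emeasure_area_measure [simp]:
  assumes "B \<in> sets borel"
  shows "emeasure area_measure B = area B"
proof -
  let ?L = "lambda_system UNIV (Pow UNIV) area"
  interpret P: sigma_algebra "UNIV :: (real^3) set" "Pow UNIV" by (rule sigma_algebra_Pow)
  have ms: "measure_space UNIV ?L area"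
    by (rule P.caratheodory_lemma[OF outer_measure_space_area])
  then interpret L: sigma_algebra UNIV ?L by (simp add: measure_space_def)
  have closed: "F \<in> ?L" if "closed F" for F
    unfolding P.lambda_system_eq
  proof (intro CollectI conjI ballI)
    fix E :: "(real^3) set"
    show "area (E \<inter> F) + area (E - F) = area E"
    proof (rule antisym)
      show "area (E \<inter> F) + area (E - F) \<le> area E" by (rule area_split_closed[OF that])
      show "area E \<le> area (E \<inter> F) + area (E - F)"
        using area_Un_le[of "E \<inter> F" "E - F"] by (simp add: Int_Diff_Un)
    qed
  qed simp
  have sub: "sets borel \<subseteq> ?L"
    unfolding borel_eq_closed using closed L.sigma_sets_subset[of "Collect closed"] by (simp add: subset_iff)
  have ca: "countably_additive (sets borel) area"
    using ms sub unfolding measure_space_def countably_additive_def by (blast dest: subset_trans)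
  show ?thesis
    unfolding area_measure_def
    by (rule emeasure_measure_of_sigma)
      (use assms ca sets.sigma_algebra_axioms[of "borel :: (real^3) measure"] in \<open>auto simp: positive_def\<close>)
qed

text \<open>Push a cover forward: diameters grow at most by the factor \<open>L\<close>.\<close>

lemma area_Lipschitz_image_le:
  assumes "L > 0" and lip: "\<And>x y. x \<in> S \<Longrightarrow> y \<in> S \<Longrightarrow> dist (f x) (f y) \<le> L * dist x y"
  shows "area (f ` S) \<le> ennreal (L\<^sup>2) * area S"
proof (rule area_leI)
  fix \<delta> :: real assume d: "\<delta> > 0"
  have "area_at \<delta> (f ` S) \<le> ennreal (L\<^sup>2) * area_at (\<delta> / L) S"
  proof -
    have canc: "ennreal (L\<^sup>2) * ennreal (1 / L\<^sup>2) = 1"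
      using \<open>L > 0\<close> by (subst ennreal_mult[symmetric]) auto
    have "ennreal (1 / L\<^sup>2) * area_at \<delta> (f ` S) \<le> area_at (\<delta> / L) S"
      unfolding area_at_def[of "\<delta> / L"]
    proof (rule INF_greatest)
      fix C assume C: "C \<in> small_covers (\<delta>/L) S"
      have bd: "bounded (C i)" "diameter (C i) \<le> \<delta> / L" for i using C by (auto simp: small_covers_def)
      have d': "dist u v \<le> L * diameter (C i)" if "u \<in> f ` (C i \<inter> S)" "v \<in> f ` (C i \<inter> S)" for u v i
      proof -
        from that obtain x y where xy: "x \<in> C i" "x \<in> S" "y \<in> C i" "y \<in> S" "u = f x" "v = f y" by auto
        have "dist u v \<le> L * dist x y" using lip xy by auto
        also have "\<dots> \<le> L * diameter (C i)"
          using diameter_bounded_bound[OF bd(1)] xy \<open>L > 0\<close> by (intro mult_left_mono) auto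
        finally show ?thesis .
      qed
      have bdf: "bounded (f ` (C i \<inter> S))" for i
        unfolding bounded_two_points using d' by blast
      have dia: "diameter (f ` (C i \<inter> S)) \<le> L * diameter (C i)" for i
        using d'[of _ i] \<open>L > 0\<close> diameter_ge_0[OF bd(1)[of i]]
        by (intro diameter_le) (auto simp: dist_norm)
      have "L * diameter (C i) \<le> \<delta>" for i using bd(2)[of i] \<open>L > 0\<close> by (simp add: field_simps)
      then have "(\<lambda>i. f ` (C i \<inter> S)) \<in> small_covers \<delta> (f ` S)"
        using C bdf dia unfolding small_covers_def by (fastforce intro: order_trans)
      from area_at_le[OF this] have "area_at \<delta> (f ` S) \<le> (\<Sum>i. disc_area (f ` (C i \<inter> S)))" .
      also have "\<dots> \<le> (\<Sum>i. ennreal (L\<^sup>2) * disc_area (C i))"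
      proof (intro suminf_le allI)
        fix i
        have "(diameter (f ` (C i \<inter> S)) / 2)\<^sup>2 \<le> (L * diameter (C i) / 2)\<^sup>2"
          using dia[of i] diameter_ge_0[OF bdf[of i]] by (intro power_mono divide_right_mono) auto
        then show "disc_area (f ` (C i \<inter> S)) \<le> ennreal (L\<^sup>2) * disc_area (C i)"
          by (subst ennreal_mult[symmetric])
            (auto intro!: ennreal_leI simp: power_mult_distrib power_divide field_simps)
      qed auto
      also have "\<dots> = ennreal (L\<^sup>2) * (\<Sum>i. disc_area (C i))" by (rule ennreal_suminf_cmult)
      finally have "ennreal (1 / L\<^sup>2) * area_at \<delta> (f ` S)
          \<le> ennreal (1 / L\<^sup>2) * (ennreal (L\<^sup>2) * (\<Sum>i. disc_area (C i)))"
        by (rule mult_left_mono) simp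
      then show "ennreal (1 / L\<^sup>2) * area_at \<delta> (f ` S) \<le> (\<Sum>i. disc_area (C i))"
        using canc by (simp add: mult.assoc[symmetric] mult.commute[of "ennreal (1 / L\<^sup>2)"])
    qed
    then have "ennreal (L\<^sup>2) * (ennreal (1 / L\<^sup>2) * area_at \<delta> (f ` S)) \<le> ennreal (L\<^sup>2) * area_at (\<delta> / L) S"
      by (rule mult_left_mono) simp
    then show ?thesis using canc by (simp add: mult.assoc[symmetric])
  qed
  also have "\<dots> \<le> ennreal (L\<^sup>2) * area S"
    using d \<open>L > 0\<close> by (intro mult_left_mono area_at_le_area) auto
  finally show "area_at \<delta> (f ` S) \<le> ennreal (L\<^sup>2) * area S" .
qed

lemma area_isometric_image:
  assumes "\<And>x y. x \<in> S \<Longrightarrow> y \<in> S \<Longrightarrow> dist (f x) (f y) = dist x y"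
  shows "area (f ` S) = area S"
proof (rule antisym)
  show "area (f ` S) \<le> area S"
    using area_Lipschitz_image_le[of 1 S f] assms by simp
  have inj: "inj_on f S" using assms by (metis dist_eq_0_iff inj_onI)
  have "dist (inv_into S f x) (inv_into S f y) \<le> 1 * dist x y" if "x \<in> f ` S" "y \<in> f ` S" for x y
    using that assms inj by auto
  then have "area (inv_into S f ` f ` S) \<le> area (f ` S)"
    using area_Lipschitz_image_le[of 1 "f ` S" "inv_into S f"] by simp
  moreover have "inv_into S f ` f ` S = S" using inj by (simp add: inv_into_image_cancel)
  ultimately show "area S \<le> area (f ` S)" by simp
qed

section \<open>The uniform distribution on the sphere\<close>

lemma orthogonal_mapping_exists:
  fixes u v :: "real^3"
  assumes "norm u = norm v"
  shows "\<exists>Q. orthogonal_transformation Q \<and> Q u = v"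
  by (rule orthogonal_transformation_exists[OF assms]) blast

lemma linear_compact_image: "linear f \<Longrightarrow> compact S \<Longrightarrow> compact (f ` S)" for f :: "real^3 \<Rightarrow> real^3"
  by (intro compact_continuous_image linear_continuous_on) (simp_all add: linear_conv_bounded_linear)

lemma emeasure_lborel_linear_image:
  fixes f :: "real^3 \<Rightarrow> real^3"
  assumes "linear f" "compact S"
  shows "emeasure lborel (f ` S) = ennreal \<bar>det (matrix f)\<bar> * emeasure lborel S"
proof -
  have fS: "compact (f ` S)"
    using assms by (intro compact_continuous_image linear_continuous_on) (simp_all add: linear_conv_bounded_linear)
  have "emeasure lborel T = ennreal (measure lebesgue T)" if "compact T" for T :: "(real^3) set"
  proof -
    have "emeasure lborel T \<noteq> top"
      using emeasure_bounded_finite[OF compact_imp_bounded[OF that]] by simp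
    then show ?thesis
      using measure_completion[of T lborel] borel_compact[OF that] by (simp add: emeasure_eq_ennreal_measure)
  qed
  then show ?thesis
    using fS assms measure_linear_image[OF assms(1) lmeasurable_compact[OF assms(2)]]
    by (simp add: ennreal_mult)
qed

text \<open>It suffices to compare volumes of boxes, and their preimages are rotated boxes.\<close>

lemma lborel_distr_orthogonal:
  fixes Q :: "real^3 \<Rightarrow> real^3"
  assumes "orthogonal_transformation Q"
  shows "distr lborel borel Q = lborel"
proof (rule lborel_eqI[symmetric])
  have lin: "linear Q" using assms by (rule orthogonal_transformation_linear)
  then have [measurable]: "Q \<in> borel_measurable borel"
    by (intro borel_measurable_continuous_onI linear_continuous_on) (simp add: linear_conv_bounded_linear)
  obtain R where R: "orthogonal_transformation R" "\<And>x. R (Q x) = x" "\<And>x. Q (R x) = x"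
    using assms orthogonal_transformation_inv orthogonal_transformation_bij
    by (metis bij_inv_eq_iff)
  fix l u :: "real^3" assume lu: "\<And>b. b \<in> Basis \<Longrightarrow> l \<bullet> b \<le> u \<bullet> b"
  have pre: "Q -` box l u = R ` box l u" by (force simp: R image_iff)
  have meas: "box l u \<in> lmeasurable" by simp
  have "emeasure (distr lborel borel Q) (box l u) = emeasure lborel (R ` box l u)"
    by (subst emeasure_distr) (simp_all add: pre[symmetric])
  also have "\<dots> = ennreal (measure lborel (R ` box l u))"
    using bounded_linear_image[OF bounded_box, of R l u] orthogonal_transformation_linear[OF R(1)]
    by (intro emeasure_eq_ennreal_measure) (auto simp: linear_conv_bounded_linear dest!: emeasure_bounded_finite)
  also have "measure lborel (R ` box l u) = measure lebesgue (R ` box l u)"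
    by (subst measure_completion) (auto simp: pre[symmetric] intro!: measurable_sets_borel[of Q borel])
  also have "\<dots> = measure lebesgue (box l u)" by (rule measure_orthogonal_image[OF R(1) meas])
  also have "ennreal \<dots> = (\<Prod>b\<in>Basis. (u - l) \<bullet> b)"
    using lu by (simp add: measure_lborel_box_eq)
  finally show "emeasure (distr lborel borel Q) (box l u) = (\<Prod>b\<in>Basis. (u - l) \<bullet> b)" .
qed simp

lemma measurable_orthogonal:
  "orthogonal_transformation Q \<Longrightarrow> (Q :: real^3 \<Rightarrow> real^3) \<in> borel_measurable borel"
  by (intro borel_measurable_continuous_onI linear_continuous_on)
    (simp add: linear_conv_bounded_linear[symmetric] orthogonal_transformation_linear)

lemma measurable_sgn [measurable]: "(sgn :: real^3 \<Rightarrow> real^3) \<in> borel_measurable borel"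
  unfolding sgn_div_norm[abs_def] by measurable

lemma sets_uniform_sphere [measurable_cong, simp]: "sets uniform_sphere = sets borel"
  and space_uniform_sphere [simp]: "space uniform_sphere = UNIV"
  by (simp_all add: uniform_sphere_def)

lemma unit_ball_volume: "0 < emeasure lborel (ball (0::real^3) 1)" "emeasure lborel (ball (0::real^3) 1) < \<infinity>"
proof -
  show "emeasure lborel (ball (0::real^3) 1) < \<infinity>" by (rule emeasure_bounded_finite) simp
  show "0 < emeasure lborel (ball (0::real^3) 1)"
    using open_not_negligible[of "ball (0::real^3) 1"]
    by (simp add: negligible_iff_emeasure0 zero_less_iff_neq_zero)
qed

lemma prob_space_uniform_sphere: "prob_space uniform_sphere"
  unfolding uniform_sphere_def
proof (rule prob_space.prob_space_distr)
  show "prob_space (uniform_measure lborel (ball (0::real^3) 1))"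
    using unit_ball_volume by (intro prob_space_uniform_measure) auto
qed (simp add: measurable_cong_sets[OF sets_uniform_measure refl])

lemma nn_integral_uniform_sphere:
  assumes [measurable]: "h \<in> borel_measurable borel"
  shows "(\<integral>\<^sup>+u. h u \<partial>uniform_sphere)
    = (\<integral>\<^sup>+x. h (sgn x) * indicator (ball 0 1) x \<partial>lborel) / emeasure lborel (ball (0::real^3) 1)"
proof -
  have [measurable]: "ball (0::real^3) 1 \<in> sets lborel" by simp
  have "(\<integral>\<^sup>+u. h u \<partial>uniform_sphere) = (\<integral>\<^sup>+x. h (sgn x) \<partial>uniform_measure lborel (ball 0 1))"
    unfolding uniform_sphere_def
    by (rule nn_integral_distr) (simp_all add: measurable_cong_sets[OF sets_uniform_measure refl])
  also have "\<dots> = (\<integral>\<^sup>+x. h (sgn x) * indicator (ball 0 1) x \<partial>lborel) / emeasure lborel (ball (0::real^3) 1)"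
    by (rule nn_integral_uniform_measure) measurable
  finally show ?thesis .
qed

lemma sgn_orthogonal:
  "orthogonal_transformation Q \<Longrightarrow> sgn (Q x) = Q (sgn x)" for Q :: "real^3 \<Rightarrow> real^3"
  by (simp add: sgn_div_norm orthogonal_transformation_norm linear_cmul orthogonal_transformation_linear)

text \<open>Orthogonal maps preserve Lebesgue measure and the unit ball, and they commute with normalisation of vectors.\<close>

lemma nn_integral_uniform_sphere_orthogonal:
  assumes Q: "orthogonal_transformation Q" and [measurable]: "h \<in> borel_measurable borel"
  shows "(\<integral>\<^sup>+u. h (Q u) \<partial>uniform_sphere) = (\<integral>\<^sup>+u. h u \<partial>uniform_sphere)"
proof -
  note [measurable] = measurable_orthogonal[OF Q]
  have [measurable]: "ball (0::real^3) 1 \<in> sets borel" by simp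
  have "(\<integral>\<^sup>+x. h (sgn x) * indicator (ball 0 1) x \<partial>lborel)
      = (\<integral>\<^sup>+x. h (sgn x) * indicator (ball 0 1) x \<partial>distr lborel borel Q)"
    by (simp add: lborel_distr_orthogonal[OF Q])
  also have "\<dots> = (\<integral>\<^sup>+x. h (sgn (Q x)) * indicator (ball 0 1) (Q x) \<partial>lborel)"
    by (rule nn_integral_distr) measurable
  also have "\<dots> = (\<integral>\<^sup>+x. h (Q (sgn x)) * indicator (ball 0 1) x \<partial>lborel)"
    by (intro nn_integral_cong) (simp add: sgn_orthogonal[OF Q] indicator_def orthogonal_transformation_norm[OF Q])
  finally show ?thesis by (simp add: nn_integral_uniform_sphere)
qed

lemma AE_uniform_sphere: "AE u in uniform_sphere. norm u = 1"
  unfolding uniform_sphere_def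
proof (subst AE_distr_iff)
  show "AE x in uniform_measure lborel (ball 0 1). norm (sgn x :: real^3) = 1"
  proof (rule AE_uniform_measureI)
    show "AE x in lborel. x \<in> ball 0 1 \<longrightarrow> norm (sgn x :: real^3) = 1"
      using AE_lborel_singleton[of "0::real^3"] by eventually_elim (simp add: norm_sgn)
  qed simp
qed (simp_all add: measurable_cong_sets[OF sets_uniform_measure refl])

lemma nn_integral_scale_real3:
  fixes f :: "real^3 \<Rightarrow> ennreal"
  assumes "r > 0" and [measurable]: "f \<in> borel_measurable borel"
  shows "(\<integral>\<^sup>+x. f x \<partial>lborel) = ennreal (r ^ 3) * (\<integral>\<^sup>+x. f (r *\<^sub>R x) \<partial>lborel)"
  using assms(1)
  by (subst lborel_affine[of r 0]) (simp_all add: nn_integral_density nn_integral_distr nn_integral_cmult ennreal_power)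

text \<open>Direction and length of a vector are independent under Lebesgue measure. Weighting Lebesgue
  measure by \<open>h\<close> of the direction gives the ball of radius \<open>r\<close> the mass \<open>r\<^sup>3\<close> times that of the
  unit ball, so the distribution of the length depends on \<open>h\<close> only through a constant factor. This is used to
  replace averages over the sphere by Gaussian averages.\<close>

lemma radial_integral:
  fixes h :: "real^3 \<Rightarrow> ennreal" and \<phi> :: "real \<Rightarrow> ennreal"
  assumes [measurable]: "h \<in> borel_measurable borel" "\<phi> \<in> borel_measurable borel"
    and fin: "(\<integral>\<^sup>+u. h u \<partial>uniform_sphere) < \<infinity>"
  shows "(\<integral>\<^sup>+x. h (sgn x) * \<phi> (norm x) \<partial>lborel)
     = (\<integral>\<^sup>+u. h u \<partial>uniform_sphere) * (\<integral>\<^sup>+(x::real^3). \<phi> (norm x) \<partial>lborel)"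
proof -
  let ?V = "emeasure lborel (ball (0::real^3) 1)"
  let ?k = "\<integral>\<^sup>+u. h u \<partial>uniform_sphere"
  define M where "M w = distr (density lborel w) borel norm" for w :: "real^3 \<Rightarrow> ennreal"
  have M_lessThan: "emeasure (M (\<lambda>x. w (sgn x))) {..<r}
      = (if r > 0 then ennreal (r ^ 3) * (\<integral>\<^sup>+x. w (sgn x) * indicator (ball 0 1) x \<partial>lborel) else 0)"
    if [measurable]: "w \<in> borel_measurable borel" for w r
  proof -
    have pre: "norm -` {..<r} = ball (0::real^3) r" by auto
    have "emeasure (M (\<lambda>x. w (sgn x))) {..<r} = (\<integral>\<^sup>+x. w (sgn x) * indicator (ball 0 r) x \<partial>lborel)"
      unfolding M_def by (simp add: emeasure_distr emeasure_density pre)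
    also have "\<dots> = (if r > 0 then ennreal (r ^ 3) * (\<integral>\<^sup>+x. w (sgn x) * indicator (ball 0 1) x \<partial>lborel) else 0)"
    proof (cases "r > 0")
      case True
      then show ?thesis
        by (subst nn_integral_scale_real3[OF True])
          (auto intro!: arg_cong2[of _ _ _ _ "(*)"] nn_integral_cong simp: sgn_scaleR indicator_def)
    qed (simp add: ball_empty)
    finally show ?thesis .
  qed
  have k: "(\<integral>\<^sup>+x. h (sgn x) * indicator (ball 0 1) x \<partial>lborel) = ?k * ?V"
    using unit_ball_volume by (subst nn_integral_uniform_sphere) (auto simp: ennreal_divide_times ennreal_mult_divide_eq)
  have V: "(\<integral>\<^sup>+x. ?k * indicator (ball (0::real^3) 1) x \<partial>lborel) = ?k * ?V"
    by (rule nn_integral_cmult_indicator) simp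
  have eq: "M (\<lambda>x. h (sgn x)) = M (\<lambda>x. ?k)"
  proof (rule measure_eqI_generator_eq[where E="range lessThan" and A="\<lambda>i::nat. {..<real i}" and \<Omega>=UNIV])
    show "Int_stable (range lessThan :: real set set)" 
      unfolding Int_stable_def
    proof safe
      fix r s :: real
      have "{..<r} \<inter> {..<s} = {..<min r s}" by auto
      then show "{..<r} \<inter> {..<s} \<in> range lessThan" by simp
    qed
    show "emeasure (M (\<lambda>x. h (sgn x))) X = emeasure (M (\<lambda>x. ?k)) X" if "X \<in> range lessThan" for X
      using that M_lessThan[of h] M_lessThan[of "\<lambda>x. ?k"] by (auto simp: k V)
    show "sets (M (\<lambda>x. h (sgn x))) = sigma_sets UNIV (range lessThan)"
      "sets (M (\<lambda>x. ?k)) = sigma_sets UNIV (range lessThan)"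
      by (simp_all add: M_def borel_Iio)
    show "(\<Union>i. {..<real i}) = UNIV" by (auto intro: reals_Archimedean2)
    show "emeasure (M (\<lambda>x. h (sgn x))) {..<real i} \<noteq> \<infinity>" for i
      using fin unit_ball_volume
      by (auto simp: M_lessThan k ennreal_mult_eq_top_iff)
  qed auto
  have "(\<integral>\<^sup>+x. h (sgn x) * \<phi> (norm x) \<partial>lborel) = (\<integral>\<^sup>+r. \<phi> r \<partial>M (\<lambda>x. h (sgn x)))"
    unfolding M_def by (simp add: nn_integral_distr nn_integral_density)
  also have "\<dots> = (\<integral>\<^sup>+(x::real^3). ?k * \<phi> (norm x) \<partial>lborel)"
    unfolding eq unfolding M_def by (simp add: nn_integral_distr nn_integral_density)
  also have "\<dots> = ?k * (\<integral>\<^sup>+(x::real^3). \<phi> (norm x) \<partial>lborel)"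
    by (rule nn_integral_cmult) auto
  finally show ?thesis .
qed

section \<open>Ellipsoids, their volume and their width\<close>

definition scale3 :: "real \<Rightarrow> real \<Rightarrow> real \<Rightarrow> real^3 \<Rightarrow> real^3" where
  "scale3 a b c x = vector [a * x$1, b * x$2, c * x$3]"

lemma scale3_nth [simp]:
  "scale3 a b c x $ 1 = a * x$1" "scale3 a b c x $ 2 = b * x$2" "scale3 a b c x $ 3 = c * x$3"
  by (simp_all add: scale3_def)

lemma linear_scale3: "linear (scale3 a b c)"
  by (rule linearI) (simp_all add: vec_eq_iff forall_3 algebra_simps)

lemma det_scale3: "det (matrix (scale3 a b c)) = a * b * c"
  by (simp add: det_3 matrix_def axis_def)

lemma inner_real_3: "(x::real^3) \<bullet> y = x$1 * y$1 + x$2 * y$2 + x$3 * y$3"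
  by (simp add: inner_vec_def sum_3)

lemma norm_sq_real_3: "(norm (x::real^3))\<^sup>2 = (x$1)\<^sup>2 + (x$2)\<^sup>2 + (x$3)\<^sup>2"
  unfolding power2_norm_eq_inner inner_real_3 by (simp add: power2_eq_square)

lemma norm_scale3: "norm (scale3 a b c x) = sqrt (a\<^sup>2 * (x$1)\<^sup>2 + b\<^sup>2 * (x$2)\<^sup>2 + c\<^sup>2 * (x$3)\<^sup>2)"
  by (rule real_sqrt_unique[symmetric]) (simp_all add: norm_sq_real_3 power_mult_distrib)

lemma scale3_inverse:
  assumes "a \<noteq> 0" "b \<noteq> 0" "c \<noteq> 0"
  shows "scale3 (1/a) (1/b) (1/c) (scale3 a b c x) = x" "scale3 a b c (scale3 (1/a) (1/b) (1/c) x) = x"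
  using assms by (simp_all add: vec_eq_iff forall_3)

lemma axis_ellipsoid_eq_image:
  assumes "a > 0" "b > 0" "c > 0"
  shows "axis_ellipsoid a b c = scale3 a b c ` cball 0 1"
proof -
  have mem: "x \<in> axis_ellipsoid a b c \<longleftrightarrow> norm (scale3 (1/a) (1/b) (1/c) x) \<le> 1" for x
    by (simp add: axis_ellipsoid_def norm_scale3 power_divide)
  show ?thesis
  proof (intro set_eqI iffI)
    fix x assume "x \<in> axis_ellipsoid a b c"
    then show "x \<in> scale3 a b c ` cball 0 1"
      using mem[of x] scale3_inverse(2)[of a b c x] assms
      by (intro image_eqI[of _ _ "scale3 (1/a) (1/b) (1/c) x"]) auto
  next
    fix x assume "x \<in> scale3 a b c ` cball 0 1"
    then show "x \<in> axis_ellipsoid a b c"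
      using assms by (auto simp: mem scale3_inverse)
  qed
qed

lemma continuous_on_scale3: "continuous_on S (scale3 a b c)"
  using linear_scale3 linear_continuous_on linear_conv_bounded_linear by blast

lemma measurable_scale3 [measurable]: "scale3 a b c \<in> borel_measurable borel"
  by (intro borel_measurable_continuous_onI continuous_on_scale3)

lemma compact_axis_ellipsoid:
  "a > 0 \<Longrightarrow> b > 0 \<Longrightarrow> c > 0 \<Longrightarrow> compact (axis_ellipsoid a b c)"
  by (simp add: axis_ellipsoid_eq_image compact_continuous_image continuous_on_scale3)

lemma frontier_axis_ellipsoid:
  assumes "a > 0" "b > 0" "c > 0"
  shows "frontier (axis_ellipsoid a b c) = scale3 a b c ` sphere 0 1"
proof -
  have "bij (scale3 a b c)"
    using scale3_inverse[of a b c] assms by (intro o_bij[of "scale3 (1/a) (1/b) (1/c)"]) (auto simp: fun_eq_iff)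
  then have inj: "inj (scale3 a b c)" by (rule bij_is_inj)
  have "closure (scale3 a b c ` cball 0 1) = scale3 a b c ` cball 0 1"
    by (intro closure_closed compact_imp_closed compact_continuous_image continuous_on_scale3) simp
  moreover have "interior (scale3 a b c ` cball 0 1) = scale3 a b c ` ball 0 1"
    using interior_injective_linear_image[OF linear_scale3 inj] by simp
  ultimately have "frontier (axis_ellipsoid a b c) = scale3 a b c ` cball 0 1 - scale3 a b c ` ball 0 1"
    by (simp add: axis_ellipsoid_eq_image[OF assms] frontier_def)
  also have "\<dots> = scale3 a b c ` (cball 0 1 - ball 0 1)"
    using inj by (simp add: image_set_diff)
  also have "cball 0 1 - ball 0 1 = sphere (0::real^3) 1" by auto
  finally show ?thesis .
qed

lemma isometry_decompose:
  assumes "isometry f"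
  obtains Q where "orthogonal_transformation Q" "\<And>x. f x = f 0 + Q x"
proof
  show "orthogonal_transformation (\<lambda>x. f x - f 0)"
    using assms unfolding orthogonal_transformation_isometry by (simp add: isometry_def dist_norm)
qed simp

lemma isometry_compose: "isometry f \<Longrightarrow> isometry g \<Longrightarrow> isometry (f \<circ> g)"
  unfolding isometry_def using comp_surj[of g f] by simp

lemma isometry_inverse:
  assumes "isometry f"
  obtains g where "isometry g" "\<And>x. g (f x) = x" "\<And>x. f (g x) = x"
proof -
  have "inj f" using assms unfolding isometry_def inj_def by (metis dist_eq_0_iff)
  then have bij: "bij f" using assms by (simp add: isometry_def bij_def)
  show ?thesis
  proof
    show "isometry (inv f)" unfolding isometry_def
    proof
      show "surj (inv f)" using bij by (simp add: bij_imp_bij_inv bij_is_surj)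
      show "\<forall>x y. dist (inv f x) (inv f y) = dist x y"
        using assms bij unfolding isometry_def by (metis bij_inv_eq_iff)
    qed
    show "inv f (f x) = x" "f (inv f x) = x" for x
      using bij by (simp_all add: bij_is_inj bij_is_surj surj_f_inv_f)
  qed
qed

lemma frontier_isometric_image:
  assumes "isometry f"
  shows "frontier (f ` S) = f ` frontier S"
proof -
  obtain Q where Q: "orthogonal_transformation Q" "\<And>x. f x = f 0 + Q x"
    using isometry_decompose[OF assms] by blast
  have lin: "linear Q" and inj: "inj Q"
    using Q by (simp_all add: orthogonal_transformation_linear orthogonal_transformation_inj)
  have im: "f ` T = (+) (f 0) ` (Q ` T)" for T by (subst Q(2)[abs_def]) (simp add: image_image)
  have "frontier (Q ` S) = Q ` frontier S"
    using lin inj by (simp add: frontier_def closure_injective_linear_image interior_injective_linear_image image_set_diff)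
  then show ?thesis unfolding im by (simp add: frontier_translation)
qed

lemma emeasure_lebesgue_ellipsoid:
  assumes "isometry f" "a > 0" "b > 0" "c > 0"
  shows "emeasure lebesgue (f ` axis_ellipsoid a b c) = ennreal (a * b * c) * emeasure lborel (cball (0::real^3) 1)"
proof -
  obtain Q where Q: "orthogonal_transformation Q" "\<And>x. f x = f 0 + Q x"
    using isometry_decompose[OF assms(1)] by blast
  let ?K = "axis_ellipsoid a b c"
  have K: "compact ?K" by (rule compact_axis_ellipsoid[OF assms(2-4)])
  have QK: "compact (Q ` ?K)"
    using K Q(1) by (intro compact_continuous_image linear_continuous_on)
      (simp_all add: linear_conv_bounded_linear[symmetric] orthogonal_transformation_linear)
  have im: "f ` ?K = (+) (f 0) ` (Q ` ?K)" by (subst Q(2)[abs_def]) (simp add: image_image)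
  have comp: "compact (f ` ?K)" unfolding im by (rule compact_translation[OF QK])
  have "emeasure lebesgue (f ` ?K) = ennreal (measure lebesgue (f ` ?K))"
    using lmeasurable_compact[OF comp] by (simp add: emeasure_eq_measure2)
  also have "measure lebesgue (f ` ?K) = measure lebesgue (Q ` ?K)"
    unfolding im by (rule measure_translation)
  also have "\<dots> = measure lebesgue ?K"
    by (rule measure_orthogonal_image[OF Q(1) lmeasurable_compact[OF K]])
  also have "\<dots> = measure lborel ?K"
    using borel_compact[OF K] by (simp add: measure_completion)
  also have "ennreal \<dots> = emeasure lborel ?K"
    using emeasure_bounded_finite[OF compact_imp_bounded[OF K]] by (simp add: emeasure_eq_ennreal_measure)
  also have "\<dots> = ennreal (a * b * c) * emeasure lborel (cball (0::real^3) 1)"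
    using assms emeasure_lborel_linear_image[OF linear_scale3, of "cball 0 1" a b c]
    by (simp add: axis_ellipsoid_eq_image det_scale3 abs_mult)
  finally show ?thesis .
qed

text \<open>The support function of the image of the unit ball under \<open>A\<close> is \<open>|A\<^sup>T u|\<close>, attained at the image of the direction of \<open>A\<^sup>T u\<close>; here \<open>A\<close> is symmetric.\<close>

lemma width_axis_ellipsoid:
  assumes "a > 0" "b > 0" "c > 0"
  shows "width (axis_ellipsoid a b c) u = 2 * norm (scale3 a b c u)"
proof -
  let ?n = "norm (scale3 a b c u)"
  have adj: "scale3 a b c y \<bullet> u = y \<bullet> scale3 a b c u" for y
    by (simp add: inner_real_3 mult_ac)
  define w where "w = sgn (scale3 a b c u)"
  have w: "norm w \<le> 1" "w \<bullet> scale3 a b c u = ?n"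
    by (simp add: w_def norm_sgn) (cases "scale3 a b c u = 0", simp_all add: w_def sgn_div_norm dot_square_norm power2_eq_square)
  have bd: "\<bar>x \<bullet> u\<bar> \<le> ?n" if "x \<in> axis_ellipsoid a b c" for x
  proof -
    from that obtain y where y: "x = scale3 a b c y" "norm y \<le> 1"
      by (auto simp: axis_ellipsoid_eq_image[OF assms])
    have "\<bar>x \<bullet> u\<bar> \<le> norm y * ?n" unfolding y adj by (rule Cauchy_Schwarz_ineq2)
    also have "\<dots> \<le> 1 * ?n" using y by (intro mult_right_mono) auto
    finally show ?thesis by simp
  qed
  have mem: "scale3 a b c w \<in> axis_ellipsoid a b c" "scale3 a b c (- w) \<in> axis_ellipsoid a b c"
    using w by (auto simp: axis_ellipsoid_eq_image[OF assms])
  have "(SUP x\<in>axis_ellipsoid a b c. x \<bullet> u) = ?n"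
    by (rule cSup_eq_maximum) (use bd mem(1) adj[of w] w in \<open>force+\<close>)
  moreover have "(INF x\<in>axis_ellipsoid a b c. x \<bullet> u) = - ?n"
    by (rule cInf_eq_minimum) (use bd mem(2) adj[of "-w"] w in \<open>force+\<close>)
  ultimately show ?thesis by (simp add: width_def)
qed

lemma SUP_add_real:
  fixes g :: "'a \<Rightarrow> real"
  assumes "K \<noteq> {}" "bdd_above (g ` K)"
  shows "(SUP x\<in>K. c + g x) = c + (SUP x\<in>K. g x)"
proof (rule cSup_eq_non_empty)
  show "y \<le> c + (SUP x\<in>K. g x)" if "y \<in> (\<lambda>x. c + g x) ` K" for y
    using that cSUP_upper[OF _ assms(2)] by auto
  show "c + (SUP x\<in>K. g x) \<le> z" if "\<And>y. y \<in> (\<lambda>x. c + g x) ` K \<Longrightarrow> y \<le> z" for z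
  proof -
    have "(SUP x\<in>K. g x) \<le> z - c" using that by (intro cSUP_least assms(1)) (simp add: algebra_simps)
    then show ?thesis by simp
  qed
qed (use assms in auto)

lemma INF_add_real:
  fixes g :: "'a \<Rightarrow> real"
  assumes "K \<noteq> {}" "bdd_below (g ` K)"
  shows "(INF x\<in>K. c + g x) = c + (INF x\<in>K. g x)"
proof (rule cInf_eq_non_empty)
  show "c + (INF x\<in>K. g x) \<le> y" if "y \<in> (\<lambda>x. c + g x) ` K" for y
    using that cINF_lower[OF assms(2)] by auto
  show "z \<le> c + (INF x\<in>K. g x)" if "\<And>y. y \<in> (\<lambda>x. c + g x) ` K \<Longrightarrow> z \<le> y" for z
  proof -
    have "z - c \<le> (INF x\<in>K. g x)" using that by (intro cINF_greatest assms(1)) (simp add: algebra_simps)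
    then show ?thesis by simp
  qed
qed (use assms in auto)

text \<open>The translation part cancels in the width; the rotation part acts on the direction through its inverse.\<close>

lemma width_isometric_image:
  assumes f: "isometry f" and K: "bounded K" "K \<noteq> {}"
  obtains R where "orthogonal_transformation R" "\<And>u. width (f ` K) u = width K (R u)"
proof -
  obtain Q where Q: "orthogonal_transformation Q" "\<And>x. f x = f 0 + Q x"
    using isometry_decompose[OF f] by blast
  obtain R where R: "orthogonal_transformation R" "\<And>x. Q (R x) = x"
    using Q(1) orthogonal_transformation_inv orthogonal_transformation_bij by (metis bij_inv_eq_iff)
  have adj: "Q x \<bullet> u = x \<bullet> R u" for x u
    using Q(1) R unfolding orthogonal_transformation_def by metis
  obtain B where B: "\<And>x. x \<in> K \<Longrightarrow> norm x \<le> B" using K by (auto simp: bounded_iff)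
  have bd: "\<bar>x \<bullet> v\<bar> \<le> B * norm v" if "x \<in> K" for x v
    using Cauchy_Schwarz_ineq2[of x v] mult_right_mono[OF B[OF that], of "norm v"] by simp
  have fin: "bdd_above ((\<lambda>x. x \<bullet> v) ` K)" "bdd_below ((\<lambda>x. x \<bullet> v) ` K)" for v
  proof -
    have "x \<bullet> v \<le> B * norm v" "- (B * norm v) \<le> x \<bullet> v" if "x \<in> K" for x
      using bd[OF that, of v] by linarith+
    then show "bdd_above ((\<lambda>x. x \<bullet> v) ` K)" "bdd_below ((\<lambda>x. x \<bullet> v) ` K)"
      by (auto intro!: bdd_aboveI2 bdd_belowI2)
  qed
  have "width (f ` K) u = width K (R u)" for u
  proof -
    have "(SUP x\<in>f ` K. x \<bullet> u) = (SUP x\<in>K. f 0 \<bullet> u + x \<bullet> R u)"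
      by (subst Q(2)[abs_def]) (simp add: image_image inner_add_left adj)
    also have "\<dots> = f 0 \<bullet> u + (SUP x\<in>K. x \<bullet> R u)"
      by (rule SUP_add_real[OF K(2) fin(1)])
    finally have 1: "(SUP x\<in>f ` K. x \<bullet> u) = f 0 \<bullet> u + (SUP x\<in>K. x \<bullet> R u)" .
    have "(INF x\<in>f ` K. x \<bullet> u) = (INF x\<in>K. f 0 \<bullet> u + x \<bullet> R u)"
      by (subst Q(2)[abs_def]) (simp add: image_image inner_add_left adj)
    also have "\<dots> = f 0 \<bullet> u + (INF x\<in>K. x \<bullet> R u)"
      by (rule INF_add_real[OF K(2) fin(2)])
    finally show ?thesis using 1 by (simp add: width_def)
  qed
  then show ?thesis using that R(1) by blast
qed

text \<open>The rotation that positions the ellipsoid disappears because the distribution of directions is invariant.\<close>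

lemma mean_width_ellipsoid:
  assumes f: "isometry f" and pos: "a > 0" "b > 0" "c > 0"
  shows "ennreal (mean_width (f ` axis_ellipsoid a b c)) = 2 * (\<integral>\<^sup>+u. ennreal (norm (scale3 a b c u)) \<partial>uniform_sphere)"
    and "(\<integral>\<^sup>+u. ennreal (norm (scale3 a b c u)) \<partial>uniform_sphere) < \<infinity>"
proof -
  interpret prob_space uniform_sphere by (rule prob_space_uniform_sphere)
  have ne: "axis_ellipsoid a b c \<noteq> {}" by (simp add: axis_ellipsoid_eq_image[OF pos])
  obtain R where R: "orthogonal_transformation R"
    and w: "\<And>u. width (f ` axis_ellipsoid a b c) u = 2 * norm (scale3 a b c (R u))"
    using width_isometric_image[OF f compact_imp_bounded[OF compact_axis_ellipsoid[OF pos]] ne]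
      width_axis_ellipsoid[OF pos] by metis
  note [measurable] = measurable_orthogonal[OF R]
  obtain B where B: "\<And>u. norm (scale3 a b c u) \<le> B * norm u"
    using linear_bounded[OF linear_scale3] by blast
  have int: "integrable uniform_sphere (\<lambda>u. norm (scale3 a b c (S u)))"
    if S: "orthogonal_transformation S" for S
  proof (rule integrable_const_bound[where B=B])
    show "AE u in uniform_sphere. norm (norm (scale3 a b c (S u))) \<le> B"
      using AE_uniform_sphere
    proof eventually_elim
      case (elim u)
      then show ?case using B[of "S u"] by (simp add: orthogonal_transformation_norm[OF S])
    qed
    show "(\<lambda>u. norm (scale3 a b c (S u))) \<in> borel_measurable uniform_sphere"
      using measurable_orthogonal[OF S] by measurable
  qed
  have "ennreal (mean_width (f ` axis_ellipsoid a b c)) = (\<integral>\<^sup>+u. ennreal (2 * norm (scale3 a b c (R u))) \<partial>uniform_sphere)"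
    unfolding mean_width_def w using int[OF R] by (intro nn_integral_eq_integral[symmetric]) auto
  also have "\<dots> = 2 * (\<integral>\<^sup>+u. ennreal (norm (scale3 a b c (R u))) \<partial>uniform_sphere)"
    by (simp add: ennreal_mult nn_integral_cmult)
  also have "(\<integral>\<^sup>+u. ennreal (norm (scale3 a b c (R u))) \<partial>uniform_sphere)
      = (\<integral>\<^sup>+u. ennreal (norm (scale3 a b c u)) \<partial>uniform_sphere)"
    by (rule nn_integral_uniform_sphere_orthogonal[OF R]) measurable
  finally show "ennreal (mean_width (f ` axis_ellipsoid a b c)) = 2 * (\<integral>\<^sup>+u. ennreal (norm (scale3 a b c u)) \<partial>uniform_sphere)" .
  show "(\<integral>\<^sup>+u. ennreal (norm (scale3 a b c u)) \<partial>uniform_sphere) < \<infinity>"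
    using int[OF orthogonal_transformation_id] by (simp add: integrable_iff_bounded)
qed

section \<open>Area in planes\<close>

text \<open>The Lipschitz bound for the map that sends \<open>g x\<close> to \<open>f x\<close>; in this form it compares two images of the same set in both directions without naming inverse maps.\<close>

lemma area_image_le_image:
  assumes "L > 0" and le: "\<And>x y. x \<in> S \<Longrightarrow> y \<in> S \<Longrightarrow> dist (f x) (f y) \<le> L * dist (g x) (g y)"
  shows "area (f ` S) \<le> ennreal (L\<^sup>2) * area (g ` S)"
proof -
  let ?h = "\<lambda>w. f (inv_into S g w)"
  have h: "?h (g x) = f x" if "x \<in> S" for x
    using le[of "inv_into S g (g x)" x] that by (simp add: inv_into_into f_inv_into_f)
  have "f ` S = ?h ` g ` S" using h by (auto simp: image_image)
  moreover have "area (?h ` g ` S) \<le> ennreal (L\<^sup>2) * area (g ` S)"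
  proof (rule area_Lipschitz_image_le[OF \<open>L > 0\<close>])
    fix u v assume "u \<in> g ` S" "v \<in> g ` S"
    then show "dist (?h u) (?h v) \<le> L * dist u v"
      using le h by auto
  qed
  ultimately show ?thesis by simp
qed

text \<open>Cover the square by \<open>N\<^sup>2\<close> squares of side \<open>1/N\<close>; the total area of discs of diameter \<open>2/N\<close> is \<open>\<pi>\<close> for every \<open>N\<close>.\<close>

lemma area_unit_square_finite:
  "area {y::real^3. y$3 = 0 \<and> y$1 \<in> {0..1} \<and> y$2 \<in> {0..1}} < \<infinity>" (is "area ?S < _")
proof -
  have "area ?S \<le> ennreal pi"
  proof (rule area_leI)
    fix \<delta> :: real assume "\<delta> > 0"
    then obtain m where m: "1 / real (Suc m) < \<delta> / 2"
      using nat_approx_posE[of "\<delta> / 2"] by auto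
    define N where "N = Suc m"
    have N: "real N > 0" "2 / real N \<le> \<delta>" using m by (auto simp: N_def field_simps)
    define I where "I k = {real k / real N .. (real k + 1) / real N}" for k :: nat
    define C where "C i = (if i < N * N then {y::real^3. y$3 = 0 \<and> y$1 \<in> I (i div N) \<and> y$2 \<in> I (i mod N)} else {})" for i
    have I: "\<bar>p - q\<bar> \<le> 1 / real N" if "p \<in> I k" "q \<in> I k" for p q k
      using that by (auto simp: I_def add_divide_distrib abs_le_iff)
    have dist: "dist y z \<le> 2 / real N" if "y \<in> C i" "z \<in> C i" for y z i
    proof -
      have "dist y z \<le> (\<Sum>j\<in>UNIV. \<bar>(y - z) $ j\<bar>)" unfolding dist_norm by (rule norm_le_l1_cart)
      also have "\<dots> = \<bar>y$1 - z$1\<bar> + \<bar>y$2 - z$2\<bar> + \<bar>y$3 - z$3\<bar>" by (simp add: sum_3)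
      also have "\<dots> \<le> 1 / real N + 1 / real N + 0"
        using that I by (intro add_mono) (auto simp: C_def split: if_splits)
      finally show ?thesis by simp
    qed
    have bd: "bounded (C i)" for i unfolding bounded_two_points using dist by blast
    have dia: "diameter (C i) \<le> 2 / real N" for i
      using dist N(1) by (intro diameter_le) (auto simp: dist_norm)
    have ex: "\<exists>k<N. p \<in> I k" if p: "p \<in> {0..1}" for p
    proof (cases "p = 1")
      case True
      then show ?thesis using N(1) by (intro exI[of _ m]) (auto simp: I_def N_def field_simps)
    next
      case False
      let ?k = "nat \<lfloor>p * real N\<rfloor>"
      have "p * real N < real N" using p False N(1) by simp
      then have "?k < N" using p by (simp add: nat_less_iff floor_less_iff)
      moreover have "p \<in> I ?k"
        using p N(1) by (auto simp: I_def pos_divide_le_eq pos_le_divide_eq of_nat_nat)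
      ultimately show ?thesis by blast
    qed
    have "?S \<subseteq> (\<Union>i. C i)"
    proof
      fix y assume y: "y \<in> ?S"
      then obtain k l where kl: "k < N" "y$1 \<in> I k" "l < N" "y$2 \<in> I l" using ex by blast
      have "k * N + l < N * N"
      proof -
        have "k * N + l < k * N + N" using kl by simp
        also have "\<dots> = (k + 1) * N" by simp
        also have "\<dots> \<le> N * N" using kl by (intro mult_right_mono) auto
        finally show ?thesis .
      qed
      then have "y \<in> C (k * N + l)" using y kl by (simp add: C_def)
      then show "y \<in> (\<Union>i. C i)" by (rule UN_I[OF UNIV_I])
    qed
    then have "C \<in> small_covers \<delta> ?S"
      using bd order_trans[OF dia N(2)] by (simp add: small_covers_def)
    then have "area_at \<delta> ?S \<le> (\<Sum>i. disc_area (C i))" by (rule area_at_le)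
    also have "\<dots> = (\<Sum>i<N * N. disc_area (C i))"
      by (rule suminf_finite) (auto simp: C_def)
    also have "\<dots> \<le> (\<Sum>i<N * N. ennreal (pi * (1 / real N)\<^sup>2))"
      using dia bd by (intro sum_mono ennreal_leI mult_left_mono power_mono)
        (auto simp: diameter_ge_0 field_simps)
    also have "\<dots> = ennreal (real (N * N) * (pi * (1 / real N)\<^sup>2))"
      by (simp only: sum_constant card_lessThan ennreal_of_nat_eq_real_of_nat) (subst ennreal_mult[symmetric], auto)
    also have "real (N * N) * (pi * (1 / real N)\<^sup>2) = pi"
      using N(1) by (simp add: power2_eq_square)
    finally show "area_at \<delta> ?S \<le> ennreal pi" .
  qed
  also have "\<dots> < \<infinity>" by simp
  finally show ?thesis .
qed

lemma area_bounded_horizontal_finite: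
  assumes "bounded S" "\<And>y. y \<in> S \<Longrightarrow> y$3 = 0"
  shows "area S < \<infinity>"
proof -
  obtain R where R: "R > 0" "\<And>y. y \<in> S \<Longrightarrow> norm y \<le> R"
    using assms(1) by (auto simp: bounded_pos)
  let ?Q = "{y::real^3. y$3 = 0 \<and> y$1 \<in> {0..1} \<and> y$2 \<in> {0..1}}"
  let ?f = "\<lambda>y::real^3. (2 * R) *\<^sub>R y - vector [R, R, 0]"
  have "S \<subseteq> ?f ` ?Q"
  proof
    fix y assume y: "y \<in> S"
    let ?z = "(1 / (2 * R)) *\<^sub>R (y + vector [R, R, 0])"
    have "\<bar>y $ i\<bar> \<le> R" for i
      using component_le_norm_cart[of y i] R(2)[OF y] by linarith
    then have b: "- R \<le> y $ i" "y $ i \<le> R" for i by (auto simp: abs_le_iff minus_le_iff)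
    show "y \<in> ?f ` ?Q"
    proof (rule image_eqI)
      show "y = ?f ?z" using R(1) by simp
      show "?z \<in> ?Q"
      proof -
        have "0 \<le> (t + R) / (2 * R)" "(t + R) / (2 * R) \<le> 1" if "- R \<le> t" "t \<le> R" for t
          using that R(1) by (simp_all add: pos_divide_le_eq)
        from this[OF b[of 1]] this[OF b[of 2]] show ?thesis using assms(2)[OF y] by simp
      qed
    qed
  qed
  then have "area S \<le> area (?f ` ?Q)" by (rule area_mono)
  also have "\<dots> \<le> ennreal ((2 * R)\<^sup>2) * area ?Q"
    using R(1) by (intro area_Lipschitz_image_le) (auto simp: dist_norm simp flip: scaleR_diff_right)
  also have "\<dots> < \<infinity>" using area_unit_square_finite by (simp add: ennreal_mult_less_top)
  finally show ?thesis .
qed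

lemma area_bounded_planar_finite:
  fixes n :: "real^3"
  assumes "norm n = 1" "bounded S" "\<And>y. y \<in> S \<Longrightarrow> y \<bullet> n = 0"
  shows "area S < \<infinity>"
proof -
  have "norm n = norm (axis 3 1 :: real^3)" using assms(1) by simp
  then obtain Q where Q: "orthogonal_transformation Q" "Q n = (axis 3 1 :: real^3)"
    using orthogonal_mapping_exists by blast
  have "area (Q ` S) < \<infinity>"
  proof (rule area_bounded_horizontal_finite)
    show "bounded (Q ` S)"
      using assms(2) orthogonal_transformation_linear[OF Q(1)]
      by (simp add: bounded_linear_image linear_conv_bounded_linear)
    fix y assume "y \<in> Q ` S"
    then obtain x where x: "x \<in> S" "y = Q x" by auto
    then have "y \<bullet> Q n = 0" using assms(3) Q(1) by (simp add: orthogonal_transformation_def)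
    then show "y $ 3 = 0" by (simp add: Q(2) inner_axis)
  qed
  also have "area (Q ` S) = area S"
    using Q(1) by (intro area_isometric_image) (simp add: orthogonal_transformation_isometry)
  finally show ?thesis .
qed

text \<open>For \<open>D\<close> in the plane orthogonal to the unit vector \<open>n\<close>, this is the cylinder of height 2 over \<open>D\<close>. Its
  volume is twice the planar Lebesgue measure of \<open>D\<close>, which avoids coordinates on the plane. Heights
  range over \<open>[-1, 1]\<close> so that the condition on the height is invariant under \<open>y \<mapsto> -y\<close>.\<close>

definition slab :: "real^3 \<Rightarrow> (real^3) set \<Rightarrow> (real^3) set" where
  "slab n D = {y. y - (y \<bullet> n) *\<^sub>R n \<in> D \<and> \<bar>y \<bullet> n\<bar> \<le> 1}"

lemma compact_slab:
  assumes "norm n = 1" "compact D"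
  shows "compact (slab n D)"
proof -
  have "closed ((\<lambda>y. y - (y \<bullet> n) *\<^sub>R n) -` D)"
    using assms by (intro closed_vimage compact_imp_closed continuous_intros) auto
  moreover have "closed {y. \<bar>y \<bullet> n\<bar> \<le> 1}"
    by (intro closed_Collect_le continuous_intros)
  moreover have "slab n D = (\<lambda>y. y - (y \<bullet> n) *\<^sub>R n) -` D \<inter> {y. \<bar>y \<bullet> n\<bar> \<le> 1}"
    by (auto simp: slab_def)
  ultimately have "closed (slab n D)" by (simp only: closed_Int)
  moreover have "bounded (slab n D)"
  proof -
    obtain B where B: "\<And>y. y \<in> D \<Longrightarrow> norm y \<le> B"
      using compact_imp_bounded[OF assms(2)] by (auto simp: bounded_iff)
    have "norm y \<le> B + 1" if "y \<in> slab n D" for y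
    proof -
      have "norm y = norm ((y - (y \<bullet> n) *\<^sub>R n) + (y \<bullet> n) *\<^sub>R n)" by simp
      also have "\<dots> \<le> norm (y - (y \<bullet> n) *\<^sub>R n) + norm ((y \<bullet> n) *\<^sub>R n)" by (rule norm_triangle_ineq)
      also have "\<dots> \<le> B + 1" using that B assms(1) by (intro add_mono) (auto simp: slab_def)
      finally show ?thesis .
    qed
    then show ?thesis by (auto simp: bounded_iff)
  qed
  ultimately show ?thesis by (simp add: compact_eq_bounded_closed)
qed

lemma nn_integral_lborel_uminus:
  fixes f :: "real^3 \<Rightarrow> ennreal"
  assumes [measurable]: "f \<in> borel_measurable borel"
  shows "(\<integral>\<^sup>+y. f (- y) \<partial>lborel) = (\<integral>\<^sup>+y. f y \<partial>lborel)"
proof -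
  have Q: "orthogonal_transformation (uminus :: real^3 \<Rightarrow> real^3)"
    by (simp add: orthogonal_transformation_isometry dist_minus)
  show ?thesis
    using nn_integral_distr[of uminus lborel borel f] lborel_distr_orthogonal[OF Q] measurable_orthogonal[OF Q]
    by simp
qed

lemma emeasure_lborel_translate:
  fixes x :: "real^3"
  assumes [measurable]: "S \<in> sets borel"
  shows "emeasure lborel {y. x + y \<in> S} = emeasure lborel S"
proof -
  have "emeasure lborel S = emeasure (distr lborel borel ((+) x)) S"
    by (simp add: lborel_distr_plus)
  also have "\<dots> = emeasure lborel {y. x + y \<in> S}"
    by (subst emeasure_distr) (auto simp: vimage_def)
  finally show ?thesis by simp
qed

text \<open>Area restricted to \<open>K\<close>. It is finite when \<open>K\<close> has finite area, so that Tonelli's theorem applies, whereas area on the whole space is not sigma-finite.\<close>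

definition area_on :: "(real^3) set \<Rightarrow> (real^3) measure" where
  "area_on K = density area_measure (indicator K)"

lemma sets_area_on [measurable_cong, simp]: "sets (area_on K) = sets borel"
  and space_area_on [simp]: "space (area_on K) = UNIV"
  by (simp_all add: area_on_def)

lemma emeasure_area_on:
  assumes "K \<in> sets borel" "X \<in> sets borel"
  shows "emeasure (area_on K) X = area (K \<inter> X)"
  unfolding area_on_def using assms
  by (subst emeasure_density) (auto simp: indicator_inter_arith[symmetric] nn_integral_indicator)

lemma AE_area_on: "K \<in> sets borel \<Longrightarrow> AE x in area_on K. x \<in> K"
  unfolding area_on_def by (subst AE_density) (auto simp: indicator_def)

lemma sigma_finite_area_on:
  assumes "K \<in> sets borel" "area K < \<infinity>"
  shows "sigma_finite_measure (area_on K)"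
proof -
  have "finite_measure (area_on K)"
    using assms by (intro finite_measureI) (simp add: emeasure_area_on)
  then show ?thesis by (simp add: finite_measure_def)
qed

text \<open>Half of the uniqueness proof for translation invariant measures: integrate the indicator of "the
  translate of \<open>x\<close> by the planar part of \<open>y\<close> lies in \<open>B\<close> and \<open>y\<close> has height at most 1" over \<open>x\<close> in \<open>A\<close> with respect to area
  and over \<open>y\<close> with respect to volume, in both orders.\<close>

lemma area_times_slab:
  fixes n :: "real^3"
  assumes n: "norm n = 1" and A: "compact A" "\<And>x. x \<in> A \<Longrightarrow> x \<bullet> n = 0"
    and B: "compact B" "\<And>x. x \<in> B \<Longrightarrow> x \<bullet> n = 0"
  shows "area A * emeasure lborel (slab n B)
    = (\<integral>\<^sup>+y. area (A \<inter> {x. x + (y - (y \<bullet> n) *\<^sub>R n) \<in> B}) * indicator {y. \<bar>y \<bullet> n\<bar> \<le> 1} y \<partial>lborel)"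
proof -
  have [measurable]: "A \<in> sets borel" "B \<in> sets borel" "slab n B \<in> sets borel"
    using A(1) B(1) compact_slab[OF n B(1)] by (simp_all add: borel_compact)
  have fin: "area A < \<infinity>" by (rule area_bounded_planar_finite[OF n compact_imp_bounded[OF A(1)] A(2)])
  interpret A: sigma_finite_measure "area_on A" by (rule sigma_finite_area_on) (use fin in auto)
  interpret pair_sigma_finite "area_on A" "lborel :: (real^3) measure" ..
  let ?k = "\<lambda>x y. indicator B (x + (y - (y \<bullet> n) *\<^sub>R n)) * indicator {y. \<bar>y \<bullet> n\<bar> \<le> 1} y :: ennreal"
  have [measurable]: "(\<lambda>y. y \<bullet> n) \<in> borel_measurable borel" by measurable
  have [measurable]: "{y. \<bar>y \<bullet> n\<bar> \<le> 1} \<in> sets borel" by measurable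
  have "area A * emeasure lborel (slab n B) = (\<integral>\<^sup>+x. emeasure lborel (slab n B) \<partial>area_on A)"
    by (simp add: emeasure_area_on mult.commute)
  also have "\<dots> = (\<integral>\<^sup>+x. (\<integral>\<^sup>+y. ?k x y \<partial>lborel) \<partial>area_on A)"
  proof (rule nn_integral_cong_AE, use AE_area_on[OF \<open>A \<in> sets borel\<close>] in eventually_elim)
    fix x :: "real^3" assume "x \<in> A"
    then have "x \<bullet> n = 0" by (rule A(2))
    show "emeasure lborel (slab n B) = (\<integral>\<^sup>+y. ?k x y \<partial>lborel)"
    proof -
      have "?k x y = indicator {y. x + y \<in> slab n B} y" for y
        using \<open>x \<bullet> n = 0\<close> by (auto simp: indicator_def slab_def inner_add_left algebra_simps)
      moreover have [measurable]: "{y. x + y \<in> slab n B} \<in> sets borel" by measurable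
      ultimately have "(\<integral>\<^sup>+y. ?k x y \<partial>lborel) = emeasure lborel {y. x + y \<in> slab n B}"
        by simp
      then show ?thesis by (simp add: emeasure_lborel_translate)
    qed
  qed
  also have "\<dots> = (\<integral>\<^sup>+y. (\<integral>\<^sup>+x. ?k x y \<partial>area_on A) \<partial>lborel)"
    by (rule Fubini'[symmetric]) measurable
  also have "\<dots> = (\<integral>\<^sup>+y. area (A \<inter> {x. x + (y - (y \<bullet> n) *\<^sub>R n) \<in> B}) * indicator {y. \<bar>y \<bullet> n\<bar> \<le> 1} y \<partial>lborel)"
  proof (rule nn_integral_cong)
    fix y :: "real^3"
    have [measurable]: "{x. x + (y - (y \<bullet> n) *\<^sub>R n) \<in> B} \<in> sets borel" by measurable
    have "(\<integral>\<^sup>+x. ?k x y \<partial>area_on A)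
      = (\<integral>\<^sup>+x. indicator {x. x + (y - (y \<bullet> n) *\<^sub>R n) \<in> B} x \<partial>area_on A) * indicator {y. \<bar>y \<bullet> n\<bar> \<le> 1} y"
      by (subst nn_integral_multc[symmetric]) (auto intro!: nn_integral_cong simp: indicator_def)
    then show "(\<integral>\<^sup>+x. ?k x y \<partial>area_on A)
      = area (A \<inter> {x. x + (y - (y \<bullet> n) *\<^sub>R n) \<in> B}) * indicator {y. \<bar>y \<bullet> n\<bar> \<le> 1} y"
      by (simp add: emeasure_area_on)
  qed
  finally show ?thesis .
qed

text \<open>In the integral of the previous lemma \<open>A\<close> and \<open>B\<close> change roles under the substitution of \<open>-y\<close> for
  \<open>y\<close>, because area is translation invariant. So the ratio of area and slab volume is the same for all compact subsets of the plane.\<close>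

lemma area_slab_swap:
  fixes n :: "real^3"
  assumes n: "norm n = 1" and A: "compact A" "\<And>x. x \<in> A \<Longrightarrow> x \<bullet> n = 0"
    and B: "compact B" "\<And>x. x \<in> B \<Longrightarrow> x \<bullet> n = 0"
  shows "area A * emeasure lborel (slab n B) = area B * emeasure lborel (slab n A)"
proof -
  let ?p = "\<lambda>y. y - (y \<bullet> n) *\<^sub>R n"
  define F where "F y = area (A \<inter> {x. x + ?p y \<in> B}) * indicator {y. \<bar>y \<bullet> n\<bar> \<le> 1} y" for y
  define G where "G y = area (B \<inter> {x. x + ?p y \<in> A}) * indicator {y. \<bar>y \<bullet> n\<bar> \<le> 1} y" for y
  have [measurable]: "A \<in> sets borel" "B \<in> sets borel"
    using A(1) B(1) by (simp_all add: borel_compact)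
  have fin: "area B < \<infinity>" by (rule area_bounded_planar_finite[OF n compact_imp_bounded[OF B(1)] B(2)])
  interpret B: sigma_finite_measure "area_on B" by (rule sigma_finite_area_on) (use fin in auto)
  have [measurable]: "G \<in> borel_measurable borel"
  proof -
    have "(\<lambda>y. emeasure (area_on B) {x \<in> space (area_on B). x + ?p y \<in> A}) \<in> borel_measurable (borel :: (real^3) measure)"
      by measurable
    moreover have "{x. x + ?p y \<in> A} \<in> sets borel" for y by measurable
    ultimately have [measurable]: "(\<lambda>y. area (B \<inter> {x. x + ?p y \<in> A})) \<in> borel_measurable borel"
      by (simp add: emeasure_area_on)
    have [measurable]: "{y. \<bar>y \<bullet> n\<bar> \<le> 1} \<in> sets borel" by measurable
    show ?thesis unfolding G_def[abs_def] by measurable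
  qed
  have "F y = G (- y)" for y
  proof -
    have "area ((\<lambda>x. x + ?p y) ` (A \<inter> {x. x + ?p y \<in> B})) = area (A \<inter> {x. x + ?p y \<in> B})"
      by (rule area_isometric_image) (simp add: dist_norm)
    moreover have "(\<lambda>x. x + ?p y) ` (A \<inter> {x. x + ?p y \<in> B}) = B \<inter> {x. x + ?p (- y) \<in> A}"
    proof (intro set_eqI iffI)
      fix z assume "z \<in> B \<inter> {x. x + ?p (- y) \<in> A}"
      then show "z \<in> (\<lambda>x. x + ?p y) ` (A \<inter> {x. x + ?p y \<in> B})"
        by (intro image_eqI[of _ _ "z + ?p (- y)"]) (auto simp: algebra_simps)
    qed (auto simp: algebra_simps)
    ultimately show ?thesis by (simp add: F_def G_def indicator_def)
  qed
  then have "(\<integral>\<^sup>+y. F y \<partial>lborel) = (\<integral>\<^sup>+y. G y \<partial>lborel)"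
    using nn_integral_lborel_uminus[of G] by simp
  then show ?thesis
    using area_times_slab[OF n A B] area_times_slab[OF n B A] by (simp add: F_def G_def)
qed

lemma slab_orthogonal_image:
  assumes "orthogonal_transformation Q"
  shows "slab (Q n) (Q ` D) = Q ` slab n D"
proof -
  have lin: "linear Q" and inj: "inj Q"
    using assms by (simp_all add: orthogonal_transformation_linear orthogonal_transformation_inj)
  have ip: "Q x \<bullet> Q n = x \<bullet> n" for x
    using assms by (simp add: orthogonal_transformation_def)
  have eq: "Q x - (x \<bullet> n) *\<^sub>R Q n = Q (x - (x \<bullet> n) *\<^sub>R n)" for x
    using lin by (simp add: linear_diff linear_cmul)
  have mem: "Q x \<in> slab (Q n) (Q ` D) \<longleftrightarrow> x \<in> slab n D" for x
    unfolding slab_def using inj by (simp add: ip eq inj_image_mem_iff)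
  show ?thesis
    using mem orthogonal_transformation_surj[OF assms] by (auto simp: image_iff) (metis surjD)
qed

text \<open>One factor serves for all planes, since each plane can be rotated to the horizontal one. The factor is computed from the unit disc there, whose slab has positive volume since it contains the unit ball.\<close>

lemma planar_area_proportional_slab:
  "\<exists>k::ennreal. \<forall>n D. norm n = 1 \<and> compact D \<and> (\<forall>x\<in>D. x \<bullet> n = 0) \<longrightarrow>
     area D = k * emeasure lborel (slab n D)"
proof -
  define e :: "real^3" where "e = axis 3 1"
  have e: "norm e = 1" by (simp add: e_def)
  define U where "U = cball 0 1 \<inter> {x. x \<bullet> e = 0}"
  have U: "compact U" "\<And>x. x \<in> U \<Longrightarrow> x \<bullet> e = 0"
    unfolding U_def by (intro compact_Int_closed closed_Collect_eq continuous_intros) auto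
  let ?V = "emeasure lborel (slab e U)"
  have "ball 0 1 \<subseteq> slab e U"
  proof
    fix y :: "real^3" assume y: "y \<in> ball 0 1"
    have 1: "\<bar>y \<bullet> e\<bar> \<le> 1" using Cauchy_Schwarz_ineq2[of y e] y e by simp
    have "e \<bullet> e = 1" using e by (simp add: dot_square_norm)
    then have "(norm (y - (y \<bullet> e) *\<^sub>R e))\<^sup>2 = (norm y)\<^sup>2 - (y \<bullet> e)\<^sup>2"
      unfolding power2_norm_eq_inner
      by (simp add: inner_diff_left inner_diff_right inner_commute[of e y] power2_eq_square)
    then have "(norm (y - (y \<bullet> e) *\<^sub>R e))\<^sup>2 \<le> (norm y)\<^sup>2" by simp
    then have "norm (y - (y \<bullet> e) *\<^sub>R e) \<le> norm y" by (rule power2_le_imp_le) simp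
    moreover have "(y - (y \<bullet> e) *\<^sub>R e) \<bullet> e = 0"
      using e by (simp add: inner_diff_left dot_square_norm)
    ultimately show "y \<in> slab e U" using 1 y by (simp add: slab_def U_def)
  qed
  then have "emeasure lborel (ball (0::real^3) 1) \<le> ?V"
    using borel_compact[OF compact_slab[OF e U(1)]] by (intro emeasure_mono) auto
  then have V0: "?V \<noteq> 0" using unit_ball_volume(1) by auto
  have V1: "?V \<noteq> top"
    using emeasure_bounded_finite[OF compact_imp_bounded[OF compact_slab[OF e U(1)]]] by simp
  have "area D = area U / ?V * emeasure lborel (slab n D)"
    if n: "norm n = 1" and D: "compact D" "\<And>x. x \<in> D \<Longrightarrow> x \<bullet> n = 0" for n D
  proof -
    have "norm n = norm e" using n e by simp
    then obtain Q where Q: "orthogonal_transformation Q" "Q n = e"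
      using orthogonal_mapping_exists by blast
    have lin: "linear Q" using Q(1) by (rule orthogonal_transformation_linear)
    have QD: "compact (Q ` D)" by (rule linear_compact_image[OF lin D(1)])
    have perp: "x \<bullet> e = 0" if "x \<in> Q ` D" for x
      using that D(2) Q by (auto simp: orthogonal_transformation_def)
    have "area (Q ` D) * ?V = area U * emeasure lborel (slab e (Q ` D))"
      by (rule area_slab_swap[OF e QD perp U])
    moreover have "area (Q ` D) = area D"
      using Q(1) by (intro area_isometric_image) (simp add: orthogonal_transformation_isometry)
    moreover have "emeasure lborel (slab e (Q ` D)) = emeasure lborel (slab n D)"
      using slab_orthogonal_image[OF Q(1), of n D] emeasure_lborel_linear_image[OF lin compact_slab[OF n D(1)]]
        orthogonal_transformation_det[OF Q(1)] by (simp add: Q(2))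
    ultimately have "area D * ?V = area U * emeasure lborel (slab n D)" by simp
    then have "area D * ?V / ?V = area U * emeasure lborel (slab n D) / ?V" by simp
    then show ?thesis
      using V0 V1 by (simp add: ennreal_mult_divide_eq ennreal_divide_times ennreal_times_divide mult.commute)
  qed
  then show ?thesis by blast
qed

text \<open>The determinant of \<open>A (I - x x\<^sup>T) + n x\<^sup>T\<close> for \<open>A = diag(a, b, c)\<close>, expanded; here \<open>(x, y, z)\<close> are the
  coordinates of the vector \<open>x\<close> and \<open>(l, m, n)\<close> those of the vector \<open>n\<close>. It is an instance of the matrix determinant lemma.\<close>

lemma det_oblique_3:
  fixes a b c x y z l m n :: real
  shows "(a - a*x*x + l*x) * (b - b*y*y + m*y) * (c - c*z*z + n*z) +
    (l*y - a*x*y) * (m*z - b*y*z) * (n*x - c*z*x) +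
    (l*z - a*x*z) * (m*x - b*y*x) * (n*y - c*z*y) -
    (a - a*x*x + l*x) * (m*z - b*y*z) * (n*y - c*z*y) -
    (l*y - a*x*y) * (m*x - b*y*x) * (c - c*z*z + n*z) -
    (l*z - a*x*z) * (b - b*y*y + m*y) * (n*x - c*z*x)
   = a*b*c * (1 - (x*x + y*y + z*z)) + b*c*l*x + a*c*m*y + a*b*n*z"
  by algebra

text \<open>The plane orthogonal to \<open>x\<close> is mapped to the plane orthogonal to \<open>w = A\<^sup>-\<^sup>1 x\<close>. The linear map \<open>M\<close>
  that agrees with \<open>A\<close> on the first plane and sends its normal \<open>x\<close> to the unit normal of the second one maps slabs to
  slabs, so the area is scaled by its determinant \<open>a b c |w|\<close>.\<close>

lemma area_linear_image_planar:
  assumes pos: "a > 0" "b > 0" "c > 0" and x: "norm x = 1"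
    and D: "compact D" "\<And>y. y \<in> D \<Longrightarrow> y \<bullet> x = 0"
  shows "area (scale3 a b c ` D) = ennreal (a * b * c * norm (scale3 (1/a) (1/b) (1/c) x)) * area D"
proof -
  obtain k :: ennreal where k: "\<And>n D. norm n = 1 \<Longrightarrow> compact D \<Longrightarrow> (\<And>x. x \<in> D \<Longrightarrow> x \<bullet> n = 0)
      \<Longrightarrow> area D = k * emeasure lborel (slab n D)"
    using planar_area_proportional_slab by blast
  let ?A = "scale3 a b c"
  define w where "w = scale3 (1/a) (1/b) (1/c) x"
  have "?A w = x" using pos by (simp add: w_def scale3_inverse)
  then have w0: "w \<noteq> 0" using x linear_0[OF linear_scale3] by force
  define n where "n = w /\<^sub>R norm w"
  have n: "norm n = 1" using w0 by (simp add: n_def)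
  have perp: "?A y \<bullet> n = 0" if "y \<bullet> x = 0" for y
  proof -
    have "?A y \<bullet> w = y \<bullet> x" using pos by (simp add: inner_real_3 w_def)
    then show ?thesis using that by (simp add: n_def)
  qed
  \<comment> \<open>Equal to \<open>A\<close> on the plane orthogonal to \<open>x\<close>, with \<open>x\<close> sent to \<open>n\<close>.\<close>
  define M where "M y = ?A (y - (y \<bullet> x) *\<^sub>R x) + (y \<bullet> x) *\<^sub>R n" for y
  have linM: "linear M"
    unfolding M_def by (rule linearI)
      (simp_all add: linear_add[OF linear_scale3] linear_diff[OF linear_scale3] linear_cmul[OF linear_scale3] algebra_simps)
  have xx: "x \<bullet> x = 1" using x by (simp add: dot_square_norm)
  have nn: "n \<bullet> n = 1" using n by (simp add: dot_square_norm)
  have slab_image: "slab n (?A ` D) = M ` slab x D"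
  proof (intro set_eqI iffI)
    fix z assume "z \<in> slab n (?A ` D)"
    then obtain d where d: "d \<in> D" "z - (z \<bullet> n) *\<^sub>R n = ?A d" "\<bar>z \<bullet> n\<bar> \<le> 1"
      by (auto simp: slab_def)
    define y where "y = d + (z \<bullet> n) *\<^sub>R x"
    have yx: "y \<bullet> x = z \<bullet> n" using D(2)[OF d(1)] xx by (simp add: y_def inner_add_left)
    have yd: "y - (y \<bullet> x) *\<^sub>R x = d" unfolding yx by (simp add: y_def)
    have "M y = z" unfolding M_def yd unfolding yx d(2)[symmetric] by simp
    moreover have "y \<in> slab x D" using d unfolding slab_def mem_Collect_eq yd unfolding yx by simp
    ultimately show "z \<in> M ` slab x D" by blast
  next
    fix z assume "z \<in> M ` slab x D"
    then obtain y where y: "z = M y" "y - (y \<bullet> x) *\<^sub>R x \<in> D" "\<bar>y \<bullet> x\<bar> \<le> 1" by (auto simp: slab_def)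
    have zn: "z \<bullet> n = y \<bullet> x"
      unfolding y(1) M_def inner_add_left perp[OF D(2)[OF y(2)]] using nn by simp
    have "z - (z \<bullet> n) *\<^sub>R n = ?A (y - (y \<bullet> x) *\<^sub>R x)" unfolding zn by (simp add: y(1) M_def)
    then show "z \<in> slab n (?A ` D)" using y(2,3) zn by (auto simp: slab_def)
  qed
  have det: "det (matrix M) = a * b * c * norm w"
  proof -
    have entries: "M (axis j 1) $ i = ?A (axis j 1) $ i - x $ j * ?A x $ i + x $ j * n $ i" for i j
      unfolding M_def by (simp add: linear_diff[OF linear_scale3] linear_cmul[OF linear_scale3] inner_axis')
    have "det (matrix M) = a*b*c * (1 - (x$1*x$1 + x$2*x$2 + x$3*x$3)) + b*c*n$1*x$1 + a*c*n$2*x$2 + a*b*n$3*x$3"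
      unfolding det_oblique_3[symmetric]
      by (simp add: det_3 matrix_def entries) (simp add: axis_def mult_ac)
    also have "\<dots> = b*c*n$1*x$1 + a*c*n$2*x$2 + a*b*n$3*x$3"
      using xx by (simp add: inner_real_3)
    also have "\<dots> = a * b * c * (n \<bullet> w)"
      using pos by (simp add: inner_real_3 w_def field_simps)
    also have "n \<bullet> w = norm w"
      using w0 by (simp add: n_def dot_square_norm power2_eq_square)
    finally show ?thesis .
  qed
  have AD: "compact (?A ` D)" by (rule linear_compact_image[OF linear_scale3 D(1)])
  have "area (?A ` D) = k * emeasure lborel (slab n (?A ` D))"
    using perp D(2) by (intro k[OF n AD]) auto
  also have "\<dots> = k * (ennreal (a * b * c * norm w) * emeasure lborel (slab x D))"
    unfolding slab_image
    using emeasure_lborel_linear_image[OF linM compact_slab[OF x D(1)]] pos by (simp add: det abs_mult)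
  also have "\<dots> = ennreal (a * b * c * norm w) * area D"
    using k[OF x D] by (simp add: mult_ac)
  finally show ?thesis by (simp add: w_def)
qed

section \<open>The surface area of an ellipsoid\<close>

definition cap :: "real^3 \<Rightarrow> real \<Rightarrow> (real^3) set" where
  "cap x r = sphere 0 1 \<inter> cball x r"

lemma compact_cap: "compact (cap x r)"
  by (simp add: cap_def compact_Int)

text \<open>Since \<open>|y| = |z|\<close>, the vector \<open>y - z\<close> is orthogonal to \<open>y + z\<close>, which is nearly \<open>2 x\<close>.\<close>

lemma cap_nearly_flat:
  assumes "y \<in> cap x r" "z \<in> cap x r" "norm x = 1"
  shows "\<bar>(y - z) \<bullet> x\<bar> \<le> r * norm (y - z)"
proof -
  have "norm y = 1" "norm z = 1" "norm (y - x) \<le> r" "norm (z - x) \<le> r"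
    using assms by (auto simp: cap_def dist_norm norm_minus_commute)
  note yz = this
  have "y \<bullet> y = 1" "z \<bullet> z = 1" using yz by (simp_all add: dot_square_norm)
  then have "(y - z) \<bullet> (y - x) + (y - z) \<bullet> (z - x) = - (2 * ((y - z) \<bullet> x))"
    by (simp add: inner_diff_left inner_diff_right inner_commute[of z y])
  then have "(y - z) \<bullet> ((y - x) + (z - x)) = - (2 * ((y - z) \<bullet> x))"
    by (simp only: inner_add_right)
  then have "2 * \<bar>(y - z) \<bullet> x\<bar> = \<bar>(y - z) \<bullet> ((y - x) + (z - x))\<bar>" by linarith
  also have "\<dots> \<le> norm (y - z) * norm ((y - x) + (z - x))" by (rule Cauchy_Schwarz_ineq2)
  also have "\<dots> \<le> norm (y - z) * (r + r)"
    by (intro mult_left_mono order_trans[OF norm_triangle_ineq] add_mono yz) simp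
  finally show ?thesis by (simp add: mult.commute)
qed

text \<open>Projecting a cap to the tangent plane at its centre changes differences by at most the relative amount
  \<open>r\<close>, all of it in the direction \<open>x\<close>. The constant \<open>\<kappa>\<close> bounds the distortion of \<open>A\<close>, so after applying
  \<open>A\<close> the relative change is at most \<open>\<kappa> r\<close>, and the map from one image to the other is Lipschitz in both directions.\<close>

lemma area_cap_projection:
  assumes x: "norm x = 1" and r: "0 < r" "\<kappa> * r < 1"
    and \<kappa>: "0 < \<kappa>" "\<And>v. norm (scale3 a b c x) * norm v \<le> \<kappa> * norm (scale3 a b c v)"
  shows "area (scale3 a b c ` (\<lambda>y. y - (y \<bullet> x) *\<^sub>R x) ` cap x r) \<le> ennreal ((1 + \<kappa> * r)\<^sup>2) * area (scale3 a b c ` cap x r)"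
    and "area (scale3 a b c ` cap x r) \<le> ennreal ((1 / (1 - \<kappa> * r))\<^sup>2) * area (scale3 a b c ` (\<lambda>y. y - (y \<bullet> x) *\<^sub>R x) ` cap x r)"
proof -
  let ?A = "scale3 a b c" and ?P = "\<lambda>y::real^3. y - (y \<bullet> x) *\<^sub>R x"
  have est: "norm ((?A y - ?A z) - (?A (?P y) - ?A (?P z))) \<le> \<kappa> * r * dist (?A y) (?A z)"
    if "y \<in> cap x r" "z \<in> cap x r" for y z
  proof -
    have "(?A y - ?A z) - (?A (?P y) - ?A (?P z)) = ((y - z) \<bullet> x) *\<^sub>R ?A x"
      by (simp add: linear_diff[OF linear_scale3] linear_cmul[OF linear_scale3] inner_diff_left scaleR_diff_left)
    then have "norm ((?A y - ?A z) - (?A (?P y) - ?A (?P z))) = \<bar>(y - z) \<bullet> x\<bar> * norm (?A x)"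
      by simp
    also have "\<dots> \<le> (r * norm (y - z)) * norm (?A x)"
      by (intro mult_right_mono cap_nearly_flat[OF that x]) simp
    also have "\<dots> = r * (norm (?A x) * norm (y - z))" by simp
    also have "\<dots> \<le> r * (\<kappa> * norm (?A (y - z)))"
      using r by (intro mult_left_mono \<kappa>) auto
    also have "\<dots> = \<kappa> * r * dist (?A y) (?A z)"
      by (simp add: dist_norm linear_diff[OF linear_scale3])
    finally show ?thesis .
  qed
  have "area ((\<lambda>y. ?A (?P y)) ` cap x r) \<le> ennreal ((1 + \<kappa> * r)\<^sup>2) * area (?A ` cap x r)"
  proof (rule area_image_le_image)
    show "0 < 1 + \<kappa> * r" using r \<kappa> by (simp add: add_pos_nonneg)
    fix y z assume yz: "y \<in> cap x r" "z \<in> cap x r"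
    have "dist (?A (?P y)) (?A (?P z)) \<le> dist (?A y) (?A z) + norm ((?A y - ?A z) - (?A (?P y) - ?A (?P z)))"
      using norm_triangle_ineq4[of "?A y - ?A z" "(?A y - ?A z) - (?A (?P y) - ?A (?P z))"]
      by (simp add: dist_norm)
    then show "dist (?A (?P y)) (?A (?P z)) \<le> (1 + \<kappa> * r) * dist (?A y) (?A z)"
      using est[OF yz] by (simp add: algebra_simps)
  qed
  then show "area (?A ` ?P ` cap x r) \<le> ennreal ((1 + \<kappa> * r)\<^sup>2) * area (?A ` cap x r)"
    by (simp add: image_image)
  have "area (?A ` cap x r) \<le> ennreal ((1 / (1 - \<kappa> * r))\<^sup>2) * area ((\<lambda>y. ?A (?P y)) ` cap x r)"
  proof (rule area_image_le_image)
    show "0 < 1 / (1 - \<kappa> * r)" using r by simp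
    fix y z assume yz: "y \<in> cap x r" "z \<in> cap x r"
    have "dist (?A y) (?A z) \<le> dist (?A (?P y)) (?A (?P z)) + norm ((?A y - ?A z) - (?A (?P y) - ?A (?P z)))"
      using norm_triangle_ineq[of "?A (?P y) - ?A (?P z)" "(?A y - ?A z) - (?A (?P y) - ?A (?P z))"]
      by (simp add: dist_norm)
    then have "(1 - \<kappa> * r) * dist (?A y) (?A z) \<le> dist (?A (?P y)) (?A (?P z))"
      using est[OF yz] by (simp add: algebra_simps)
    then show "dist (?A y) (?A z) \<le> 1 / (1 - \<kappa> * r) * dist (?A (?P y)) (?A (?P z))"
      using r by (simp add: pos_le_divide_eq mult.commute)
  qed
  then show "area (?A ` cap x r) \<le> ennreal ((1 / (1 - \<kappa> * r))\<^sup>2) * area (?A ` ?P ` cap x r)"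
    by (simp add: image_image)
qed

lemma scale3_id [simp]: "scale3 1 1 1 x = x"
  by (simp add: vec_eq_iff forall_3)

lemma cap_distortion:
  assumes pos: "a > 0" "b > 0" "c > 0"
  obtains \<kappa> where "\<kappa> \<ge> 1" "\<And>x v. norm x = 1 \<Longrightarrow> norm (scale3 a b c x) * norm v \<le> \<kappa> * norm (scale3 a b c v)"
proof -
  obtain B where B: "B > 0" "\<And>v. norm (scale3 a b c v) \<le> B * norm v"
    using linear_bounded_pos[OF linear_scale3] by blast
  obtain B' where B': "B' > 0" "\<And>v. norm (scale3 (1/a) (1/b) (1/c) v) \<le> B' * norm v"
    using linear_bounded_pos[OF linear_scale3] by blast
  have "norm (scale3 a b c x) * norm v \<le> max 1 (B * B') * norm (scale3 a b c v)" if "norm x = 1" for x v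
  proof -
    have 1: "norm (scale3 a b c x) \<le> B" using B(2)[of x] that by simp
    have 2: "norm v \<le> B' * norm (scale3 a b c v)"
      using B'(2)[of "scale3 a b c v"] pos by (simp add: scale3_inverse)
    have "norm (scale3 a b c x) * norm v \<le> B * (B' * norm (scale3 a b c v))"
      using 1 2 B(1) by (intro mult_mono) auto
    also have "\<dots> = (B * B') * norm (scale3 a b c v)" by simp
    also have "\<dots> \<le> max 1 (B * B') * norm (scale3 a b c v)"
      by (intro mult_right_mono) auto
    finally show ?thesis .
  qed
  then show ?thesis using that[of "max 1 (B * B')"] by auto
qed

text \<open>Pass from the cap to its planar projection, apply \<open>A\<close> there, where the area is scaled exactly, and return to the image of the cap. The factor \<open>q\<close> tends to 1 as \<open>r\<close> tends to 0, uniformly in \<open>x\<close>.\<close>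

lemma area_cap_image:
  assumes pos: "a > 0" "b > 0" "c > 0" and x: "norm x = 1"
    and \<kappa>: "\<kappa> \<ge> 1" "\<And>v. norm (scale3 a b c x) * norm v \<le> \<kappa> * norm (scale3 a b c v)"
    and r: "0 < r" "\<kappa> * r < 1"
  defines "J \<equiv> ennreal (a * b * c * norm (scale3 (1/a) (1/b) (1/c) x))"
    and "q \<equiv> ennreal (((1 + \<kappa> * r) / (1 - \<kappa> * r))\<^sup>2)"
  shows "area (scale3 a b c ` cap x r) \<le> q * (J * area (cap x r))"
    and "J * area (cap x r) \<le> q * area (scale3 a b c ` cap x r)"
proof -
  let ?A = "scale3 a b c" and ?P = "\<lambda>y::real^3. y - (y \<bullet> x) *\<^sub>R x"
  let ?D = "?P ` cap x r"
  let ?u = "ennreal ((1 + \<kappa> * r)\<^sup>2)" and ?l = "ennreal ((1 / (1 - \<kappa> * r))\<^sup>2)"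
  have q: "q = ?l * ?u"
    unfolding q_def by (subst ennreal_mult[symmetric]) (simp_all add: power_mult_distrib power_divide)
  have xx: "x \<bullet> x = 1" using x by (simp add: dot_square_norm)
  have "compact ?D"
    by (intro compact_continuous_image compact_cap continuous_intros)
  moreover have "y \<bullet> x = 0" if "y \<in> ?D" for y using that xx by (auto simp: inner_diff_left)
  ultimately have AD: "area (?A ` ?D) = J * area ?D"
    unfolding J_def by (rule area_linear_image_planar[OF pos x])
  have k0: "\<kappa> > 0" using \<kappa>(1) by simp
  have "norm (scale3 1 1 1 x) * norm v \<le> \<kappa> * norm (scale3 1 1 1 v)" for v
    using x \<kappa>(1) mult_right_mono[of 1 \<kappa> "norm v"] by simp
  note id = area_cap_projection[where a=1 and b=1 and c=1, OF x r k0 this, simplified]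
  note A = area_cap_projection[OF x r k0 \<kappa>(2)]
  have "area (?A ` cap x r) \<le> ?l * (J * area ?D)" using A(2) by (simp add: AD)
  also have "\<dots> \<le> ?l * (J * (?u * area (cap x r)))"
    using id(1) by (intro mult_left_mono) (simp_all add: image_image)
  finally show "area (?A ` cap x r) \<le> q * (J * area (cap x r))" by (simp add: q mult_ac)
  have "J * area (cap x r) \<le> J * (?l * area ?D)"
    using id(2) by (intro mult_left_mono) (simp_all add: image_image power_divide)
  also have "\<dots> = ?l * area (?A ` ?D)" by (simp add: AD mult_ac)
  also have "\<dots> \<le> ?l * (?u * area (?A ` cap x r))"
    using A(1) by (intro mult_left_mono) simp_all
  finally show "J * area (cap x r) \<le> q * area (?A ` cap x r)" by (simp add: q mult_ac)
qed

lemma area_cap_finite: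
  assumes "norm x = 1" "0 < r" "r < 1"
  shows "area (cap x r) < \<infinity>"
proof -
  have "norm (scale3 1 1 1 x) * norm v \<le> 1 * norm (scale3 1 1 1 v)" for v using assms by simp
  from area_cap_projection(2)[where a=1 and b=1 and c=1, OF assms(1,2) _ _ this] assms
  have "area (cap x r) \<le> ennreal ((1 / (1 - r))\<^sup>2) * area ((\<lambda>y. y - (y \<bullet> x) *\<^sub>R x) ` cap x r)"
    by simp
  also have "\<dots> < \<infinity>"
  proof -
    have xx: "x \<bullet> x = 1" using assms by (simp add: dot_square_norm)
    have "bounded ((\<lambda>y. y - (y \<bullet> x) *\<^sub>R x) ` cap x r)"
      by (intro compact_imp_bounded compact_continuous_image compact_cap continuous_intros)
    then have "area ((\<lambda>y. y - (y \<bullet> x) *\<^sub>R x) ` cap x r) < \<infinity>"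
      by (rule area_bounded_planar_finite[OF assms(1)]) (use xx in \<open>auto simp: inner_diff_left\<close>)
    then show ?thesis by (simp add: ennreal_mult_less_top)
  qed
  finally show ?thesis .
qed

lemma sphere_finite_cap_cover:
  assumes "r > 0"
  obtains T where "finite T" "T \<subseteq> sphere (0::real^3) 1" "sphere 0 1 \<subseteq> (\<Union>x\<in>T. cap x r)"
proof -
  have cov: "sphere (0::real^3) 1 \<subseteq> (\<Union>x\<in>sphere 0 1. ball x r)"
  proof
    fix x :: "real^3" assume "x \<in> sphere 0 1"
    then show "x \<in> (\<Union>x\<in>sphere 0 1. ball x r)" by (rule UN_I) (use assms in simp)
  qed
  have op: "open (ball x r)" if "x \<in> sphere 0 1" for x :: "real^3" by simp
  have "\<exists>T. finite T \<and> T \<subseteq> sphere (0::real^3) 1 \<and> sphere (0::real^3) 1 \<subseteq> (\<Union>x\<in>T. ball x r)"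
    by (rule compactE_image[OF compact_sphere op cov]) (assumption, blast)
  then obtain T where T: "finite T" "T \<subseteq> sphere (0::real^3) 1" "sphere (0::real^3) 1 \<subseteq> (\<Union>x\<in>T. ball x r)"
    by blast
  have "sphere (0::real^3) 1 \<subseteq> (\<Union>x\<in>T. cap x r)"
  proof
    fix y :: "real^3" assume y: "y \<in> sphere 0 1"
    then obtain x where x: "x \<in> T" "y \<in> ball x r" using T(3) by blast
    then have "y \<in> cap x r" using y by (simp add: cap_def)
    with x(1) show "y \<in> (\<Union>x\<in>T. cap x r)" by (rule UN_I)
  qed
  with T(1,2) show thesis by (rule that)
qed

lemma area_sphere_finite: "area (sphere (0::real^3) 1) < \<infinity>"
proof -
  obtain T where T: "finite T" "T \<subseteq> sphere (0::real^3) 1" "sphere 0 1 \<subseteq> (\<Union>x\<in>T. cap x (1/2))"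
    using sphere_finite_cap_cover[of "1/2"] by auto
  from T(3) have "area (sphere (0::real^3) 1) \<le> area (\<Union>x\<in>T. cap x (1/2))" by (rule area_mono)
  also have "\<dots> \<le> (\<Sum>x\<in>T. area (cap x (1/2)))" by (rule area_UN_finite_le[OF T(1)])
  also have "\<dots> < \<infinity>"
    using T(1,2) area_cap_finite[of _ "1/2"] by (simp add: subset_iff)
  finally show ?thesis .
qed

text \<open>A covering set of diameter \<open>d\<close> lies over a square of side \<open>2 d\<close>, so the part of the slab above it has
  volume at most \<open>8 d\<^sup>2 = (32 / \<pi>) \<cdot> \<pi> (d/2)\<^sup>2\<close>. This crude bound is what makes
  the area of the sphere positive.\<close>

lemma area_planar_lower_bound:
  assumes "\<And>y. y \<in> D \<Longrightarrow> y \<bullet> axis 3 1 = 0"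
  shows "emeasure lborel (slab (axis 3 1) D) \<le> ennreal (32 / pi) * area D"
proof -
  have "ennreal (pi / 32) * emeasure lborel (slab (axis 3 1) D) \<le> area_at 1 D"
    unfolding area_at_def
  proof (rule INF_greatest)
    fix C assume C: "C \<in> small_covers 1 D"
    have bd: "bounded (C i)" for i using C by (auto simp: small_covers_def)
    \<comment> \<open>If \<open>C i\<close> is empty this point is arbitrary, but then its box is not used for covering.\<close>
    define p where "p i = (SOME z. z \<in> C i)" for i
    define e :: "nat \<Rightarrow> real^3" where "e i = vector [diameter (C i), diameter (C i), 1]" for i
    define b :: "nat \<Rightarrow> real^3" where "b i = vector [p i $ 1, p i $ 2, 0]" for i
    have d: "diameter (C i) \<ge> 0" for i by (rule diameter_ge_0[OF bd])
    have "slab (axis 3 1) D \<subseteq> (\<Union>i. cbox (b i - e i) (b i + e i))"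
    proof
      fix y assume y: "y \<in> slab (axis 3 1) D"
      define z where "z = y - (y \<bullet> axis 3 1) *\<^sub>R axis 3 1"
      have z: "z \<in> D" "\<bar>y $ 3\<bar> \<le> 1" "z $ 1 = y $ 1" "z $ 2 = y $ 2"
        using y by (auto simp: slab_def z_def inner_axis) (simp_all add: axis_def)
      then obtain i where i: "z \<in> C i" using C by (auto simp: small_covers_def)
      then have "p i \<in> C i" unfolding p_def by (rule someI)
      then have "dist z (p i) \<le> diameter (C i)" using diameter_bounded_bound[OF bd i] by blast
      then have "\<bar>z $ j - p i $ j\<bar> \<le> diameter (C i)" for j
        using component_le_norm_cart[of "z - p i" j] by (simp add: dist_norm)
      from this[of 1] this[of 2] have "y \<in> cbox (b i - e i) (b i + e i)"
        using z(2-4) by (simp add: mem_box_cart forall_3 b_def e_def abs_le_iff)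
      then show "y \<in> (\<Union>i. cbox (b i - e i) (b i + e i))" by (rule UN_I[OF UNIV_I])
    qed
    then have "emeasure lborel (slab (axis 3 1) D) \<le> emeasure lborel (\<Union>i. cbox (b i - e i) (b i + e i))"
      by (intro emeasure_mono) auto
    also have "\<dots> \<le> (\<Sum>i. emeasure lborel (cbox (b i - e i) (b i + e i)))"
      by (rule emeasure_subadditive_countably) auto
    also have "\<dots> = (\<Sum>i. ennreal (32 / pi) * disc_area (C i))"
    proof (intro arg_cong[of _ _ suminf] ext)
      fix i
      have "emeasure lborel (cbox (b i - e i) (b i + e i)) = ennreal (\<Prod>k\<in>Basis. (2 *\<^sub>R e i) \<bullet> k)"
      proof -
        have "0 \<le> e i $ j" for j using exhaust_3[of j] d[of i] by (auto simp: e_def)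
        then show ?thesis
          by (subst emeasure_lborel_cbox) (auto simp: Basis_vec_def inner_axis scaleR_2 algebra_simps)
      qed
      also have "(\<Prod>k\<in>Basis. (2 *\<^sub>R e i) \<bullet> k) = 32 / pi * (pi * (diameter (C i) / 2)\<^sup>2)"
      proof -
        have B: "(Basis :: (real^3) set) = (\<lambda>j::3. axis j (1::real)) ` UNIV" by (auto simp: Basis_vec_def)
        have "(\<Prod>k\<in>Basis. (2 *\<^sub>R e i) \<bullet> k) = (\<Prod>j\<in>UNIV. 2 * e i $ j)"
          unfolding B by (subst prod.reindex) (auto simp: inj_on_def axis_eq_axis inner_axis)
        also have "\<dots> = 8 * (diameter (C i))\<^sup>2"
          unfolding UNIV_3 by (simp add: e_def power2_eq_square)
        finally show ?thesis by (simp add: power_divide)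
      qed
      finally show "emeasure lborel (cbox (b i - e i) (b i + e i)) = ennreal (32 / pi) * disc_area (C i)"
        by (subst ennreal_mult[symmetric]) auto
    qed
    also have "\<dots> = ennreal (32 / pi) * (\<Sum>i. disc_area (C i))" by (rule ennreal_suminf_cmult)
    finally have "ennreal (pi / 32) * emeasure lborel (slab (axis 3 1) D)
        \<le> ennreal (pi / 32) * (ennreal (32 / pi) * (\<Sum>i. disc_area (C i)))"
      by (rule mult_left_mono) simp
    also have "\<dots> = (\<Sum>i. disc_area (C i))"
      by (simp add: mult.assoc[symmetric] ennreal_mult[symmetric])
    finally show "ennreal (pi / 32) * emeasure lborel (slab (axis 3 1) D) \<le> (\<Sum>i. disc_area (C i))" .
  qed
  also have "\<dots> \<le> area D" by (rule area_at_le_area) simp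
  finally have "ennreal (32 / pi) * (ennreal (pi / 32) * emeasure lborel (slab (axis 3 1) D)) \<le> ennreal (32 / pi) * area D"
    by (rule mult_left_mono) simp
  then show ?thesis by (simp add: mult.assoc[symmetric] ennreal_mult[symmetric])
qed

text \<open>The orthogonal projection of the sphere to the horizontal plane is the unit disc; projection does not increase area, and the slab over the disc contains the unit ball.\<close>

lemma area_sphere_positive: "area (sphere (0::real^3) 1) \<noteq> 0"
proof
  assume zero: "area (sphere (0::real^3) 1) = 0"
  let ?e = "axis 3 1 :: real^3"
  let ?P = "\<lambda>y::real^3. y - (y \<bullet> ?e) *\<^sub>R ?e"
  let ?D = "?P ` sphere 0 1"
  have P: "?P y = vector [y$1, y$2, 0]" for y
    by (simp add: vec_eq_iff forall_3 inner_axis) (simp add: axis_def)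
  have "dist (?P y) (?P z) \<le> 1 * dist y z" for y z :: "real^3"
  proof -
    have "(dist (?P y) (?P z))\<^sup>2 \<le> (dist y z)\<^sup>2" unfolding dist_norm P by (simp add: norm_sq_real_3)
    then have "dist (?P y) (?P z) \<le> dist y z" by (rule power2_le_imp_le) simp
    then show ?thesis by simp
  qed
  then have "area ?D \<le> ennreal (1\<^sup>2) * area (sphere (0::real^3) 1)"
    by (intro area_Lipschitz_image_le) auto
  then have "area ?D = 0" using zero by simp
  moreover have "emeasure lborel (slab ?e ?D) \<le> ennreal (32 / pi) * area ?D"
    by (rule area_planar_lower_bound) (auto simp: P inner_axis)
  moreover have "ball 0 1 \<subseteq> slab ?e ?D"
  proof
    fix y :: "real^3" assume "y \<in> ball 0 1"
    then have "(norm y)\<^sup>2 \<le> 1" by (simp add: power_le_one)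
    then have y: "(y$1)\<^sup>2 + (y$2)\<^sup>2 + (y$3)\<^sup>2 \<le> 1" by (simp add: norm_sq_real_3)
    let ?z = "vector [y$1, y$2, sqrt (1 - (y$1)\<^sup>2 - (y$2)\<^sup>2)] :: real^3"
    have "0 \<le> 1 - (y$1)\<^sup>2 - (y$2)\<^sup>2" using y zero_le_power2[of "y$3"] by linarith
    then have "(norm ?z)\<^sup>2 = 1" by (simp add: norm_sq_real_3)
    then have "?z \<in> sphere 0 1" by (simp add: power2_eq_1_iff) (metis norm_ge_zero not_one_le_zero neg_0_le_iff_le)
    moreover have "?P y = ?P ?z" unfolding P by simp
    ultimately have "?P y \<in> ?D" by (rule rev_image_eqI)
    moreover have "\<bar>y \<bullet> ?e\<bar> \<le> 1"
    proof -
      have "(y$3)\<^sup>2 \<le> 1" using y zero_le_power2[of "y$1"] zero_le_power2[of "y$2"] by linarith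
      then show ?thesis by (simp add: inner_axis abs_square_le_1)
    qed
    ultimately show "y \<in> slab ?e ?D" by (simp add: slab_def)
  qed
  then have "emeasure lborel (ball (0::real^3) 1) \<le> emeasure lborel (slab ?e ?D)"
  proof (rule emeasure_mono)
    have "compact ?D" by (intro compact_continuous_image compact_sphere continuous_intros)
    then have "compact (slab ?e ?D)" by (intro compact_slab) simp_all
    then show "slab ?e ?D \<in> sets lborel" by (simp add: borel_compact)
  qed
  ultimately show False using unit_ball_volume(1) by simp
qed

lemma uniform_sphere_cball_eq:
  assumes "norm x = 1" "norm y = 1"
  shows "emeasure uniform_sphere (cball x r) = emeasure uniform_sphere (cball y r)"
proof -
  have "norm x = norm y" using assms by simp
  then obtain Q where Q: "orthogonal_transformation Q" "Q x = y"
    using orthogonal_mapping_exists by blast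
  have "(\<integral>\<^sup>+u. indicator (cball y r) (Q u) \<partial>uniform_sphere) = (\<integral>\<^sup>+u. indicator (cball y r) u \<partial>uniform_sphere)"
    by (rule nn_integral_uniform_sphere_orthogonal[OF Q(1)]) (rule borel_measurable_indicator, simp)
  moreover have "dist y (Q u) = dist x u" for u
    using Q by (metis orthogonal_transformation_isometry)
  then have "indicator (cball y r) (Q u) = (indicator (cball x r) u :: ennreal)" for u
    by (simp add: indicator_def)
  ultimately show ?thesis by simp
qed

text \<open>Finitely many caps cover the sphere, and they all have the same probability.\<close>

lemma uniform_sphere_cball_positive:
  assumes x: "norm x = 1" and r: "r > 0"
  shows "emeasure uniform_sphere (cball x r) \<noteq> 0"
proof
  assume zero: "emeasure uniform_sphere (cball x r) = 0"
  interpret prob_space uniform_sphere by (rule prob_space_uniform_sphere)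
  obtain T where T: "finite T" "T \<subseteq> sphere (0::real^3) 1" "sphere 0 1 \<subseteq> (\<Union>x\<in>T. cap x r)"
    using sphere_finite_cap_cover[OF r] by auto
  have "1 = emeasure uniform_sphere (sphere 0 1)"
    using AE_uniform_sphere by (intro emeasure_eq_1_AE[symmetric]) auto
  also have "\<dots> \<le> emeasure uniform_sphere (\<Union>x\<in>T. cball x r)"
    using T by (intro emeasure_mono) (auto simp: cap_def)
  also have "\<dots> \<le> (\<Sum>y\<in>T. emeasure uniform_sphere (cball y r))"
    using T(1) by (intro emeasure_subadditive_finite) auto
  also have "\<dots> = 0"
    using T(2) zero uniform_sphere_cball_eq[OF x] by (intro sum.neutral) auto
  finally show False by simp
qed

text \<open>Tonelli's theorem for the relation "\<open>A\<^sup>-\<^sup>1 w\<close> has distance at most \<open>r\<close> from \<open>x\<close>" between points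
  \<open>w\<close> of the image of the sphere and centres \<open>x\<close>: the relation is symmetric in \<open>x\<close> and
  \<open>A\<^sup>-\<^sup>1 w\<close>, and the probability of a cap does not depend on its centre.\<close>

lemma average_cap_area:
  assumes pos: "a > 0" "b > 0" "c > 0" and e: "norm e = 1"
  shows "(\<lambda>x. area (scale3 a b c ` cap x r)) \<in> borel_measurable uniform_sphere"
    and "(\<integral>\<^sup>+x. area (scale3 a b c ` cap x r) \<partial>uniform_sphere)
    = emeasure uniform_sphere (cball e r) * area (scale3 a b c ` sphere 0 1)"
proof -
  let ?A = "scale3 a b c" and ?B = "scale3 (1/a) (1/b) (1/c)"
  let ?S = "?A ` sphere 0 1"
  have AB: "?A (?B x) = x" "?B (?A x) = x" for x using pos by (simp_all add: scale3_inverse)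
  have S: "?S \<in> sets borel" by (intro borel_compact linear_compact_image linear_scale3) simp
  have fin: "area ?S < \<infinity>"
  proof -
    obtain L where L: "L > 0" "\<And>v. norm (?A v) \<le> L * norm v"
      using linear_bounded_pos[OF linear_scale3] by blast
    have "area ?S \<le> ennreal (L\<^sup>2) * area (sphere (0::real^3) 1)"
      using L by (intro area_Lipschitz_image_le) (auto simp: dist_norm simp flip: linear_diff[OF linear_scale3])
    also have "\<dots> < \<infinity>" using area_sphere_finite by (simp add: ennreal_mult_less_top)
    finally show ?thesis .
  qed
  interpret U: prob_space uniform_sphere by (rule prob_space_uniform_sphere)
  interpret S: sigma_finite_measure "area_on ?S" by (rule sigma_finite_area_on[OF S fin])
  interpret pair_sigma_finite uniform_sphere "area_on ?S" ..
  let ?k = "\<lambda>x w. indicator {p. dist (fst p) (?B (snd p)) \<le> r} (x, w) :: ennreal"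
  have [measurable]: "{p. dist (fst p) (?B (snd p)) \<le> r} \<in> sets (borel \<Otimes>\<^sub>M borel)"
    unfolding borel_prod
    by (intro borel_closed closed_Collect_le continuous_intros
        continuous_on_compose2[OF continuous_on_scale3[of UNIV]]) auto
  have inner: "(\<integral>\<^sup>+w. ?k x w \<partial>area_on ?S) = area (?A ` cap x r)" for x
  proof -
    have [measurable]: "{w. dist x (?B w) \<le> r} \<in> sets borel" by measurable
    have "(\<integral>\<^sup>+w. ?k x w \<partial>area_on ?S) = (\<integral>\<^sup>+w. indicator {w. dist x (?B w) \<le> r} w \<partial>area_on ?S)"
      by (intro nn_integral_cong) (simp add: indicator_def)
    also have "\<dots> = area (?S \<inter> {w. dist x (?B w) \<le> r})"
      by (simp add: emeasure_area_on[OF S])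
    also have "?S \<inter> {w. dist x (?B w) \<le> r} = ?A ` cap x r"
      by (auto simp: cap_def AB)
    finally show ?thesis .
  qed
  have outer: "(\<integral>\<^sup>+x. ?k x w \<partial>uniform_sphere) = emeasure uniform_sphere (cball e r)" if "w \<in> ?S" for w
  proof -
    have "norm (?B w) = 1" using that by (auto simp: AB)
    have "(\<integral>\<^sup>+x. ?k x w \<partial>uniform_sphere) = (\<integral>\<^sup>+x. indicator (cball (?B w) r) x \<partial>uniform_sphere)"
      by (intro nn_integral_cong) (simp add: indicator_def dist_commute)
    also have "\<dots> = emeasure uniform_sphere (cball (?B w) r)" by simp
    also have "\<dots> = emeasure uniform_sphere (cball e r)"
      by (rule uniform_sphere_cball_eq[OF \<open>norm (?B w) = 1\<close> e])
    finally show ?thesis .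
  qed
  have "(\<integral>\<^sup>+x. area (?A ` cap x r) \<partial>uniform_sphere) = (\<integral>\<^sup>+x. (\<integral>\<^sup>+w. ?k x w \<partial>area_on ?S) \<partial>uniform_sphere)"
    by (simp only: inner)
  also have "\<dots> = (\<integral>\<^sup>+w. (\<integral>\<^sup>+x. ?k x w \<partial>uniform_sphere) \<partial>area_on ?S)"
    by (rule Fubini'[symmetric]) measurable
  also have "\<dots> = (\<integral>\<^sup>+w. emeasure uniform_sphere (cball e r) \<partial>area_on ?S)"
    by (rule nn_integral_cong_AE, use AE_area_on[OF S] in eventually_elim) (rule outer)
  also have "\<dots> = emeasure uniform_sphere (cball e r) * area ?S"
    by (simp add: emeasure_area_on[OF S])
  finally show "(\<integral>\<^sup>+x. area (?A ` cap x r) \<partial>uniform_sphere) = emeasure uniform_sphere (cball e r) * area ?S" .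
  have "(\<lambda>x. \<integral>\<^sup>+w. ?k x w \<partial>area_on ?S) \<in> borel_measurable uniform_sphere" by measurable
  then show "(\<lambda>x. area (?A ` cap x r)) \<in> borel_measurable uniform_sphere" by (simp only: inner)
qed

lemma area_cap_const:
  assumes "norm x = 1" "norm y = 1"
  shows "area (cap x r) = area (cap y r)"
proof -
  have "norm x = norm y" using assms by simp
  then obtain Q where Q: "orthogonal_transformation Q" "Q x = y"
    using orthogonal_mapping_exists by blast
  have "Q ` cap x r = cap y r"
  proof -
    have mem: "Q u \<in> cap y r \<longleftrightarrow> u \<in> cap x r" for u
      using Q unfolding cap_def
      by (simp add: orthogonal_transformation_norm[OF Q(1)])
         (metis orthogonal_transformation_isometry)
    show ?thesis
    proof (intro set_eqI iffI)
      fix v assume v: "v \<in> cap y r"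
      obtain u where "v = Q u" using orthogonal_transformation_surj[OF Q(1)] by (auto simp: surj_def)
      with v mem show "v \<in> Q ` cap x r" by blast
    qed (use mem in auto)
  qed
  moreover have "area (Q ` cap x r) = area (cap x r)"
    using Q(1) by (intro area_isometric_image) (simp add: orthogonal_transformation_isometry)
  ultimately show ?thesis by simp
qed

lemma ennreal_le_of_all_factors:
  fixes X Y :: ennreal
  assumes "Y < \<infinity>" and le: "\<And>q::real. q > 1 \<Longrightarrow> X \<le> ennreal q * Y"
  shows "X \<le> Y"
proof (rule ennreal_le_epsilon)
  fix e :: real assume e: "e > 0"
  obtain y where y: "Y = ennreal y" "y \<ge> 0" using assms(1) by (cases Y) auto
  have "X \<le> ennreal (1 + e / (y + 1)) * Y" using e y by (intro le) simp
  also have "\<dots> = ennreal (y + e * (y / (y + 1)))"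
    unfolding y(1) using e y(2) by (subst ennreal_mult[symmetric]) (auto simp: field_simps)
  also have "\<dots> \<le> ennreal (y + e)"
    using e y(2) mult_left_mono[of "y / (y + 1)" 1 e] by (intro ennreal_leI) simp
  also have "\<dots> = Y + ennreal e" using e y by simp
  finally show "X \<le> Y + ennreal e" .
qed

text \<open>Average the bounds for images of caps over the centre, for \<open>A\<close> and for the identity. The unknown probability and area of a cap cancel.\<close>

theorem area_scaled_sphere:
  assumes pos: "a > 0" "b > 0" "c > 0"
  shows "area (scale3 a b c ` sphere 0 1) = area (sphere (0::real^3) 1) *
    (ennreal (a * b * c) * (\<integral>\<^sup>+x. ennreal (norm (scale3 (1/a) (1/b) (1/c) x)) \<partial>uniform_sphere))"
proof -
  let ?A = "scale3 a b c"
  define e :: "real^3" where "e = axis 1 1"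
  have e: "norm e = 1" by (simp add: e_def)
  define J where "J x = ennreal (a * b * c * norm (scale3 (1/a) (1/b) (1/c) x))" for x
  have [measurable]: "J \<in> borel_measurable borel" unfolding J_def[abs_def] by measurable
  let ?I = "\<integral>\<^sup>+x. J x \<partial>uniform_sphere"
  have I: "?I = ennreal (a * b * c) * (\<integral>\<^sup>+x. ennreal (norm (scale3 (1/a) (1/b) (1/c) x)) \<partial>uniform_sphere)"
    unfolding J_def using pos by (subst nn_integral_cmult[symmetric]) (simp_all add: ennreal_mult)
  interpret U: prob_space uniform_sphere by (rule prob_space_uniform_sphere)
  obtain \<kappa> where \<kappa>: "\<kappa> \<ge> 1" "\<And>x v. norm x = 1 \<Longrightarrow> norm (?A x) * norm v \<le> \<kappa> * norm (?A v)"
    using cap_distortion[OF pos] by blast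
  have bounds: "area (?A ` sphere 0 1) \<le> ennreal q * (area (sphere (0::real^3) 1) * ?I)"
    "area (sphere (0::real^3) 1) * ?I \<le> ennreal q * area (?A ` sphere 0 1)" if q: "q > 1" for q
  proof -
    have "((\<lambda>r. ((1 + \<kappa> * r) / (1 - \<kappa> * r))\<^sup>2) \<longlongrightarrow> ((1 + \<kappa> * 0) / (1 - \<kappa> * 0))\<^sup>2) (at_right 0)"
      by (intro tendsto_intros) simp
    then have "\<forall>\<^sub>F r in at_right 0. ((1 + \<kappa> * r) / (1 - \<kappa> * r))\<^sup>2 < q"
      using q by (intro order_tendstoD(2)) auto
    moreover have "\<forall>\<^sub>F r in at_right 0. r < 1 / \<kappa>"
      using \<kappa>(1) by (intro order_tendstoD(2)[OF tendsto_ident_at]) simp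
    moreover have "\<forall>\<^sub>F r in at_right 0. 0 < (r::real)" by (rule eventually_at_right_less)
    ultimately have "\<forall>\<^sub>F r in at_right 0. ((1 + \<kappa> * r) / (1 - \<kappa> * r))\<^sup>2 < q \<and> r < 1 / \<kappa> \<and> 0 < r"
      by eventually_elim auto
    then obtain r where r0: "((1 + \<kappa> * r) / (1 - \<kappa> * r))\<^sup>2 < q" "r < 1 / \<kappa>" "0 < r"
      using eventually_happens'[OF trivial_limit_at_right_real] by blast
    have r: "0 < r" "\<kappa> * r < 1" using r0 \<kappa>(1) by (simp_all add: pos_less_divide_eq mult.commute)
    let ?q = "ennreal (((1 + \<kappa> * r) / (1 - \<kappa> * r))\<^sup>2)"
    let ?s = "emeasure uniform_sphere (cball e r)"
    have s: "?s \<noteq> 0" "?s \<noteq> top"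
      using uniform_sphere_cball_positive[OF e r(1)] by simp_all
    have est: "AE x in uniform_sphere. area (?A ` cap x r) \<le> ?q * (J x * area (cap e r))"
      "AE x in uniform_sphere. J x * area (cap e r) \<le> ?q * area (?A ` cap x r)"
      using AE_uniform_sphere
      by (eventually_elim, use area_cap_image[OF pos _ \<kappa>(1) \<kappa>(2) r] area_cap_const[OF _ e] in \<open>simp add: J_def\<close>)+
    \<comment> \<open>The case \<open>A = id\<close>: all caps have the same area, which is therefore their average.\<close>
    have full: "area (cap e r) = ?s * area (sphere (0::real^3) 1)"
    proof -
      have "?s * area (sphere (0::real^3) 1) = (\<integral>\<^sup>+x. area (cap x r) \<partial>uniform_sphere)"
        using average_cap_area(2)[of 1 1 1 e r] e by simp
      also have "\<dots> = (\<integral>\<^sup>+x. area (cap e r) \<partial>uniform_sphere)"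
        by (rule nn_integral_cong_AE, use AE_uniform_sphere in eventually_elim) (rule area_cap_const[OF _ e])
      also have "\<dots> = area (cap e r)" using U.emeasure_space_1 by simp
      finally show ?thesis ..
    qed
    have avg: "(\<integral>\<^sup>+x. area (?A ` cap x r) \<partial>uniform_sphere) = ?s * area (?A ` sphere 0 1)"
      by (rule average_cap_area(2)[OF pos e])
    have J: "(\<integral>\<^sup>+x. J x * area (cap e r) \<partial>uniform_sphere) = ?s * (area (sphere (0::real^3) 1) * ?I)"
      by (subst nn_integral_multc) (simp_all add: full mult_ac)
    have "?s * area (?A ` sphere 0 1) \<le> (\<integral>\<^sup>+x. ?q * (J x * area (cap e r)) \<partial>uniform_sphere)"
      unfolding avg[symmetric] by (rule nn_integral_mono_AE[OF est(1)])
    also have "\<dots> = ?q * (?s * (area (sphere (0::real^3) 1) * ?I))"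
      unfolding J[symmetric] by (rule nn_integral_cmult) measurable
    also have "\<dots> = ?s * (?q * (area (sphere (0::real^3) 1) * ?I))" by (simp only: mult_ac)
    finally have "area (?A ` sphere 0 1) \<le> ?q * (area (sphere (0::real^3) 1) * ?I)"
      using s by (simp add: ennreal_mult_le_mult_iff)
    also have "\<dots> \<le> ennreal q * (area (sphere (0::real^3) 1) * ?I)"
      using r0 by (intro mult_right_mono ennreal_leI) simp_all
    finally show "area (?A ` sphere 0 1) \<le> ennreal q * (area (sphere (0::real^3) 1) * ?I)" .
    have meas: "(\<lambda>x. area (?A ` cap x r)) \<in> borel_measurable uniform_sphere"
      by (rule average_cap_area(1)[OF pos e])
    have "?s * (area (sphere (0::real^3) 1) * ?I) \<le> (\<integral>\<^sup>+x. ?q * area (?A ` cap x r) \<partial>uniform_sphere)"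
      unfolding J[symmetric] by (rule nn_integral_mono_AE[OF est(2)])
    also have "\<dots> = ?q * (?s * area (?A ` sphere 0 1))"
      unfolding avg[symmetric] by (rule nn_integral_cmult[OF meas])
    also have "\<dots> = ?s * (?q * area (?A ` sphere 0 1))" by (simp only: mult_ac)
    finally have "area (sphere (0::real^3) 1) * ?I \<le> ?q * area (?A ` sphere 0 1)"
      using s by (simp add: ennreal_mult_le_mult_iff)
    also have "\<dots> \<le> ennreal q * area (?A ` sphere 0 1)"
      using r0 by (intro mult_right_mono ennreal_leI) simp_all
    finally show "area (sphere (0::real^3) 1) * ?I \<le> ennreal q * area (?A ` sphere 0 1)" .
  qed
  have I_fin: "?I < \<infinity>"
  proof -
    have "isometry id" by (simp add: isometry_def)
    then show ?thesis
      unfolding I using mean_width_ellipsoid(2)[of id "1/a" "1/b" "1/c"] pos by (simp add: ennreal_mult_less_top)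
  qed
  have fin: "area (sphere (0::real^3) 1) * ?I < \<infinity>"
    using area_sphere_finite I_fin by (simp add: ennreal_mult_less_top)
  have "area (?A ` sphere 0 1) \<le> area (sphere (0::real^3) 1) * ?I"
    by (rule ennreal_le_of_all_factors[OF fin bounds(1)])
  moreover have "area (?A ` sphere 0 1) < \<infinity>"
  proof -
    have "area (?A ` sphere 0 1) \<le> ennreal 2 * (area (sphere (0::real^3) 1) * ?I)" by (rule bounds(1)) simp
    also have "\<dots> < \<infinity>" using ennreal_mult_less_top[of "ennreal 2" "area (sphere (0::real^3) 1) * ?I"] fin by simp
    finally show ?thesis .
  qed
  then have "area (sphere (0::real^3) 1) * ?I \<le> area (?A ` sphere 0 1)"
    using bounds(2) by (rule ennreal_le_of_all_factors)
  ultimately show ?thesis unfolding I[symmetric] by (rule antisym)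
qed

section \<open>Gaussian averages of a quadratic norm\<close>

text \<open>The substitution that makes both integral representations of the square root below homogeneous of degree \<open>1/2\<close> in \<open>q\<close>.\<close>

lemma nn_integral_scale_pos:
  fixes k :: "real \<Rightarrow> real"
  assumes c: "c > 0" and [measurable]: "k \<in> borel_measurable borel"
  shows "(\<integral>\<^sup>+t. indicator {0<..} t * ennreal (k t) \<partial>lborel)
       = ennreal c * (\<integral>\<^sup>+t. indicator {0<..} t * ennreal (k (c * t)) \<partial>lborel)"
  using c by (subst nn_integral_real_affine[where c=c and t=0])
    (auto simp: indicator_def zero_less_mult_iff intro!: nn_integral_cong)

text \<open>By homogeneity, the substitution of \<open>t / q\<close> for \<open>t\<close> extracts the factor \<open>sqrt q\<close>.\<close>

lemma sqrt_eq_heat_integral: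
  assumes "q \<ge> 0"
  shows "(\<integral>\<^sup>+t. indicator {0<..} t * ennreal ((1 - exp (- (t * q))) * t powr (-3/2)) \<partial>lborel)
     = ennreal (sqrt q) * (\<integral>\<^sup>+t. indicator {0<..} t * ennreal ((1 - exp (- t)) * t powr (-3/2)) \<partial>lborel)"
proof (cases "q = 0")
  case False
  with assms have q: "q > 0" by simp
  have "(\<integral>\<^sup>+t. indicator {0<..} t * ennreal ((1 - exp (- (t * q))) * t powr (-3/2)) \<partial>lborel)
    = ennreal (1/q) * (\<integral>\<^sup>+t. indicator {0<..} t * ennreal ((1 - exp (- ((1/q*t) * q))) * (1/q*t) powr (-3/2)) \<partial>lborel)"
    using q by (intro nn_integral_scale_pos) auto
  also have "\<dots> = (\<integral>\<^sup>+t. ennreal (1/q) * (indicator {0<..} t * ennreal ((1 - exp (- ((1/q*t) * q))) * (1/q*t) powr (-3/2))) \<partial>lborel)"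
    by (rule nn_integral_cmult[symmetric]) auto
  also have "\<dots> = (\<integral>\<^sup>+t. ennreal (sqrt q) * (indicator {0<..} t * ennreal ((1 - exp (- t)) * t powr (-3/2))) \<partial>lborel)"
  proof (rule nn_integral_cong)
    fix t :: real
    have key: "(1/q) * (1/q) powr (-3/2) = sqrt q"
      using q powr_add[of q 1 "1/2"] powr_half_sqrt[of q]
      by (simp add: powr_divide powr_minus_divide)
    have split: "(1/q*t) powr (-3/2) = (1/q) powr (-3/2) * t powr (-3/2)" 
      by (rule powr_mult)
    have canc: "(1/q*t) * q = t" using q by simp
    have "1/q * ((1 - exp (- ((1/q*t) * q))) * (1/q*t) powr (-3/2))
        = (1/q * (1/q) powr (-3/2)) * ((1 - exp (- t)) * t powr (-3/2))"
      unfolding canc split by (simp only: mult_ac)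
    also have "\<dots> = sqrt q * ((1 - exp (- t)) * t powr (-3/2))" by (simp only: key)
    finally have "1/q * ((1 - exp (- ((1/q*t) * q))) * (1/q*t) powr (-3/2)) = sqrt q * ((1 - exp (- t)) * t powr (-3/2))" .
    then show "ennreal (1/q) * (indicator {0<..} t * ennreal ((1 - exp (- ((1/q*t) * q))) * (1/q*t) powr (-3/2)))
      = ennreal (sqrt q) * (indicator {0<..} t * ennreal ((1 - exp (- t)) * t powr (-3/2)))"
      using q by (auto simp: indicator_def simp flip: ennreal_mult)
  qed
  also have "\<dots> = ennreal (sqrt q) * (\<integral>\<^sup>+t. indicator {0<..} t * ennreal ((1 - exp (- t)) * t powr (-3/2)) \<partial>lborel)"
    by (rule nn_integral_cmult) auto
  finally show ?thesis .
qed simp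

text \<open>The previous representation with \<open>1/t\<close> in place of \<open>t\<close>. Stating it separately saves a substitution in the final integrals.\<close>

lemma sqrt_eq_reciprocal_heat_integral:
  assumes "q \<ge> 0"
  shows "(\<integral>\<^sup>+t. indicator {0<..} t * ennreal ((1 - exp (- (1 / t * q))) * t powr (-1/2)) \<partial>lborel)
     = ennreal (sqrt q) * (\<integral>\<^sup>+t. indicator {0<..} t * ennreal ((1 - exp (- (1 / t))) * t powr (-1/2)) \<partial>lborel)"
proof (cases "q = 0")
  case False
  with assms have q: "q > 0" by simp
  have "(\<integral>\<^sup>+t. indicator {0<..} t * ennreal ((1 - exp (- (1 / t * q))) * t powr (-1/2)) \<partial>lborel)
    = ennreal q * (\<integral>\<^sup>+t. indicator {0<..} t * ennreal ((1 - exp (- (1 / (q*t) * q))) * (q*t) powr (-1/2)) \<partial>lborel)"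
    using q by (intro nn_integral_scale_pos) auto
  also have "\<dots> = (\<integral>\<^sup>+t. ennreal q * (indicator {0<..} t * ennreal ((1 - exp (- (1 / (q*t) * q))) * (q*t) powr (-1/2))) \<partial>lborel)"
    by (rule nn_integral_cmult[symmetric]) auto
  also have "\<dots> = (\<integral>\<^sup>+t. ennreal (sqrt q) * (indicator {0<..} t * ennreal ((1 - exp (- (1 / t))) * t powr (-1/2))) \<partial>lborel)"
  proof (rule nn_integral_cong)
    fix t :: real
    have "q * q powr (-1/2) = sqrt q"
      using q by (simp add: powr_half_sqrt[symmetric] powr_mult_base)
    then have "q * ((1 - exp (- (1 / (q*t) * q))) * (q*t) powr (-1/2)) = sqrt q * ((1 - exp (- (1 / t))) * t powr (-1/2))"
      if "t > 0" using q that by (simp add: powr_mult mult_ac)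
    then show "ennreal q * (indicator {0<..} t * ennreal ((1 - exp (- (1 / (q*t) * q))) * (q*t) powr (-1/2)))
      = ennreal (sqrt q) * (indicator {0<..} t * ennreal ((1 - exp (- (1 / t))) * t powr (-1/2)))"
      using q by (auto simp: indicator_def simp flip: ennreal_mult)
  qed
  also have "\<dots> = ennreal (sqrt q) * (\<integral>\<^sup>+t. indicator {0<..} t * ennreal ((1 - exp (- (1/t))) * t powr (-1/2)) \<partial>lborel)"
    by (rule nn_integral_cmult) auto
  finally show ?thesis .
qed simp

text \<open>A common majorant of both kernels: integrable at 0 through the first power and at infinity through the second.\<close>

lemma finite_nn_integral_powr_majorant:
  "(\<integral>\<^sup>+t. indicator {0<..} t * ennreal (min (t powr (-1/2)) (t powr (-3/2))) \<partial>lborel) < \<infinity>"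
proof -
  have 1: "(\<integral>\<^sup>+t. ennreal (indicator {0..1} t * t powr (-1/2)) \<partial>lborel) < \<infinity>"
  proof -
    have "((\<lambda>t::real. t powr (-1/2)) has_integral (1 powr (-1/2+1) / (-1/2+1))) {0..1}"
      by (rule has_integral_powr_from_0) auto
    from nn_integral_has_integral_lebesgue[OF _ this] show ?thesis by simp
  qed
  have 2: "(\<integral>\<^sup>+t. ennreal (indicator {1..} t * t powr (-3/2)) \<partial>lborel) < \<infinity>"
  proof -
    have "((\<lambda>t::real. t powr (-3/2)) has_integral (-(1 powr (-3/2+1)) / (-3/2+1))) {1..}"
      by (rule has_integral_powr_to_inf) auto
    from nn_integral_has_integral_lebesgue[OF _ this] show ?thesis by simp
  qed
  have "(\<integral>\<^sup>+t. indicator {0<..} t * ennreal (min (t powr (-1/2)) (t powr (-3/2))) \<partial>lborel)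
    \<le> (\<integral>\<^sup>+t. ennreal (indicator {0..1} t * t powr (-1/2)) + ennreal (indicator {1..} t * t powr (-3/2)) \<partial>lborel)"
    by (intro nn_integral_mono) (auto simp: indicator_def not_le intro!: ennreal_leI)
  also have "\<dots> = (\<integral>\<^sup>+t. ennreal (indicator {0..1} t * t powr (-1/2)) \<partial>lborel)
      + (\<integral>\<^sup>+t. ennreal (indicator {1..} t * t powr (-3/2)) \<partial>lborel)"
    by (rule nn_integral_add) auto
  also have "\<dots> < \<infinity>" using 1 2 by simp
  finally show ?thesis .
qed

lemma finite_heat_const:
  "(\<integral>\<^sup>+t. indicator {0<..} t * ennreal ((1 - exp (- t)) * t powr (-3/2)) \<partial>lborel) < \<infinity>"
proof (rule le_less_trans[OF nn_integral_mono finite_nn_integral_powr_majorant])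
  fix t :: real
  have "(1 - exp (- t)) * t powr (-3/2) \<le> min (t powr (-1/2)) (t powr (-3/2))" if "t > 0"
  proof -
    have "(1 - exp (- t)) * t powr (-3/2) \<le> t * t powr (-3/2)"
      using exp_ge_add_one_self[of "-t"] by (intro mult_right_mono) auto
    also have "t * t powr (-3/2) = t powr (-1/2)" using that by (simp add: powr_mult_base)
    finally show ?thesis using that mult_right_mono[of "1 - exp (-t)" 1 "t powr (-3/2)"] by simp
  qed
  then show "indicator {0<..} t * ennreal ((1 - exp (- t)) * t powr (-3/2))
    \<le> indicator {0<..} t * ennreal (min (t powr (-1/2)) (t powr (-3/2)))"
    by (auto simp: indicator_def intro!: ennreal_leI)
qed

lemma finite_reciprocal_heat_const:
  "(\<integral>\<^sup>+t. indicator {0<..} t * ennreal ((1 - exp (- (1/t))) * t powr (-1/2)) \<partial>lborel) < \<infinity>"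
proof (rule le_less_trans[OF nn_integral_mono finite_nn_integral_powr_majorant])
  fix t :: real
  have "(1 - exp (- (1/t))) * t powr (-1/2) \<le> min (t powr (-1/2)) (t powr (-3/2))" if "t > 0"
  proof -
    have "(1 - exp (- (1/t))) * t powr (-1/2) \<le> (1/t) * t powr (-1/2)"
      using exp_ge_add_one_self[of "-(1/t)"] by (intro mult_right_mono) auto
    also have "(1/t) * t powr (-1/2) = t powr (-3/2)"
      using that powr_add[of t "-1" "-1/2"] by (simp add: powr_minus_divide)
    finally show ?thesis using that mult_right_mono[of "1 - exp (-(1/t))" 1 "t powr (-1/2)"] by simp
  qed
  then show "indicator {0<..} t * ennreal ((1 - exp (- (1/t))) * t powr (-1/2))
    \<le> indicator {0<..} t * ennreal (min (t powr (-1/2)) (t powr (-3/2)))"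
    by (auto simp: indicator_def intro!: ennreal_leI)
qed

lemma nn_integral_gaussian:
  assumes "k > 0"
  shows "(\<integral>\<^sup>+(x::real). ennreal (exp (- (k * x\<^sup>2))) \<partial>lborel) = ennreal (sqrt (pi / k))"
proof -
  have "has_bochner_integral lborel (\<lambda>x::real. exp (- x\<^sup>2)) (2 *\<^sub>R (sqrt pi / 2))"
    using has_bochner_integral_even_function[OF gaussian_moment_0] by simp
  then have std: "(\<integral>\<^sup>+(x::real). ennreal (exp (- x\<^sup>2)) \<partial>lborel) = ennreal (sqrt pi)"
    by (subst nn_integral_eq_integral) (auto simp: has_bochner_integral_iff)
  have "(\<integral>\<^sup>+(x::real). ennreal (exp (- (k * x\<^sup>2))) \<partial>lborel)
      = ennreal (1 / sqrt k) * (\<integral>\<^sup>+(x::real). ennreal (exp (- x\<^sup>2)) \<partial>lborel)"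
    using assms by (subst nn_integral_real_affine[where c="1 / sqrt k" and t=0])
      (auto simp: power_divide)
  also have "\<dots> = ennreal (sqrt (pi / k))"
    unfolding std using assms by (subst ennreal_mult[symmetric]) (auto simp: real_sqrt_divide)
  finally show ?thesis .
qed

lemma prod_Basis_3: "(\<Prod>b\<in>(Basis :: (real^3) set). f b) = f (axis 1 1) * f (axis 2 1) * f (axis 3 1)"
proof -
  have B: "(Basis :: (real^3) set) = (\<lambda>i::3. axis i (1::real)) ` UNIV" by (auto simp: Basis_vec_def)
  have "(\<Prod>b\<in>(Basis :: (real^3) set). f b) = (\<Prod>i\<in>UNIV. f (axis i 1))"
    unfolding B by (subst prod.reindex) (auto simp: inj_on_def axis_eq_axis)
  also have "\<dots> = f (axis 1 1) * f (axis 2 1) * f (axis 3 1)"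
    unfolding UNIV_3 by (simp add: mult.assoc)
  finally show ?thesis .
qed

lemma nn_integral_gaussian_3:
  assumes "k1 > 0" "k2 > 0" "k3 > 0"
  shows "(\<integral>\<^sup>+(x::real^3). ennreal (exp (- (k1 * (x$1)\<^sup>2 + k2 * (x$2)\<^sup>2 + k3 * (x$3)\<^sup>2))) \<partial>lborel)
    = ennreal (pi * sqrt pi / sqrt (k1 * k2 * k3))"
proof -
  define k :: "real^3 \<Rightarrow> real" where "k b = (if b = axis 1 1 then k1 else if b = axis 2 1 then k2 else k3)" for b
  have k: "k (axis 1 1) = k1" "k (axis 2 1) = k2" "k (axis 3 1) = k3"
    by (auto simp: k_def axis_eq_axis)
  have kpos: "k b > 0" for b using assms by (simp add: k_def)
  have "(\<integral>\<^sup>+(x::real^3). ennreal (exp (- (k1 * (x$1)\<^sup>2 + k2 * (x$2)\<^sup>2 + k3 * (x$3)\<^sup>2))) \<partial>lborel)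
    = (\<integral>\<^sup>+(x::real^3). (\<Prod>b\<in>Basis. ennreal (exp (- (k b * (x \<bullet> b)\<^sup>2)))) \<partial>lborel)"
    by (simp add: prod_Basis_3 k inner_axis ennreal_mult[symmetric] exp_add[symmetric] algebra_simps)
  also have "\<dots> = (\<Prod>b\<in>(Basis :: (real^3) set). ennreal (sqrt (pi / k b)))"
    by (subst nn_integral_lborel_prod) (auto simp: nn_integral_gaussian kpos)
  also have "\<dots> = ennreal (pi * sqrt pi / sqrt (k1 * k2 * k3))"
    using assms by (simp add: prod_Basis_3 k ennreal_mult[symmetric] real_sqrt_mult real_sqrt_divide)
  finally show ?thesis .
qed

text \<open>The Gaussian average of \<open>|A x|\<close>, without normalisation.\<close>

definition gauss_mean :: "real \<Rightarrow> real \<Rightarrow> real \<Rightarrow> ennreal" where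
  "gauss_mean a b c = (\<integral>\<^sup>+(x::real^3).
     ennreal (sqrt (a\<^sup>2 * (x$1)\<^sup>2 + b\<^sup>2 * (x$2)\<^sup>2 + c\<^sup>2 * (x$3)\<^sup>2)) * ennreal (exp (- (norm x)\<^sup>2)) \<partial>lborel)"

lemma measurable_vec_nth [measurable]: "(\<lambda>x::real^3. x $ i) \<in> borel_measurable borel"
  by (intro borel_measurable_continuous_onI continuous_intros)

lemma gauss_mean_deficit:
  assumes "s \<ge> 0"
  shows "(\<integral>\<^sup>+(x::real^3). ennreal ((1 - exp (- (s * (a\<^sup>2 * (x$1)\<^sup>2 + b\<^sup>2 * (x$2)\<^sup>2 + c\<^sup>2 * (x$3)\<^sup>2)))) * exp (- (norm x)\<^sup>2)) \<partial>lborel)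
    = ennreal (pi * sqrt pi * (1 - 1 / sqrt ((1 + s * a\<^sup>2) * (1 + s * b\<^sup>2) * (1 + s * c\<^sup>2))))"
    (is "?L = _")
proof -
  let ?q = "\<lambda>x::real^3. a\<^sup>2 * (x$1)\<^sup>2 + b\<^sup>2 * (x$2)\<^sup>2 + c\<^sup>2 * (x$3)\<^sup>2"
  let ?R = "sqrt ((1 + s * a\<^sup>2) * (1 + s * b\<^sup>2) * (1 + s * c\<^sup>2))"
  have pos: "1 + s * y\<^sup>2 > 0" for y using assms by (simp add: add_pos_nonneg)
  have fac: "exp (- (s * ?q x)) * exp (- (norm x)\<^sup>2)
      = exp (- ((1 + s * a\<^sup>2) * (x$1)\<^sup>2 + (1 + s * b\<^sup>2) * (x$2)\<^sup>2 + (1 + s * c\<^sup>2) * (x$3)\<^sup>2))" for x :: "real^3"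
    by (simp add: norm_sq_real_3 exp_add[symmetric] algebra_simps)
  have G: "(\<integral>\<^sup>+(x::real^3). ennreal (exp (- (s * ?q x)) * exp (- (norm x)\<^sup>2)) \<partial>lborel) = ennreal (pi * sqrt pi / ?R)"
    unfolding fac by (rule nn_integral_gaussian_3[OF pos pos pos])
  have G0: "(\<integral>\<^sup>+(x::real^3). ennreal (exp (- (norm x)\<^sup>2)) \<partial>lborel) = ennreal (pi * sqrt pi)"
    using nn_integral_gaussian_3[of 1 1 1] by (simp add: norm_sq_real_3)
  have "?L = (\<integral>\<^sup>+(x::real^3). ennreal (exp (- (norm x)\<^sup>2)) - ennreal (exp (- (s * ?q x)) * exp (- (norm x)\<^sup>2)) \<partial>lborel)"
    by (intro nn_integral_cong) (simp add: ennreal_minus algebra_simps)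
  also have "\<dots> = ennreal (pi * sqrt pi) - ennreal (pi * sqrt pi / ?R)"
  proof (subst nn_integral_diff)
    show "AE x::real^3 in lborel. ennreal (exp (- (s * ?q x)) * exp (- (norm x)\<^sup>2)) \<le> ennreal (exp (- (norm x)\<^sup>2))"
      using assms by (intro AE_I2 ennreal_leI mult_left_le_one_le) auto
  qed (simp_all add: G[simplified] G0)
  also have "\<dots> = ennreal (pi * sqrt pi * (1 - 1 / ?R))"
  proof -
    have "0 \<le> ?R" using less_imp_le[OF pos] by (intro real_sqrt_ge_zero mult_nonneg_nonneg)
    then have "0 \<le> pi * sqrt pi / ?R" by (intro divide_nonneg_nonneg mult_nonneg_nonneg) auto
    then show ?thesis by (subst ennreal_minus) (simp_all only: right_diff_distrib mult_1_right times_divide_eq_right)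
  qed
  finally show ?thesis .
qed

text \<open>Insert the integral representation of the square root and exchange the integrals; the inner Gaussian integral is explicit.\<close>

lemma gauss_mean_heat:
  "gauss_mean a b c * (\<integral>\<^sup>+t. indicator {0<..} t * ennreal ((1 - exp (- t)) * t powr (-3/2)) \<partial>lborel)
   = (\<integral>\<^sup>+t. indicator {0<..} t * ennreal (pi * sqrt pi * (t powr (-3/2) *
        (1 - 1 / sqrt ((1 + t * a\<^sup>2) * (1 + t * b\<^sup>2) * (1 + t * c\<^sup>2))))) \<partial>lborel)" (is "_ * ?K = _")
proof -
  let ?q = "\<lambda>x::real^3. a\<^sup>2 * (x$1)\<^sup>2 + b\<^sup>2 * (x$2)\<^sup>2 + c\<^sup>2 * (x$3)\<^sup>2"
  have q: "?q x \<ge> 0" for x by simp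
  have "gauss_mean a b c * ?K = (\<integral>\<^sup>+x. ennreal (sqrt (?q x)) * ennreal (exp (- (norm x)\<^sup>2)) * ?K \<partial>lborel)"
    unfolding gauss_mean_def by (rule nn_integral_multc[symmetric]) simp
  also have "\<dots> = (\<integral>\<^sup>+x. (\<integral>\<^sup>+t. indicator {0<..} t * ennreal ((1 - exp (- (t * ?q x))) * t powr (-3/2)) * ennreal (exp (- (norm x)\<^sup>2)) \<partial>lborel) \<partial>lborel)"
  proof (rule nn_integral_cong)
    fix x :: "real^3"
    have "ennreal (sqrt (?q x)) * ?K = (\<integral>\<^sup>+t. indicator {0<..} t * ennreal ((1 - exp (- (t * ?q x))) * t powr (-3/2)) \<partial>lborel)"
      by (rule sqrt_eq_heat_integral[OF q, symmetric])
    then have "ennreal (sqrt (?q x)) * ennreal (exp (- (norm x)\<^sup>2)) * ?K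
      = (\<integral>\<^sup>+t. indicator {0<..} t * ennreal ((1 - exp (- (t * ?q x))) * t powr (-3/2)) \<partial>lborel) * ennreal (exp (- (norm x)\<^sup>2))"
      by (simp only: mult_ac)
    also have "\<dots> = (\<integral>\<^sup>+t. indicator {0<..} t * ennreal ((1 - exp (- (t * ?q x))) * t powr (-3/2)) * ennreal (exp (- (norm x)\<^sup>2)) \<partial>lborel)"
      by (rule nn_integral_multc[symmetric]) measurable
    finally show "ennreal (sqrt (?q x)) * ennreal (exp (- (norm x)\<^sup>2)) * ?K = \<dots>" .
  qed
  also have "\<dots> = (\<integral>\<^sup>+t. (\<integral>\<^sup>+x. indicator {0<..} t * ennreal ((1 - exp (- (t * ?q x))) * t powr (-3/2)) * ennreal (exp (- (norm x)\<^sup>2)) \<partial>lborel) \<partial>lborel)"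
    by (rule lborel_pair.Fubini') measurable
  also have "\<dots> = (\<integral>\<^sup>+t. indicator {0<..} t * ennreal (pi * sqrt pi * (t powr (-3/2) *
        (1 - 1 / sqrt ((1 + t * a\<^sup>2) * (1 + t * b\<^sup>2) * (1 + t * c\<^sup>2))))) \<partial>lborel)"
  proof (rule nn_integral_cong)
    fix t :: real
    show "(\<integral>\<^sup>+x. indicator {0<..} t * ennreal ((1 - exp (- (t * ?q x))) * t powr (-3/2)) * ennreal (exp (- (norm x)\<^sup>2)) \<partial>lborel)
       = indicator {0<..} t * ennreal (pi * sqrt pi * (t powr (-3/2) *
        (1 - 1 / sqrt ((1 + t * a\<^sup>2) * (1 + t * b\<^sup>2) * (1 + t * c\<^sup>2)))))"
    proof (cases "t > 0")
      case True
      then have "(\<integral>\<^sup>+x. indicator {0<..} t * ennreal ((1 - exp (- (t * ?q x))) * t powr (-3/2)) * ennreal (exp (- (norm x)\<^sup>2)) \<partial>lborel)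
        = (\<integral>\<^sup>+x. ennreal (t powr (-3/2)) * ennreal ((1 - exp (- (t * ?q x))) * exp (- (norm x)\<^sup>2)) \<partial>lborel)"
        using q by (intro nn_integral_cong) (simp add: ennreal_mult[symmetric] mult_ac mult_nonneg_nonneg)
      also have "\<dots> = ennreal (t powr (-3/2)) * ennreal (pi * sqrt pi * (1 - 1 / sqrt ((1 + t * a\<^sup>2) * (1 + t * b\<^sup>2) * (1 + t * c\<^sup>2))))"
        using True by (subst nn_integral_cmult) (auto simp: gauss_mean_deficit)
      finally show ?thesis using True by (simp add: ennreal_mult'[symmetric] mult_ac)
    qed simp
  qed
  finally show ?thesis .
qed

lemma gauss_mean_reciprocal_heat:
  "gauss_mean a b c * (\<integral>\<^sup>+t. indicator {0<..} t * ennreal ((1 - exp (- (1/t))) * t powr (-1/2)) \<partial>lborel)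
   = (\<integral>\<^sup>+t. indicator {0<..} t * ennreal (pi * sqrt pi * (t powr (-1/2) *
        (1 - 1 / sqrt ((1 + 1/t * a\<^sup>2) * (1 + 1/t * b\<^sup>2) * (1 + 1/t * c\<^sup>2))))) \<partial>lborel)" (is "_ * ?K = _")
proof -
  let ?q = "\<lambda>x::real^3. a\<^sup>2 * (x$1)\<^sup>2 + b\<^sup>2 * (x$2)\<^sup>2 + c\<^sup>2 * (x$3)\<^sup>2"
  have q: "?q x \<ge> 0" for x by simp
  have "gauss_mean a b c * ?K = (\<integral>\<^sup>+x. ennreal (sqrt (?q x)) * ennreal (exp (- (norm x)\<^sup>2)) * ?K \<partial>lborel)"
    unfolding gauss_mean_def by (rule nn_integral_multc[symmetric]) simp
  also have "\<dots> = (\<integral>\<^sup>+x. (\<integral>\<^sup>+t. indicator {0<..} t * ennreal ((1 - exp (- (1/t * ?q x))) * t powr (-1/2)) * ennreal (exp (- (norm x)\<^sup>2)) \<partial>lborel) \<partial>lborel)"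
  proof (rule nn_integral_cong)
    fix x :: "real^3"
    have "ennreal (sqrt (?q x)) * ?K = (\<integral>\<^sup>+t. indicator {0<..} t * ennreal ((1 - exp (- (1/t * ?q x))) * t powr (-1/2)) \<partial>lborel)"
      by (rule sqrt_eq_reciprocal_heat_integral[OF q, symmetric])
    then have "ennreal (sqrt (?q x)) * ennreal (exp (- (norm x)\<^sup>2)) * ?K
      = (\<integral>\<^sup>+t. indicator {0<..} t * ennreal ((1 - exp (- (1/t * ?q x))) * t powr (-1/2)) \<partial>lborel) * ennreal (exp (- (norm x)\<^sup>2))"
      by (simp only: mult_ac)
    also have "\<dots> = (\<integral>\<^sup>+t. indicator {0<..} t * ennreal ((1 - exp (- (1/t * ?q x))) * t powr (-1/2)) * ennreal (exp (- (norm x)\<^sup>2)) \<partial>lborel)"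
      by (rule nn_integral_multc[symmetric]) measurable
    finally show "ennreal (sqrt (?q x)) * ennreal (exp (- (norm x)\<^sup>2)) * ?K = \<dots>" .
  qed
  also have "\<dots> = (\<integral>\<^sup>+t. (\<integral>\<^sup>+x. indicator {0<..} t * ennreal ((1 - exp (- (1/t * ?q x))) * t powr (-1/2)) * ennreal (exp (- (norm x)\<^sup>2)) \<partial>lborel) \<partial>lborel)"
    by (rule lborel_pair.Fubini') measurable
  also have "\<dots> = (\<integral>\<^sup>+t. indicator {0<..} t * ennreal (pi * sqrt pi * (t powr (-1/2) *
        (1 - 1 / sqrt ((1 + 1/t * a\<^sup>2) * (1 + 1/t * b\<^sup>2) * (1 + 1/t * c\<^sup>2))))) \<partial>lborel)"
  proof (rule nn_integral_cong)
    fix t :: real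
    show "(\<integral>\<^sup>+x. indicator {0<..} t * ennreal ((1 - exp (- (1/t * ?q x))) * t powr (-1/2)) * ennreal (exp (- (norm x)\<^sup>2)) \<partial>lborel)
       = indicator {0<..} t * ennreal (pi * sqrt pi * (t powr (-1/2) *
        (1 - 1 / sqrt ((1 + 1/t * a\<^sup>2) * (1 + 1/t * b\<^sup>2) * (1 + 1/t * c\<^sup>2)))))"
    proof (cases "t > 0")
      case True
      then have "(\<integral>\<^sup>+x. indicator {0<..} t * ennreal ((1 - exp (- (1/t * ?q x))) * t powr (-1/2)) * ennreal (exp (- (norm x)\<^sup>2)) \<partial>lborel)
        = (\<integral>\<^sup>+x. ennreal (t powr (-1/2)) * ennreal ((1 - exp (- (1/t * ?q x))) * exp (- (norm x)\<^sup>2)) \<partial>lborel)"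
        using q by (intro nn_integral_cong) (simp add: ennreal_mult[symmetric] mult_ac mult_nonneg_nonneg)
      also have "\<dots> = ennreal (t powr (-1/2)) * ennreal (pi * sqrt pi * (1 - 1 / sqrt ((1 + 1/t * a\<^sup>2) * (1 + 1/t * b\<^sup>2) * (1 + 1/t * c\<^sup>2))))"
        using True by (subst nn_integral_cmult) (auto simp: gauss_mean_deficit[where s="1/t", simplified])
      finally show ?thesis using True by (simp add: ennreal_mult'[symmetric] mult_ac)
    qed simp
  qed
  finally show ?thesis .
qed

text \<open>From \<open>|A x| \<le> M |x|\<close> and \<open>|x| \<le> exp (|x|\<^sup>2 / 2)\<close>, the integrand is at most a multiple of a wider Gaussian.\<close>

lemma gauss_mean_finite: "gauss_mean a b c < \<infinity>"
proof -
  let ?M = "sqrt (a\<^sup>2 + b\<^sup>2 + c\<^sup>2)"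
  have "gauss_mean a b c \<le> (\<integral>\<^sup>+(x::real^3). ennreal ?M * ennreal (exp (- (1/2 * (x$1)\<^sup>2 + 1/2 * (x$2)\<^sup>2 + 1/2 * (x$3)\<^sup>2))) \<partial>lborel)"
    unfolding gauss_mean_def
  proof (rule nn_integral_mono)
    fix x :: "real^3"
    let ?q = "a\<^sup>2 * (x$1)\<^sup>2 + b\<^sup>2 * (x$2)\<^sup>2 + c\<^sup>2 * (x$3)\<^sup>2"
    have "?q \<le> (a\<^sup>2 + b\<^sup>2 + c\<^sup>2) * (norm x)\<^sup>2"
      unfolding norm_sq_real_3 by (simp add: algebra_simps)
    then have 1: "sqrt ?q \<le> ?M * norm x"
      using real_sqrt_le_mono[of ?q "(a\<^sup>2 + b\<^sup>2 + c\<^sup>2) * (norm x)\<^sup>2"] by (simp add: real_sqrt_mult)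
    have "norm x \<le> exp ((norm x)\<^sup>2 / 2)"
    proof -
      have "0 \<le> (norm x - 1)\<^sup>2" by simp
      then have "norm x \<le> 1 + (norm x)\<^sup>2 / 2" unfolding power2_diff by simp
      then show ?thesis using exp_ge_add_one_self[of "(norm x)\<^sup>2 / 2"] by linarith
    qed
    then have "?M * norm x \<le> ?M * exp ((norm x)\<^sup>2 / 2)" by (intro mult_left_mono) auto
    with 1 have "sqrt ?q * exp (- (norm x)\<^sup>2) \<le> (?M * exp ((norm x)\<^sup>2 / 2)) * exp (- (norm x)\<^sup>2)"
      by (intro mult_right_mono) (linarith, simp)
    also have "\<dots> = ?M * exp (- (1/2 * (x$1)\<^sup>2 + 1/2 * (x$2)\<^sup>2 + 1/2 * (x$3)\<^sup>2))"
    proof -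
      have "exp ((norm x)\<^sup>2 / 2) * exp (- (norm x)\<^sup>2) = exp (- (1/2 * (x$1)\<^sup>2 + 1/2 * (x$2)\<^sup>2 + 1/2 * (x$3)\<^sup>2))"
        unfolding exp_add[symmetric] norm_sq_real_3 by (rule arg_cong[of _ _ exp]) (simp add: field_simps)
      then show ?thesis by (simp add: mult.assoc)
    qed
    finally show "ennreal (sqrt ?q) * ennreal (exp (- (norm x)\<^sup>2))
      \<le> ennreal ?M * ennreal (exp (- (1/2 * (x$1)\<^sup>2 + 1/2 * (x$2)\<^sup>2 + 1/2 * (x$3)\<^sup>2)))"
      by (simp add: ennreal_mult[symmetric] ennreal_leI)
  qed
  also have "\<dots> = ennreal ?M * ennreal (pi * sqrt pi / sqrt (1/2 * (1/2) * (1/2)))"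
    by (subst nn_integral_cmult) (measurable, subst nn_integral_gaussian_3, auto)
  also have "\<dots> < \<infinity>" by (simp add: ennreal_mult_less_top)
  finally show ?thesis .
qed

text \<open>By homogeneity \<open>|A x|\<close> is \<open>|x|\<close> times a function of the direction of \<open>x\<close>.\<close>

lemma gauss_mean_eq_sphere_mean:
  assumes pos: "a > 0" "b > 0" "c > 0"
  shows "gauss_mean a b c = (\<integral>\<^sup>+u. ennreal (norm (scale3 a b c u)) \<partial>uniform_sphere)
     * (\<integral>\<^sup>+(x::real^3). ennreal (norm x * exp (- (norm x)\<^sup>2)) \<partial>lborel)"
proof -
  have "isometry id" by (simp add: isometry_def)
  then have fin: "(\<integral>\<^sup>+u. ennreal (norm (scale3 a b c u)) \<partial>uniform_sphere) < \<infinity>"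
    by (rule mean_width_ellipsoid(2)[OF _ pos])
  have "gauss_mean a b c = (\<integral>\<^sup>+x. ennreal (norm (scale3 a b c (sgn x))) * ennreal (norm x * exp (- (norm x)\<^sup>2)) \<partial>lborel)"
    unfolding gauss_mean_def norm_scale3[symmetric]
  proof (rule nn_integral_cong)
    fix x :: "real^3"
    have "x = norm x *\<^sub>R sgn x" by (cases "x = 0") (simp_all add: sgn_div_norm)
    then have "scale3 a b c x = norm x *\<^sub>R scale3 a b c (sgn x)"
      by (metis linear_cmul[OF linear_scale3])
    then have "norm (scale3 a b c x) = norm x * norm (scale3 a b c (sgn x))" by simp
    then show "ennreal (norm (scale3 a b c x)) * ennreal (exp (- (norm x)\<^sup>2))
        = ennreal (norm (scale3 a b c (sgn x))) * ennreal (norm x * exp (- (norm x)\<^sup>2))"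
      by (simp add: ennreal_mult[symmetric] mult_ac)
  qed
  also have "\<dots> = (\<integral>\<^sup>+u. ennreal (norm (scale3 a b c u)) \<partial>uniform_sphere)
     * (\<integral>\<^sup>+(x::real^3). ennreal (norm x * exp (- (norm x)\<^sup>2)) \<partial>lborel)"
    by (rule radial_integral[where \<phi>="\<lambda>r. ennreal (r * exp (- r\<^sup>2))", OF _ _ fin]) measurable
  finally show ?thesis .
qed

section \<open>Two vanishing moments determine the semiaxes\<close>

text \<open>The heart of the uniqueness proof. The function \<open>u\<close> has at most one sign change, at \<open>s\<close> say, and the
  quotient \<open>t\<^bsup>5/2\<^esup>\<close> of the two weights is strictly increasing. So some combination of the weights has
  the same sign, except at \<open>s\<close>, as \<open>u\<close>, and its product with \<open>u\<close> cannot have integral zero.\<close>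

lemma moments_vanish_imp_eq:
  fixes d1 d2 :: real and u :: "real \<Rightarrow> real"
  assumes int1: "integrable lborel (\<lambda>t. indicator {0<..} t * (t powr (-3/2) * u t))"
    and int2: "integrable lborel (\<lambda>t. indicator {0<..} t * (t * u t))"
    and zero1: "(LINT t|lborel. indicator {0<..} t * (t powr (-3/2) * u t)) = 0"
    and zero2: "(LINT t|lborel. indicator {0<..} t * (t * u t)) = 0"
    and sgn: "\<And>t. t > 0 \<Longrightarrow> sgn (u t) = sgn (d1 + d2 * t)"
  shows "d1 = 0 \<and> d2 = 0"
proof (rule ccontr)
  assume nz: "\<not> (d1 = 0 \<and> d2 = 0)"
  \<comment> \<open>The point where \<open>d1 + d2 t\<close> changes sign, or 0 if its sign is constant on the positive axis.\<close>
  define s where "s = (if d1 * d2 < 0 then - d1 / d2 else 0)"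
  obtain al be where pos: "\<And>t. t > 0 \<Longrightarrow> t \<noteq> s \<Longrightarrow> (al + be * t powr (5/2)) * (d1 + d2 * t) > 0"
  proof (cases "d1 * d2 < 0")
    case True
    then have s: "s > 0" "d1 = - d2 * s" "d2 \<noteq> 0"
      by (auto simp: s_def mult_less_0_iff divide_neg_pos divide_pos_neg)
    \<comment> \<open>The combination \<open>d2 (t\<^bsup>5/2\<^esup> - s\<^bsup>5/2\<^esup>)\<close> changes sign at \<open>s\<close> together with \<open>d2 (t - s)\<close>.\<close>
    have "(- (d2 * s powr (5/2)) + d2 * t powr (5/2)) * (d1 + d2 * t) > 0" if "t > 0" "t \<noteq> s" for t
    proof -
      have "(t powr (5/2) - s powr (5/2)) * (t - s) > 0"
      proof (cases "s < t")
        case True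
        then show ?thesis using s(1) by (simp add: powr_less_mono2)
      next
        case False
        then show ?thesis using that s(1) by (intro mult_neg_neg) (simp_all add: powr_less_mono2)
      qed
      then have "0 < d2\<^sup>2 * ((t powr (5/2) - s powr (5/2)) * (t - s))"
        using s(3) by simp
      then show ?thesis
        unfolding s(2) by (simp add: algebra_simps power2_eq_square)
    qed
    then show ?thesis by (rule that)
  next
    case False
    define al where "al = (if d1 > 0 \<or> d2 > 0 then 1 else -1 :: real)"
    have "(al + 0 * t powr (5/2)) * (d1 + d2 * t) > 0" if "t > 0" for t
    proof (cases "d1 > 0 \<or> d2 > 0")
      case True
      then have "d1 \<ge> 0" "d2 \<ge> 0" using False by (auto simp: mult_less_0_iff)
      then show ?thesis using True that by (auto simp: al_def intro: add_pos_nonneg add_nonneg_pos)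
    next
      case F: False
      then have "d1 \<le> 0" "d2 \<le> 0" by auto
      then have "d1 + d2 * t < 0" using nz that
        by (metis add_neg_nonpos add_nonpos_neg less_eq_real_def mult_neg_pos mult_nonpos_nonneg)
      then show ?thesis using F by (simp add: al_def)
    qed
    then show ?thesis using that by blast
  qed
  let ?f = "\<lambda>t. al * (indicator {0<..} t * (t powr (-3/2) * u t)) + be * (indicator {0<..} t * (t * u t))"
  have f_pos: "?f t > 0" if "t > 0" "t \<noteq> s" for t
  proof -
    have "t = t powr (5/2) * t powr (-3/2)" using that by (simp flip: powr_add)
    then have eq: "?f t = (al + be * t powr (5/2)) * u t * t powr (-3/2)"
      using that by (simp add: algebra_simps)
    have "sgn ((al + be * t powr (5/2)) * u t) = sgn ((al + be * t powr (5/2)) * (d1 + d2 * t))"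
      using sgn[OF that(1)] by (simp add: sgn_mult)
    then have "(al + be * t powr (5/2)) * u t > 0"
      using pos[OF that] by (metis sgn_1_pos sgn_pos)
    then show ?thesis unfolding eq using that by simp
  qed
  have AE_nn: "AE t in lborel. ?f t \<ge> 0"
    using AE_lborel_singleton[of s]
  proof eventually_elim
    case (elim t)
    then show ?case using f_pos[of t] by (cases "t > 0") auto
  qed
  have "integrable lborel ?f" using int1 int2 by auto
  moreover have "integral\<^sup>L lborel ?f = 0"
    using int1 int2 zero1 zero2 by (simp add: Bochner_Integration.integral_add)
  ultimately have "AE t in lborel. ?f t = 0"
    using AE_nn integral_nonneg_eq_0_iff_AE by blast
  then have "AE t in lborel. t \<notin> {max 0 s<..<max 0 s + 1}"
  proof eventually_elim
    case (elim t)
    then show ?case using f_pos[of t] by (auto simp: max_def split: if_splits)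
  qed
  then have "emeasure lborel {max 0 s<..<max 0 s + 1} = 0"
    by (subst (asm) AE_iff_null_sets[symmetric]) (auto simp: null_sets_def)
  then show False by simp
qed

lemma integral_diff_eq_0_of_nn_integral_eq:
  fixes f g :: "real \<Rightarrow> real"
  assumes [measurable]: "f \<in> borel_measurable borel" "g \<in> borel_measurable borel"
    and nn: "\<And>t. t > 0 \<Longrightarrow> 0 \<le> f t" "\<And>t. t > 0 \<Longrightarrow> 0 \<le> g t"
    and eq: "(\<integral>\<^sup>+t. indicator {0<..} t * ennreal (f t) \<partial>lborel) = (\<integral>\<^sup>+t. indicator {0<..} t * ennreal (g t) \<partial>lborel)"
    and fin: "(\<integral>\<^sup>+t. indicator {0<..} t * ennreal (f t) \<partial>lborel) < \<infinity>"
  shows "integrable lborel (\<lambda>t. indicator {0<..} t * (f t - g t))"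
    and "(LINT t|lborel. indicator {0<..} t * (f t - g t)) = 0"
proof -
  have conv: "indicator {0<..} t * ennreal (h t) = ennreal (indicator {0<..} t * h t)" for h and t :: real
    by (simp add: indicator_def)
  have nn': "AE t in lborel. 0 \<le> indicator {0<..} t * f t" "AE t in lborel. 0 \<le> indicator {0<..} t * g t"
    using nn by (auto simp: indicator_def)
  have F: "integrable lborel (\<lambda>t. indicator {0<..} t * f t)"
    by (rule integrableI_nonneg) (use nn' fin in \<open>auto simp: conv\<close>)
  have G: "integrable lborel (\<lambda>t. indicator {0<..} t * g t)"
    by (rule integrableI_nonneg) (use nn' fin eq in \<open>auto simp: conv\<close>)
  have "ennreal (LINT t|lborel. indicator {0<..} t * f t) = ennreal (LINT t|lborel. indicator {0<..} t * g t)"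
    using nn_integral_eq_integral[OF F nn'(1)] nn_integral_eq_integral[OF G nn'(2)] eq by (simp add: conv)
  then have "(LINT t|lborel. indicator {0<..} t * f t) = (LINT t|lborel. indicator {0<..} t * g t)"
    using integral_nonneg_AE[OF nn'(1)] integral_nonneg_AE[OF nn'(2)] by simp
  then show "integrable lborel (\<lambda>t. indicator {0<..} t * (f t - g t))"
    and "(LINT t|lborel. indicator {0<..} t * (f t - g t)) = 0"
    using F G by (simp_all add: right_diff_distrib)
qed

text \<open>Equality of the two Gaussian means says that two moments of
  \<open>u = P\<^bsup>-1/2\<^esup> - P'\<^bsup>-1/2\<^esup>\<close> vanish. The means are nonnegative integrals; they are finite, so that equal values
  can be subtracted.\<close>

theorem gauss_means_determine_symmetric_functions:
  fixes a b c a' b' c' :: real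
  assumes pos: "a > 0" "b > 0" "c > 0" "a' > 0" "b' > 0" "c' > 0"
    and prod: "a * b * c = a' * b' * c'"
    and eq: "gauss_mean a b c = gauss_mean a' b' c'"
    and eq_inv: "gauss_mean (1/a) (1/b) (1/c) = gauss_mean (1/a') (1/b') (1/c')"
  shows "a\<^sup>2 + b\<^sup>2 + c\<^sup>2 = a'\<^sup>2 + b'\<^sup>2 + c'\<^sup>2"
    and "a\<^sup>2 * b\<^sup>2 + a\<^sup>2 * c\<^sup>2 + b\<^sup>2 * c\<^sup>2 = a'\<^sup>2 * b'\<^sup>2 + a'\<^sup>2 * c'\<^sup>2 + b'\<^sup>2 * c'\<^sup>2"
proof -
  define P where "P t = (1 + t * a\<^sup>2) * (1 + t * b\<^sup>2) * (1 + t * c\<^sup>2)" for t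
  define P' where "P' t = (1 + t * a'\<^sup>2) * (1 + t * b'\<^sup>2) * (1 + t * c'\<^sup>2)" for t
  define u where "u t = pi * sqrt pi * (1 / sqrt (P t) - 1 / sqrt (P' t))" for t
  define d1 where "d1 = (a'\<^sup>2 + b'\<^sup>2 + c'\<^sup>2) - (a\<^sup>2 + b\<^sup>2 + c\<^sup>2)"
  define d2 where "d2 = (a'\<^sup>2 * b'\<^sup>2 + a'\<^sup>2 * c'\<^sup>2 + b'\<^sup>2 * c'\<^sup>2) - (a\<^sup>2 * b\<^sup>2 + a\<^sup>2 * c\<^sup>2 + b\<^sup>2 * c\<^sup>2)"
  have [measurable]: "P \<in> borel_measurable borel" "P' \<in> borel_measurable borel"
    unfolding P_def P'_def by measurable
  have ge1: "(1 + s * x\<^sup>2) * (1 + s * y\<^sup>2) * (1 + s * z\<^sup>2) \<ge> 1" if "s > 0" for s x y z :: real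
  proof -
    have 1: "1 \<le> 1 + s * w\<^sup>2" for w using that by simp
    show ?thesis using mult_mono[OF mult_mono[OF 1 1] 1, of x y z] 1[of x] 1[of y] that by simp
  qed
  have P1: "P t \<ge> 1" "P' t \<ge> 1" if "t > 0" for t
    unfolding P_def P'_def by (rule ge1[OF that])+
  have nonneg: "0 \<le> pi * sqrt pi * (y * (1 - 1 / sqrt x))" if "x \<ge> 1" "y \<ge> 0" for x y :: real
    using that by (intro mult_nonneg_nonneg) auto
  \<comment> \<open>The integrands for the semiaxes and for their reciprocals, as functions of the polynomial \<open>Q\<close>.\<close>
  define f where "f Q t = pi * sqrt pi * (t powr (-3/2) * (1 - 1 / sqrt (Q t)))" for Q :: "real \<Rightarrow> real" and t
  define g where "g Q t = pi * sqrt pi * (t powr (-1/2) * (1 - a * b * c * t powr (3/2) / sqrt (Q t)))" for Q :: "real \<Rightarrow> real" and t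
  have [measurable]: "f Q \<in> borel_measurable borel" "g Q \<in> borel_measurable borel"
    if [measurable]: "Q \<in> borel_measurable borel" for Q
    unfolding f_def g_def by measurable
  have f_int: "(\<integral>\<^sup>+t. indicator {0<..} t * ennreal (f P t) \<partial>lborel)
      = gauss_mean a b c * (\<integral>\<^sup>+t. indicator {0<..} t * ennreal ((1 - exp (- t)) * t powr (-3/2)) \<partial>lborel)"
    "(\<integral>\<^sup>+t. indicator {0<..} t * ennreal (f P' t) \<partial>lborel)
      = gauss_mean a' b' c' * (\<integral>\<^sup>+t. indicator {0<..} t * ennreal ((1 - exp (- t)) * t powr (-3/2)) \<partial>lborel)"
    unfolding gauss_mean_heat f_def P_def P'_def by (rule refl)+
  \<comment> \<open>The factor \<open>1 + (1/t) (1/x)\<^sup>2\<close> is \<open>(1 + t x\<^sup>2) / (t x\<^sup>2)\<close>: passing to reciprocal semiaxes and to \<open>1/t\<close> reproduces the same polynomial.\<close>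
  have recip: "1 - 1 / sqrt ((1 + 1/t * (1/x)\<^sup>2) * (1 + 1/t * (1/y)\<^sup>2) * (1 + 1/t * (1/z)\<^sup>2))
      = 1 - x * y * z * t powr (3/2) / sqrt ((1 + t * x\<^sup>2) * (1 + t * y\<^sup>2) * (1 + t * z\<^sup>2))"
    if "t > 0" "x > 0" "y > 0" "z > 0" for t x y z :: real
  proof -
    have 1: "1 + 1/t * (1/w)\<^sup>2 = (1 + t * w\<^sup>2) / (t * w\<^sup>2)" if "w > 0" for w
      using that \<open>t > 0\<close> by (simp add: field_simps)
    have "t powr (3/2) = t * sqrt t"
      using powr_add[of t 1 "1/2"] \<open>t > 0\<close> by (simp add: powr_half_sqrt)
    then have 2: "sqrt (t * x\<^sup>2 * (t * y\<^sup>2) * (t * z\<^sup>2)) = x * y * z * t powr (3/2)"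
      using that by (simp add: real_sqrt_mult)
    have "sqrt ((1 + 1/t * (1/x)\<^sup>2) * (1 + 1/t * (1/y)\<^sup>2) * (1 + 1/t * (1/z)\<^sup>2))
      = sqrt ((1 + t * x\<^sup>2) * (1 + t * y\<^sup>2) * (1 + t * z\<^sup>2)) / sqrt (t * x\<^sup>2 * (t * y\<^sup>2) * (t * z\<^sup>2))"
      unfolding 1[OF that(2)] 1[OF that(3)] 1[OF that(4)] real_sqrt_divide[symmetric] by simp
    then show ?thesis unfolding 2 by simp
  qed
  have g_eq: "indicator {0<..} t * ennreal (pi * sqrt pi * (t powr (-1/2) * (1 - 1 / sqrt ((1 + 1/t * (1/x)\<^sup>2) * (1 + 1/t * (1/y)\<^sup>2) * (1 + 1/t * (1/z)\<^sup>2)))))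
      = indicator {0<..} t * ennreal (g (\<lambda>t. (1 + t * x\<^sup>2) * (1 + t * y\<^sup>2) * (1 + t * z\<^sup>2)) t)"
    if "x > 0" "y > 0" "z > 0" "x * y * z = a * b * c" for t x y z
    using recip[OF _ that(1-3), of t] that(4) by (cases "t > 0") (simp_all add: g_def)
  have g_int: "(\<integral>\<^sup>+t. indicator {0<..} t * ennreal (g P t) \<partial>lborel)
      = gauss_mean (1/a) (1/b) (1/c) * (\<integral>\<^sup>+t. indicator {0<..} t * ennreal ((1 - exp (- (1/t))) * t powr (-1/2)) \<partial>lborel)"
    "(\<integral>\<^sup>+t. indicator {0<..} t * ennreal (g P' t) \<partial>lborel)
      = gauss_mean (1/a') (1/b') (1/c') * (\<integral>\<^sup>+t. indicator {0<..} t * ennreal ((1 - exp (- (1/t))) * t powr (-1/2)) \<partial>lborel)"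
    unfolding gauss_mean_reciprocal_heat
    using g_eq[OF pos(1-3)] g_eq[OF pos(4-6)] prod by (simp_all add: P_def[abs_def] P'_def[abs_def])
  have f_nn: "0 \<le> f Q t" if "1 \<le> Q t" for Q t
    unfolding f_def by (rule nonneg[OF that]) simp
  have g_nn: "0 \<le> g P t" "0 \<le> g P' t" if "t > 0" for t
  proof -
    have "0 \<le> g (\<lambda>t. (1 + t * x\<^sup>2) * (1 + t * y\<^sup>2) * (1 + t * z\<^sup>2)) t"
      if "x > 0" "y > 0" "z > 0" "x * y * z = a * b * c" for x y z
      using nonneg[OF ge1[of "1/t" "1/x" "1/y" "1/z"], of "t powr (-1/2)"] \<open>t > 0\<close>
        recip[OF \<open>t > 0\<close> that(1-3)] that(4) by (simp add: g_def)
    then show "0 \<le> g P t" "0 \<le> g P' t"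
      using pos prod by (simp_all add: P_def[abs_def] P'_def[abs_def])
  qed
  have diff_f: "f P' t - f P t = t powr (-3/2) * u t" for t
    unfolding u_def f_def by (simp add: algebra_simps)
  have diff_g: "g P' t - g P t = a * b * c * (t * u t)" if "t > 0" for t
  proof -
    have "t powr (-1/2) * t powr (3/2) = t" using that by (simp flip: powr_add)
    then have "g Q t = pi * sqrt pi * (t powr (-1/2) - a * b * c * t / sqrt (Q t))" for Q
      by (simp add: g_def right_diff_distrib)
    then show ?thesis by (simp add: u_def algebra_simps)
  qed
  have f_fin: "(\<integral>\<^sup>+t. indicator {0<..} t * ennreal (f P' t) \<partial>lborel) < \<infinity>"
    unfolding f_int using gauss_mean_finite[of a' b' c'] finite_heat_const by (simp add: ennreal_mult_less_top)
  have g_fin: "(\<integral>\<^sup>+t. indicator {0<..} t * ennreal (g P' t) \<partial>lborel) < \<infinity>"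
    unfolding g_int using gauss_mean_finite[of "1/a'" "1/b'" "1/c'"] finite_reciprocal_heat_const
    by (simp add: ennreal_mult_less_top)
  have f_same: "(\<integral>\<^sup>+t. indicator {0<..} t * ennreal (f P' t) \<partial>lborel) = (\<integral>\<^sup>+t. indicator {0<..} t * ennreal (f P t) \<partial>lborel)"
    unfolding f_int eq by (rule refl)
  have g_same: "(\<integral>\<^sup>+t. indicator {0<..} t * ennreal (g P' t) \<partial>lborel) = (\<integral>\<^sup>+t. indicator {0<..} t * ennreal (g P t) \<partial>lborel)"
    unfolding g_int eq_inv by (rule refl)
  have F: "integrable lborel (\<lambda>t. indicator {0<..} t * (f P' t - f P t))"
    "(LINT t|lborel. indicator {0<..} t * (f P' t - f P t)) = 0"
    by (rule integral_diff_eq_0_of_nn_integral_eq[OF _ _ _ _ f_same f_fin]; simp add: f_nn P1)+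
  have G: "integrable lborel (\<lambda>t. indicator {0<..} t * (g P' t - g P t))"
    "(LINT t|lborel. indicator {0<..} t * (g P' t - g P t)) = 0"
    by (rule integral_diff_eq_0_of_nn_integral_eq[OF _ _ _ _ g_same g_fin]; simp add: g_nn)+
  have ind_g: "indicator {0<..} t * (g P' t - g P t) = a * b * c * (indicator {0<..} t * (t * u t))" for t
    by (cases "t > 0") (simp_all add: diff_g)
  have abc: "a * b * c \<noteq> 0" using pos by simp
  have "d1 = 0 \<and> d2 = 0"
  proof (rule moments_vanish_imp_eq)
    show "integrable lborel (\<lambda>t. indicator {0<..} t * (t powr (-3/2) * u t))"
      "(LINT t|lborel. indicator {0<..} t * (t powr (-3/2) * u t)) = 0"
      using F unfolding diff_f .
    show "integrable lborel (\<lambda>t. indicator {0<..} t * (t * u t))"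
      "(LINT t|lborel. indicator {0<..} t * (t * u t)) = 0"
      using G abc unfolding ind_g by simp_all
    fix t :: real assume t: "t > 0"
    \<comment> \<open>Equal volume makes the cubic coefficients equal, so only two terms of the difference remain.\<close>
    have "(a * b * c)\<^sup>2 = (a' * b' * c')\<^sup>2" using prod by simp
    then have diff: "P' t - P t = t * (d1 + d2 * t)"
      unfolding P_def P'_def d1_def d2_def by (simp add: algebra_simps power2_eq_square)
    have p: "P t > 0" "P' t > 0" using P1[OF t] by auto
    have "sgn (u t) = sgn (1 / sqrt (P t) - 1 / sqrt (P' t))"
      by (simp add: u_def sgn_mult)
    also have "\<dots> = sgn (P' t - P t)"
      using p by (cases "P t" "P' t" rule: linorder_cases) (auto simp: frac_less2 divide_strict_left_mono)
    also have "\<dots> = sgn (d1 + d2 * t)"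
      unfolding diff using t by (simp add: sgn_mult)
    finally show "sgn (u t) = sgn (d1 + d2 * t)" .
  qed
  then show "a\<^sup>2 + b\<^sup>2 + c\<^sup>2 = a'\<^sup>2 + b'\<^sup>2 + c'\<^sup>2"
    and "a\<^sup>2 * b\<^sup>2 + a\<^sup>2 * c\<^sup>2 + b\<^sup>2 * c\<^sup>2 = a'\<^sup>2 * b'\<^sup>2 + a'\<^sup>2 * c'\<^sup>2 + b'\<^sup>2 * c'\<^sup>2"
    by (simp_all add: d1_def d2_def)
qed

section \<open>Congruence\<close>

definition congruent_sets :: "(real^3) set \<Rightarrow> (real^3) set \<Rightarrow> bool" where
  "congruent_sets S T \<longleftrightarrow> (\<exists>f. isometry f \<and> f ` S = T)"

lemma congruent_sets_trans: "congruent_sets S T \<Longrightarrow> congruent_sets T U \<Longrightarrow> congruent_sets S U"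
  unfolding congruent_sets_def
proof (elim exE conjE)
  fix f g assume "isometry f" "f ` S = T" "isometry g" "g ` T = U"
  then have "isometry (g \<circ> f) \<and> (g \<circ> f) ` S = U"
    by (auto intro: isometry_compose)
  then show "\<exists>f. isometry f \<and> f ` S = U" by (rule exI[of _ "g \<circ> f"])
qed

lemma congruent_sets_sym: "congruent_sets S T \<Longrightarrow> congruent_sets T S"
  unfolding congruent_sets_def
proof (elim exE conjE)
  fix f assume f: "isometry f" "f ` S = T"
  obtain g where g: "isometry g" "\<And>x. g (f x) = x" "\<And>x. f (g x) = x"
    by (rule isometry_inverse[OF f(1)]) (rule that)
  have "g ` T = S" unfolding f(2)[symmetric] image_image g(2) by simp
  with g(1) show "\<exists>f. isometry f \<and> f ` T = S" by blast
qed

lemma congruent_sets_refl: "congruent_sets S S"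
  unfolding congruent_sets_def by (rule exI[of _ id]) (simp add: isometry_def)

lemma dist_real_3: "dist (x::real^3) y = sqrt ((x$1 - y$1)\<^sup>2 + (x$2 - y$2)\<^sup>2 + (x$3 - y$3)\<^sup>2)"
  by (rule real_sqrt_unique[symmetric]) (simp_all add: dist_norm norm_sq_real_3)

lemma congruent_swap12: "congruent_sets (axis_ellipsoid a b c) (axis_ellipsoid b a c)"
proof -
  let ?f = "\<lambda>x::real^3. vector [x$2, x$1, x$3] :: real^3"
  have inv: "?f (?f x) = x" for x by (simp add: vec_eq_iff forall_3)
  have "isometry ?f"
    unfolding isometry_def
    by (intro conjI allI surjI[of ?f ?f] inv) (simp add: dist_real_3 add_ac)
  moreover have "?f ` axis_ellipsoid a b c = axis_ellipsoid b a c"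
  proof (intro set_eqI iffI)
    fix x assume "x \<in> axis_ellipsoid b a c"
    then show "x \<in> ?f ` axis_ellipsoid a b c"
      by (intro image_eqI[of _ _ "?f x"]) (simp only: inv, simp add: axis_ellipsoid_def add_ac)
  qed (auto simp: axis_ellipsoid_def add_ac)
  ultimately show ?thesis unfolding congruent_sets_def by blast
qed

lemma congruent_swap23: "congruent_sets (axis_ellipsoid a b c) (axis_ellipsoid a c b)"
proof -
  let ?f = "\<lambda>x::real^3. vector [x$1, x$3, x$2] :: real^3"
  have inv: "?f (?f x) = x" for x by (simp add: vec_eq_iff forall_3)
  have "isometry ?f"
    unfolding isometry_def
    by (intro conjI allI surjI[of ?f ?f] inv) (simp add: dist_real_3 add_ac)
  moreover have "?f ` axis_ellipsoid a b c = axis_ellipsoid a c b"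
  proof (intro set_eqI iffI)
    fix x assume "x \<in> axis_ellipsoid a c b"
    then show "x \<in> ?f ` axis_ellipsoid a b c"
      by (intro image_eqI[of _ _ "?f x"]) (simp only: inv, simp add: axis_ellipsoid_def add_ac)
  qed (auto simp: axis_ellipsoid_def add_ac)
  ultimately show ?thesis unfolding congruent_sets_def by blast
qed

text \<open>Both \<open>y\<close> and \<open>y'\<close> are roots of the same quadratic polynomial.\<close>

lemma same_symmetric_functions_2:
  fixes y z y' z' :: real
  assumes "y + z = y' + z'" "y * z = y' * z'"
  shows "(y' = y \<and> z' = z) \<or> (y' = z \<and> z' = y)"
proof -
  have "(y' - y) * (y' - z) = y' * y' - y' * (y + z) + y * z" by (simp add: algebra_simps)
  also have "\<dots> = 0" unfolding assms by (simp add: algebra_simps)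
  finally have "y' = y \<or> y' = z" by simp
  then show ?thesis using assms(1) by auto
qed

text \<open>The other two squared semiaxes have the same sum and product, hence agree up to order.\<close>

lemma congruent_of_common_axis:
  assumes pos: "a > 0" "b > 0" "c > 0" "b' > 0" "c' > 0"
    and e1: "b\<^sup>2 + c\<^sup>2 = b'\<^sup>2 + c'\<^sup>2" and e3: "a * b * c = a * b' * c'"
  shows "congruent_sets (axis_ellipsoid a b c) (axis_ellipsoid a b' c')"
proof -
  have "b * c = b' * c'" using e3 pos by (simp add: mult.assoc)
  then have "b\<^sup>2 * c\<^sup>2 = b'\<^sup>2 * c'\<^sup>2" by (metis power_mult_distrib)
  from same_symmetric_functions_2[OF e1 this] have "(b' = b \<and> c' = c) \<or> (b' = c \<and> c' = b)"
    using pos by (auto simp: power2_eq_iff_nonneg)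
  then show ?thesis using congruent_sets_refl congruent_swap23 by auto
qed

text \<open>The squared semiaxes are the roots of the same cubic polynomial, so the ellipsoids share a semiaxis, which a permutation of coordinates moves to the first place.\<close>

lemma congruent_of_symmetric_functions:
  assumes pos: "a > 0" "b > 0" "c > 0" "a' > 0" "b' > 0" "c' > 0"
    and e1: "a\<^sup>2 + b\<^sup>2 + c\<^sup>2 = a'\<^sup>2 + b'\<^sup>2 + c'\<^sup>2"
    and e2: "a\<^sup>2 * b\<^sup>2 + a\<^sup>2 * c\<^sup>2 + b\<^sup>2 * c\<^sup>2 = a'\<^sup>2 * b'\<^sup>2 + a'\<^sup>2 * c'\<^sup>2 + b'\<^sup>2 * c'\<^sup>2"
    and e3: "a * b * c = a' * b' * c'"
  shows "congruent_sets (axis_ellipsoid a b c) (axis_ellipsoid a' b' c')"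
proof -
  have e3': "a\<^sup>2 * b\<^sup>2 * c\<^sup>2 = a'\<^sup>2 * b'\<^sup>2 * c'\<^sup>2" using e3 by (metis power_mult_distrib)
  have "(X - x) * (X - y) * (X - z) = X^3 - X\<^sup>2 * (x + y + z) + X * (x*y + x*z + y*z) - x*y*z" for X x y z :: real
    by (simp add: algebra_simps power2_eq_square power3_eq_cube)
  note viete = this
  have "(a'\<^sup>2 - a\<^sup>2) * (a'\<^sup>2 - b\<^sup>2) * (a'\<^sup>2 - c\<^sup>2) = (a'\<^sup>2 - a'\<^sup>2) * (a'\<^sup>2 - b'\<^sup>2) * (a'\<^sup>2 - c'\<^sup>2)"
    unfolding viete e1 e2 e3' by (rule refl)
  then have "a'\<^sup>2 = a\<^sup>2 \<or> a'\<^sup>2 = b\<^sup>2 \<or> a'\<^sup>2 = c\<^sup>2" by auto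
  then have "a' = a \<or> a' = b \<or> a' = c" using pos by (simp add: power2_eq_iff_nonneg)
  then consider "a' = a" | "a' = b" | "a' = c" by blast
  then show ?thesis
  proof cases
    case 1
    then show ?thesis using congruent_of_common_axis[of a b c b' c'] pos e1 e3 by simp
  next
    case 2
    then have "congruent_sets (axis_ellipsoid b a c) (axis_ellipsoid a' b' c')"
      using congruent_of_common_axis[of b a c b' c'] pos e1 e3 by (simp add: mult_ac)
    with congruent_swap12 show ?thesis by (rule congruent_sets_trans)
  next
    case 3
    then have "congruent_sets (axis_ellipsoid c a b) (axis_ellipsoid a' b' c')"
      using congruent_of_common_axis[of c a b b' c'] pos e1 e3 by (simp add: mult_ac)
    with congruent_sets_trans[OF congruent_swap23 congruent_swap12] show ?thesis by (rule congruent_sets_trans)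
  qed
qed

theorem theorem1:
  fixes E1 E2 :: "(real^3) set"
  assumes "ellipsoid E1" and "ellipsoid E2"
    and "emeasure lebesgue E1 = emeasure lebesgue E2"
    and "surface_area E1 = surface_area E2"
    and "mean_width E1 = mean_width E2"
  shows "\<exists>f. isometry f \<and> f ` E1 = E2"
proof -
  obtain f a b c where f: "isometry f" and pos: "a > 0" "b > 0" "c > 0"
    and E1: "E1 = f ` axis_ellipsoid a b c"
    using assms(1) by (auto simp: ellipsoid_def)
  obtain g a' b' c' where g: "isometry g" and pos': "a' > 0" "b' > 0" "c' > 0"
    and E2: "E2 = g ` axis_ellipsoid a' b' c'"
    using assms(2) by (auto simp: ellipsoid_def)
  let ?m = "\<lambda>a b c. \<integral>\<^sup>+u. ennreal (norm (scale3 a b c u)) \<partial>uniform_sphere"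
  have B: "emeasure lborel (cball (0::real^3) 1) \<noteq> 0" "emeasure lborel (cball (0::real^3) 1) \<noteq> top"
  proof -
    have "emeasure lborel (ball (0::real^3) 1) \<le> emeasure lborel (cball (0::real^3) 1)"
      by (intro emeasure_mono) auto
    then show "emeasure lborel (cball (0::real^3) 1) \<noteq> 0" using unit_ball_volume(1) by auto
    show "emeasure lborel (cball (0::real^3) 1) \<noteq> top" using emeasure_bounded_finite[of "cball (0::real^3) 1"] by simp
  qed
  have "ennreal (a * b * c) = ennreal (a' * b' * c')"
    using assms(3) B unfolding E1 E2 emeasure_lebesgue_ellipsoid[OF f pos] emeasure_lebesgue_ellipsoid[OF g pos']
    by (simp add: mult.commute[of _ "emeasure lborel (cball (0::real^3) 1)"] ennreal_mult_cancel_left)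
  then have vol: "a * b * c = a' * b' * c'" using pos pos' by simp
  have "2 * ?m a b c = 2 * ?m a' b' c'"
    using mean_width_ellipsoid(1)[OF f pos] mean_width_ellipsoid(1)[OF g pos'] assms(5) by (simp add: E1 E2)
  then have mean: "?m a b c = ?m a' b' c'" by (simp add: ennreal_mult_cancel_left)
  have surf: "surface_area (h ` axis_ellipsoid p q r) = area (sphere (0::real^3) 1) * (ennreal (p * q * r) * ?m (1/p) (1/q) (1/r))"
    if h: "isometry h" and p: "p > 0" "q > 0" "r > 0" for h p q r
  proof -
    have "surface_area (h ` axis_ellipsoid p q r) = area (scale3 p q r ` sphere 0 1)"
      unfolding surface_area_def frontier_isometric_image[OF h] frontier_axis_ellipsoid[OF p]
      using h by (intro area_isometric_image) (simp add: isometry_def)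
    then show ?thesis using area_scaled_sphere[OF p] by simp
  qed
  have "area (sphere (0::real^3) 1) * (ennreal (a * b * c) * ?m (1/a) (1/b) (1/c))
      = area (sphere (0::real^3) 1) * (ennreal (a * b * c) * ?m (1/a') (1/b') (1/c'))"
    using assms(4) surf[OF f pos] surf[OF g pos'] vol by (simp add: E1 E2)
  then have mean_inv: "?m (1/a) (1/b) (1/c) = ?m (1/a') (1/b') (1/c')"
    using area_sphere_positive less_imp_neq[OF area_sphere_finite] pos
    by (simp add: ennreal_mult_cancel_left)
  have inv: "1/a > 0" "1/b > 0" "1/c > 0" "1/a' > 0" "1/b' > 0" "1/c' > 0" using pos pos' by simp_all
  have G: "gauss_mean a b c = gauss_mean a' b' c'"
    using gauss_mean_eq_sphere_mean[OF pos] gauss_mean_eq_sphere_mean[OF pos'] mean by simp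
  have G': "gauss_mean (1/a) (1/b) (1/c) = gauss_mean (1/a') (1/b') (1/c')"
    using gauss_mean_eq_sphere_mean[OF inv(1-3)] gauss_mean_eq_sphere_mean[OF inv(4-6)] mean_inv by simp
  have "congruent_sets (axis_ellipsoid a b c) (axis_ellipsoid a' b' c')"
    by (rule congruent_of_symmetric_functions[OF pos pos'
      gauss_means_determine_symmetric_functions[OF pos pos' vol G G'] vol])
  moreover have "congruent_sets (axis_ellipsoid a b c) E1" "congruent_sets (axis_ellipsoid a' b' c') E2"
    using f g E1 E2 by (auto simp: congruent_sets_def)
  ultimately have "congruent_sets E1 E2"
    using congruent_sets_trans congruent_sets_sym by blast
  then show ?thesis by (simp add: congruent_sets_def)
qed

end
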